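(* Let $\Omega\subset\mathbb{R}^N$, $s$, $\Sigma_{\mathcal D}$, $\Sigma_{\mathcal N}$ satisfy the standing assumptions in the context. Let $k\geq 2$ and let $\Lambda_k$ be an eigenvalue of multiplicity $m\in\mathbb{N}$ of the problem $$(-\Delta)^s u=\lambda u\ \text{ in }\Omega,\qquad B(u)=0\ \text{ on }\partial\Omega,$$ i.e. $\Lambda_{k-1}<\Lambda_k=\dots=\Lambda_{k+m-1}<\Lambda_{k+m}$. Set $$\delta_k:=\min\left\{\frac{\Lambda_k-\Lambda_{k-1}}{\Lambda_{k-1}+|\Omega|^{-\frac{2s}{N}}\widetilde S(\Sigma_{\mathcal D})},\ \frac{\Lambda_{k+m}-\Lambda_k}{\Lambda_{k+m}}\right\}|\Omega|^{-\frac{2s}{N}}\,\widetilde S(\Sigma_{\mathcal D}).$$ Then, for every $\lambda\in(\Lambda_k-\delta_k,\Lambda_k)$, the problem $$(-\Delta)^s u=\lambda u+|u|^{2_s^*-2}u\ \text{ in }\Omega,\qquad B(u)=0\ \text{ on }\partial\Omega$$ has at least two (weak) solutions.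
   Context: Standing assumptions. $s\in(1/2,1)$, $N>2s$, $2_s^*=\frac{2N}{N-2s}$. $\Omega\subset\mathbb{R}^N$ is a bounded domain with smooth boundary (in particular a bounded Lipschitz domain), with outward unit normal $\nu$; $\Sigma_{\mathcal D},\Sigma_{\mathcal N}$ are smooth $(N-1)$-dimensional submanifolds of $\partial\Omega$; $\Sigma_{\mathcal D}$ is a closed manifold with $(N-1)$-dimensional measure $|\Sigma_{\mathcal D}|=\alpha\in(0,|\partial\Omega|)$; $\Sigma_{\mathcal D}\cap\Sigma_{\mathcal N}=\emptyset$, $\Sigma_{\mathcal D}\cup\Sigma_{\mathcal N}=\partial\Omega$, and $\Sigma_{\mathcal D}\cap\overline{\Sigma}_{\mathcal N}=\Gamma$ is a smooth $(N-2)$-dimensional submanifold of $\partial\Omega$. $|\Omega|$ is the $N$-dimensional Lebesgue measure of $\Omega$. The mixed boundary operator is $B(u)=u\chi_{\Sigma_{\mathcal D}}+\frac{\partial u}{\partial\nu}\chi_{\Sigma_{\mathcal N}}$, where $\chi_A$ is the characteristic function of $A$. Spectral fractional Laplacian. Let $(\lambda_i,\varphi_i)_{i\ge1}$ be the eigenvalues (nondecreasing, repeated according to multiplicity) and the eigenfunctions, normalized in $L^2(\Omega)$ (forming an orthonormal basis of $L^2(\Omega)$), of $-\Delta$ in $\Omega$ with the homogeneous mixed boundary condition $B(u)=0$. Then $(-\Delta)^s u=\sum_{j\ge1}\lambda_j^s\langle u,\varphi_j\rangle_2\varphi_j$, with $\langle\cdot,\cdot\rangle_2$ the $L^2(\Omega)$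 scalar product (and similarly for $(-\Delta)^{s/2}$, with $\lambda_j^{s/2}$). The energy space is $$H^s_{\Sigma_{\mathcal D}}(\Omega)=\Big\{u=\sum_{j\ge1}a_j\varphi_j\in L^2(\Omega):\ u=0\text{ on }\Sigma_{\mathcal D},\ \|u\|^2_{H^s_{\Sigma_{\mathcal D}}}:=\sum_{j\ge1}a_j^2\lambda_j^s<+\infty\Big\},$$ a Hilbert space with scalar product $\langle u,v\rangle_{H^s_{\Sigma_{\mathcal D}}}=\langle(-\Delta)^{s/2}u,(-\Delta)^{s/2}v\rangle_2$, continuously embedded in $L^{2_s^*}(\Omega)$. The eigenvalues of $(-\Delta)^s$ with the boundary condition $B(u)=0$ are $\Lambda_k=\lambda_k^s$, $0<\Lambda_1<\Lambda_2\le\dots\le\Lambda_k\le\dots\to+\infty$, counted with multiplicity, with eigenfunctions $\varphi_k$. For $k\ge2$, $\Lambda_k$ is said to have multiplicity $m\in\mathbb N$ if $\Lambda_{k-1}<\Lambda_k=\dots=\Lambda_{k+m-1}<\Lambda_{k+m}$. Sobolev constant: $\widetilde S(\Sigma_{\mathcal D})=\inf\big\{\|u\|^2_{H^s_{\Sigma_{\mathcal D}}}/\|u\|^2_{L^{2_s^*}(\Omega)}:\ u\in H^s_{\Sigma_{\mathcal D}}(\Omega),\ u\not\equiv0\big\}>0$. Weak solution: $u\in H^s_{\Sigma_{\mathcal D}}(\Omega)$ is a (weak) solution of $(-\Delta)^su=\lambda u+|u|^{2_s^*-2}u$ in $\Omega$, $B(u)=0$ on $\partial\Omega$, if for all $v\in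 H^s_{\Sigma_{\mathcal D}}(\Omega)$ $$\int_\Omega(-\Delta)^{s/2}u\,(-\Delta)^{s/2}v\,dx=\lambda\int_\Omega uv\,dx+\int_\Omega|u|^{2_s^*-2}uv\,dx.$$ *)

theory Defs
  imports "HOL-Analysis.Analysis"
begin

section \<open>Smooth functions, domains and submanifolds of Euclidean space\<close>

primrec Ck_on :: "nat \<Rightarrow> 'a::euclidean_space set \<Rightarrow> ('a \<Rightarrow> 'b::real_normed_vector) \<Rightarrow> bool" where
  "Ck_on 0 U f \<longleftrightarrow> continuous_on U f"
| "Ck_on (Suc k) U f \<longleftrightarrow> (\<forall>x\<in>U. f differentiable (at x)) \<and>
     (\<forall>e\<in>Basis. Ck_on k U (\<lambda>x. frechet_derivative f (at x) e))"

text \<open>Only meant for open \<open>U\<close>.\<close>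

definition smooth_on :: "'a::euclidean_space set \<Rightarrow> ('a \<Rightarrow> 'b::real_normed_vector) \<Rightarrow> bool" where
  "smooth_on U f \<longleftrightarrow> (\<forall>k. Ck_on k U f)"

definition smooth_diffeomorphism ::
  "'a::euclidean_space set \<Rightarrow> 'a set \<Rightarrow> ('a \<Rightarrow> 'a) \<Rightarrow> ('a \<Rightarrow> 'a) \<Rightarrow> bool" where
  "smooth_diffeomorphism U V F G \<longleftrightarrow>
     open U \<and> open V \<and> homeomorphism U V F G \<and> smooth_on U F \<and> smooth_on V G"

definition smooth_boundary :: "'a::euclidean_space set \<Rightarrow> bool" where
  "smooth_boundary \<Omega> \<longleftrightarrow>
     (\<forall>p\<in>frontier \<Omega>. \<exists>U V F G e. p \<in> U \<and> smooth_diffeomorphism U V F G \<and>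
        e \<noteq> 0 \<and> F ` (\<Omega> \<inter> U) = {y\<in>V. 0 < e \<bullet> y})"

text \<open>Embedded smooth submanifolds of dimension \<open>d\<close>; the second predicate allows a
  (possibly empty) smooth boundary.\<close>

definition smooth_submanifold :: "nat \<Rightarrow> 'a::euclidean_space set \<Rightarrow> bool" where
  "smooth_submanifold d M \<longleftrightarrow>
     (\<forall>p\<in>M. \<exists>U V F G T. p \<in> U \<and> smooth_diffeomorphism U V F G \<and>
        subspace T \<and> dim T = d \<and> F ` (M \<inter> U) = V \<inter> T)"

definition smooth_submanifold_with_boundary :: "nat \<Rightarrow> 'a::euclidean_space set \<Rightarrow> bool" where
  "smooth_submanifold_with_boundary d M \<longleftrightarrow>
     (\<forall>p\<in>M. \<exists>U V F G T. p \<in> U \<and> smooth_diffeomorphism U V F G \<and>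
        subspace T \<and> dim T = d \<and>
        (F ` (M \<inter> U) = V \<inter> T \<or>
         (\<exists>e\<in>T. e \<noteq> 0 \<and> F ` (M \<inter> U) = V \<inter> {y\<in>T. 0 \<le> e \<bullet> y})))"


section \<open>Surface measure\<close>

text \<open>The \<open>d\<close>-dimensional Hausdorff measure, normalised so that it agrees with the
  Riemannian volume on smooth \<open>d\<close>-dimensional submanifolds. The case distinction only
  matters for \<open>d = 0\<close>, where \<open>0 ^ 0 = 1\<close> would give the empty set a positive weight.\<close>

definition hausdorff_premeasure :: "nat \<Rightarrow> real \<Rightarrow> 'a::metric_space set \<Rightarrow> ennreal" where
  "hausdorff_premeasure d \<epsilon> A =
     (INF C \<in> {C :: nat \<Rightarrow> 'a set. A \<subseteq> (\<Union>i. C i) \<and> (\<forall>i. bounded (C i) \<and> diameter (C i) \<le> \<epsilon>)}.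
        \<Sum>i. if C i = {} then 0
            else ennreal (unit_ball_vol (real d) * (diameter (C i) / 2) ^ d))"

definition hausdorff_measure :: "nat \<Rightarrow> 'a::metric_space set \<Rightarrow> ennreal" where
  "hausdorff_measure d A = (SUP \<epsilon>\<in>{0<..}. hausdorff_premeasure d \<epsilon> A)"


section \<open>Square integrable functions and Sobolev spaces\<close>

text \<open>Elements of function spaces are represented by functions on the whole space, of which
  only the restriction to \<open>\<Omega>\<close>, up to null sets, is relevant.\<close>

definition L2 :: "'a::euclidean_space set \<Rightarrow> ('a \<Rightarrow> 'b::euclidean_space) set" where
  "L2 \<Omega> = {f \<in> borel_measurable (lebesgue_on \<Omega>).
            integrable (lebesgue_on \<Omega>) (\<lambda>x. (norm (f x))\<^sup>2)}"

definition L2_inner ::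
  "'a::euclidean_space set \<Rightarrow> ('a \<Rightarrow> 'b::euclidean_space) \<Rightarrow> ('a \<Rightarrow> 'b) \<Rightarrow> real" where
  "L2_inner \<Omega> f g = (LINT x|lebesgue_on \<Omega>. f x \<bullet> g x)"

text \<open>Only meant for \<open>F n\<close> and \<open>f\<close> in \<open>L2 \<Omega>\<close>, since the integral of a non-integrable function is
  \<open>0\<close> by convention.\<close>

definition L2_tendsto ::
  "'a::euclidean_space set \<Rightarrow> (nat \<Rightarrow> 'a \<Rightarrow> 'b::euclidean_space) \<Rightarrow> ('a \<Rightarrow> 'b) \<Rightarrow> bool" where
  "L2_tendsto \<Omega> F f \<longleftrightarrow> (\<lambda>n. LINT x|lebesgue_on \<Omega>. (norm (F n x - f x))\<^sup>2) \<longlonglongrightarrow> 0"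

definition grad :: "(real^'n \<Rightarrow> real) \<Rightarrow> real^'n \<Rightarrow> real^'n" where
  "grad f x = (\<chi> i. frechet_derivative f (at x) (axis i 1))"

definition test_function :: "(real^'n) set \<Rightarrow> (real^'n \<Rightarrow> real) \<Rightarrow> bool" where
  "test_function \<Omega> \<psi> \<longleftrightarrow>
     smooth_on UNIV \<psi> \<and> compact (closure {x. \<psi> x \<noteq> 0}) \<and> closure {x. \<psi> x \<noteq> 0} \<subseteq> \<Omega>"

definition has_weak_grad ::
  "(real^'n) set \<Rightarrow> (real^'n \<Rightarrow> real) \<Rightarrow> (real^'n \<Rightarrow> real^'n) \<Rightarrow> bool" where
  "has_weak_grad \<Omega> u g \<longleftrightarrow>
     (\<forall>\<psi>. test_function \<Omega> \<psi> \<longrightarrow>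
        (LINT x|lebesgue_on \<Omega>. u x *\<^sub>R grad \<psi> x) = - (LINT x|lebesgue_on \<Omega>. \<psi> x *\<^sub>R g x))"

definition H1 :: "(real^'n) set \<Rightarrow> (real^'n \<Rightarrow> real) set" where
  "H1 \<Omega> = {u \<in> L2 \<Omega>. \<exists>g \<in> L2 \<Omega>. has_weak_grad \<Omega> u g}"

definition weak_grad :: "(real^'n) set \<Rightarrow> (real^'n \<Rightarrow> real) \<Rightarrow> real^'n \<Rightarrow> real^'n" where
  "weak_grad \<Omega> u = (SOME g. g \<in> L2 \<Omega> \<and> has_weak_grad \<Omega> u g)"

text \<open>For a closed part \<open>D\<close> of the boundary of \<open>\<Omega>\<close>, with complementary part \<open>N\<close>, the
  restrictions to \<open>\<Omega>\<close> of the following functions make up the space of smooth functions with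
  compact support in \<open>\<Omega> \<union> N\<close>.\<close>

definition smooth_vanishing_near :: "(real^'n) set \<Rightarrow> (real^'n \<Rightarrow> real) \<Rightarrow> bool" where
  "smooth_vanishing_near D \<psi> \<longleftrightarrow>
     smooth_on UNIV \<psi> \<and> compact (closure {x. \<psi> x \<noteq> 0}) \<and> closure {x. \<psi> x \<noteq> 0} \<inter> D = {}"

text \<open>The space of functions in \<open>H1 \<Omega>\<close> with zero trace on \<open>D\<close>, as a closure in the norm of
  \<open>H1 \<Omega>\<close>.\<close>

definition H1_zero_on :: "(real^'n) set \<Rightarrow> (real^'n) set \<Rightarrow> (real^'n \<Rightarrow> real) set" where
  "H1_zero_on \<Omega> D =
     {u \<in> H1 \<Omega>. \<exists>\<psi>. (\<forall>n. smooth_vanishing_near D (\<psi> n)) \<and>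
        L2_tendsto \<Omega> \<psi> u \<and> L2_tendsto \<Omega> (\<lambda>n. grad (\<psi> n)) (weak_grad \<Omega> u)}"


section \<open>The mixed Dirichlet-Neumann Laplacian and its fractional powers\<close>

text \<open>Weak form of \<open>- \<Delta>u = \<mu> u\<close> in \<open>\<Omega>\<close>, \<open>u = 0\<close> on \<open>D\<close>, \<open>\<partial>u/\<partial>\<nu> = 0\<close> on the rest of the
  boundary. The Neumann condition is the natural one: it is encoded in the fact that the
  test functions are not required to vanish off \<open>D\<close>.\<close>

definition mixed_laplace_solution ::
  "(real^'n) set \<Rightarrow> (real^'n) set \<Rightarrow> real \<Rightarrow> (real^'n \<Rightarrow> real) \<Rightarrow> bool" where
  "mixed_laplace_solution \<Omega> D \<mu> u \<longleftrightarrow>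
     u \<in> H1_zero_on \<Omega> D \<and>
     (\<forall>v \<in> H1_zero_on \<Omega> D. L2_inner \<Omega> (weak_grad \<Omega> u) (weak_grad \<Omega> v) = \<mu> * L2_inner \<Omega> u v)"

text \<open>Sequences are indexed from \<open>1\<close>; their values at index \<open>0\<close> are irrelevant. Since the
  eigenfunctions form a Hilbert basis, \<open>ev\<close> lists all eigenvalues with their multiplicities.\<close>

definition mixed_laplace_eigensystem ::
  "(real^'n) set \<Rightarrow> (real^'n) set \<Rightarrow> (nat \<Rightarrow> real) \<Rightarrow> (nat \<Rightarrow> real^'n \<Rightarrow> real) \<Rightarrow> bool" where
  "mixed_laplace_eigensystem \<Omega> D ev \<phi> \<longleftrightarrow>
     (\<forall>i\<ge>1. mixed_laplace_solution \<Omega> D (ev i) (\<phi> i)) \<and>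
     (\<forall>i\<ge>1. \<forall>j\<ge>i. ev i \<le> ev j) \<and>
     (\<forall>i\<ge>1. \<forall>j\<ge>1. L2_inner \<Omega> (\<phi> i) (\<phi> j) = (if i = j then 1 else 0)) \<and>
     (\<forall>u \<in> L2 \<Omega>. L2_tendsto \<Omega> (\<lambda>n x. \<Sum>j=1..n. L2_inner \<Omega> u (\<phi> j) * \<phi> j x) u)"

text \<open>The operator with symbol \<open>ev j powr s\<close>, well defined up to null sets on the functions for
  which the series converges; \<open>s / 2\<close> in place of \<open>s\<close> gives the half power.\<close>

definition frac_laplacian ::
  "(real^'n) set \<Rightarrow> (nat \<Rightarrow> real) \<Rightarrow> (nat \<Rightarrow> real^'n \<Rightarrow> real) \<Rightarrow> real \<Rightarrow>
   (real^'n \<Rightarrow> real) \<Rightarrow> real^'n \<Rightarrow> real" where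
  "frac_laplacian \<Omega> ev \<phi> s u =
     (SOME w. w \<in> L2 \<Omega> \<and>
        L2_tendsto \<Omega> (\<lambda>n x. \<Sum>j=1..n. ev j powr s * L2_inner \<Omega> u (\<phi> j) * \<phi> j x) w)"

definition finite_energy ::
  "(real^'n) set \<Rightarrow> (nat \<Rightarrow> real) \<Rightarrow> (nat \<Rightarrow> real^'n \<Rightarrow> real) \<Rightarrow> real \<Rightarrow>
   (real^'n \<Rightarrow> real) \<Rightarrow> bool" where
  "finite_energy \<Omega> ev \<phi> s u \<longleftrightarrow>
     u \<in> L2 \<Omega> \<and> (\<lambda>j. (L2_inner \<Omega> u (\<phi> j))\<^sup>2 * ev j powr s) summable_on {1..}"

definition energy_norm_sq ::
  "(real^'n) set \<Rightarrow> (nat \<Rightarrow> real) \<Rightarrow> (nat \<Rightarrow> real^'n \<Rightarrow> real) \<Rightarrow> real \<Rightarrow>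
   (real^'n \<Rightarrow> real) \<Rightarrow> real" where
  "energy_norm_sq \<Omega> ev \<phi> s u = (\<Sum>\<^sub>\<infinity>j\<in>{1..}. (L2_inner \<Omega> u (\<phi> j))\<^sup>2 * ev j powr s)"

text \<open>The condition \<open>u = 0\<close> on \<open>D\<close> is understood, as in \<open>H1_zero_on\<close>, as approximability in
  the norm of the space by smooth functions vanishing near \<open>D\<close>.\<close>

definition Hs ::
  "(real^'n) set \<Rightarrow> (real^'n) set \<Rightarrow> (nat \<Rightarrow> real) \<Rightarrow> (nat \<Rightarrow> real^'n \<Rightarrow> real) \<Rightarrow> real \<Rightarrow>
   (real^'n \<Rightarrow> real) set" where
  "Hs \<Omega> D ev \<phi> s =
     {u. finite_energy \<Omega> ev \<phi> s u \<and>
        (\<exists>\<psi>. (\<forall>n. smooth_vanishing_near D (\<psi> n) \<and> finite_energy \<Omega> ev \<phi> s (\<psi> n)) \<and>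
             L2_tendsto \<Omega> \<psi> u \<and>
             (\<lambda>n. energy_norm_sq \<Omega> ev \<phi> s (\<lambda>x. \<psi> n x - u x)) \<longlonglongrightarrow> 0)}"

text \<open>The critical exponent \<open>2N/(N - 2s)\<close>.\<close>

definition crit_exp :: "nat \<Rightarrow> real \<Rightarrow> real" where
  "crit_exp N s = 2 * real N / (real N - 2 * s)"

text \<open>A function outside the Lebesgue space with the critical exponent would contribute the value
  \<open>0\<close> to the following infimum (its integral and the division by \<open>0\<close> both give \<open>0\<close>). This is
  the usual convention \<open>c/\<infinity> = 0\<close>; the Sobolev embedding excludes such functions.\<close>

definition sobolev_const ::
  "(real^'n) set \<Rightarrow> (real^'n) set \<Rightarrow> (nat \<Rightarrow> real) \<Rightarrow> (nat \<Rightarrow> real^'n \<Rightarrow> real) \<Rightarrow> real \<Rightarrow> real" where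
  "sobolev_const \<Omega> D ev \<phi> s =
     Inf {energy_norm_sq \<Omega> ev \<phi> s u /
            ((LINT x|lebesgue_on \<Omega>. \<bar>u x\<bar> powr crit_exp CARD('n) s)
               powr (1 / crit_exp CARD('n) s))\<^sup>2 |
          u. u \<in> Hs \<Omega> D ev \<phi> s \<and> \<not> (AE x in lebesgue_on \<Omega>. u x = 0)}"

text \<open>Weak solutions of \<open>(- \<Delta>)\<^sup>s u = \<mu> u + |u|\<^sup>p\<^sup>-\<^sup>2 u\<close> for the critical exponent \<open>p\<close>, with mixed
  boundary condition.\<close>

definition weak_solution ::
  "(real^'n) set \<Rightarrow> (real^'n) set \<Rightarrow> (nat \<Rightarrow> real) \<Rightarrow> (nat \<Rightarrow> real^'n \<Rightarrow> real) \<Rightarrow> real \<Rightarrow> real \<Rightarrow>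
   (real^'n \<Rightarrow> real) \<Rightarrow> bool" where
  "weak_solution \<Omega> D ev \<phi> s \<mu> u \<longleftrightarrow>
     u \<in> Hs \<Omega> D ev \<phi> s \<and>
     (\<forall>v \<in> Hs \<Omega> D ev \<phi> s.
        (LINT x|lebesgue_on \<Omega>.
           frac_laplacian \<Omega> ev \<phi> (s / 2) u x * frac_laplacian \<Omega> ev \<phi> (s / 2) v x) =
        \<mu> * (LINT x|lebesgue_on \<Omega>. u x * v x) +
        (LINT x|lebesgue_on \<Omega>. \<bar>u x\<bar> powr (crit_exp CARD('n) s - 2) * u x * v x))"

end

theory Submission
  imports Defs "HOL-Library.Diagonal_Subsequence" "HOL-Computational_Algebra.Polynomial"
begin

text \<open>Since the nonlinearity is odd, a nontrivial solution \<open>u\<close> comes with the second one \<open>- u\<close>, and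
  the point is to find one nontrivial solution.

  Write \<open>p\<close> for the critical exponent, \<open>N u\<close> for the squared norm of \<open>u\<close> in \<open>L\<^sup>p\<close>, \<open>E u\<close> for the energy
  and \<open>Q u = E u - \<mu> \<parallel>u\<parallel>\<^sup>2\<close>. The first term of the minimum in \<open>\<delta>\<close> yields \<open>\<Lambda> (k - 1) < \<mu> < \<Lambda> k\<close>, so
  that \<open>Q\<close> is negative definite on the span \<open>H\<^sup>-\<close> of the first \<open>k - 1\<close> eigenfunctions and positive
  definite on its orthogonal complement \<open>H\<^sup>+\<close>. Let \<open>c\<close> be the least number such that every \<open>u\<close> in \<open>H\<^sup>+\<close>
  has some \<open>v\<close> in \<open>H\<^sup>-\<close> with \<open>N (u + v) \<le> c Q (u + v)\<close>; its inverse is the linking level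
  \<open>inf\<^sub>u sup\<^sub>v Q (u + v) / N (u + v)\<close>. Taking \<open>u\<close> to be the \<open>k\<close>-th eigenfunction and using Hoelder's
  inequality, the second term of the minimum in \<open>\<delta>\<close> yields \<open>1 / c < S\<close>
  (\<open>admissible_lower_bound\<close>), the condition under which no energy can concentrate.

  Let \<open>u\<^sub>n\<close> in \<open>H\<^sup>+\<close> with \<open>Q u\<^sub>n = 1\<close> violate the defining property for numbers \<open>c\<^sub>n < c\<close> tending to \<open>c\<close>,
  let \<open>u\<close> be a weak limit and \<open>\<rho>\<close> the limit of the energies of \<open>u\<^sub>n - u\<close>. The upper half of the
  Brezis-Lieb lemma (\<open>brezis_lieb_upper\<close>) and the Sobolev inequality give
  \<open>c (Q (u + v) + \<rho>) \<le> \<rho> / S + N (u + v)\<close> for every \<open>v\<close> in \<open>H\<^sup>-\<close>. For the \<open>v\<close> provided by the choice of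
  \<open>c\<close> this reads \<open>(c - 1 / S) \<rho> \<le> 0\<close>, whence \<open>\<rho> = 0\<close>: the limit \<open>u\<close> is not zero, and \<open>N - c Q\<close> has
  minimum \<open>0\<close> on \<open>u + H\<^sup>-\<close> (\<open>minimax_attained\<close>). The minimiser \<open>z\<close> is a critical point of \<open>N - c Q\<close>:
  in the directions of \<open>H\<^sup>-\<close> because it minimises, in those of \<open>H\<^sup>+\<close> because the minimum over
  \<open>u + t h + H\<^sup>-\<close> is never positive and is attained near \<open>z\<close> for small \<open>t\<close> (\<open>N_difference_bound\<close>,
  \<open>euler_lagrange\<close>). The resulting equation for \<open>z\<close> is the one in question up to a positive
  factor in front of the nonlinearity, which is removed by rescaling.

  The analytic input about the domain enters through the constant \<open>S\<close>. It is positive because \<open>\<delta>\<close>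
  is, and this contains the Sobolev inequality (\<open>sobolev_inequality\<close>). That inequality forces the
  eigenvalues to tend to infinity, for otherwise \<open>L\<^sup>2\<close> would be contained in \<open>L\<^sup>p\<close> (\<open>Lam_at_top\<close>), and
  unbounded eigenvalues make sets of bounded energy compact in \<open>L\<^sup>2\<close> (\<open>compactness\<close>). Finally, the
  energy space consists of all functions of finite energy (\<open>Hs_iff\<close>): the gradients of the
  eigenfunctions are orthogonal, so that Bessel's inequality bounds the energy by the norm of
  \<open>H1\<close>, in which the eigenfunctions are limits of smooth functions vanishing near the Dirichlet
  part.\<close>

section \<open>Square integrable functions\<close>

text \<open>On Lebesgue measure restricted to \<open>\<Omega>\<close> these are \<open>L2\<close> and \<open>L2_inner\<close>. The variational part of the
  proof takes place on an arbitrary finite measure space.\<close>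

definition sqint :: "'a measure \<Rightarrow> ('a \<Rightarrow> 'b::euclidean_space) set" where
  "sqint M = {f \<in> borel_measurable M. integrable M (\<lambda>x. (norm (f x))\<^sup>2)}"

definition ip :: "'a measure \<Rightarrow> ('a \<Rightarrow> 'b::euclidean_space) \<Rightarrow> ('a \<Rightarrow> 'b) \<Rightarrow> real" where
  "ip M f g = (LINT x|M. f x \<bullet> g x)"

definition sq :: "'a measure \<Rightarrow> ('a \<Rightarrow> 'b::euclidean_space) \<Rightarrow> real" where
  "sq M f = (LINT x|M. (norm (f x))\<^sup>2)"

lemma sqintD[measurable_dest]: "f \<in> sqint M \<Longrightarrow> f \<in> borel_measurable M"
  by (simp add: sqint_def)

lemma sqint_integrable_sq: "f \<in> sqint M \<Longrightarrow> integrable M (\<lambda>x. (norm (f x))\<^sup>2)"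
  by (simp add: sqint_def)

lemma ip_integrable:
  assumes "f \<in> sqint M" "g \<in> sqint M"
  shows "integrable M (\<lambda>x. f x \<bullet> g x)"
proof (rule Bochner_Integration.integrable_bound)
  show "integrable M (\<lambda>x. (norm (f x))\<^sup>2 + (norm (g x))\<^sup>2)"
    using assms by (auto intro: sqint_integrable_sq)
  show "(\<lambda>x. f x \<bullet> g x) \<in> borel_measurable M"
    using assms by (auto dest!: sqintD)
  have "\<bar>a \<bullet> b\<bar> \<le> (norm a)\<^sup>2 + (norm b)\<^sup>2" for a b :: 'b
  proof -
    have "\<bar>a \<bullet> b\<bar> \<le> norm a * norm b" by (rule Cauchy_Schwarz_ineq2)
    also have "\<dots> \<le> (norm a)\<^sup>2 + (norm b)\<^sup>2"
    proof -
      have "0 \<le> norm a * norm b" by simp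
      then show ?thesis using sum_squares_bound[of "norm a" "norm b"] by linarith
    qed
    finally show ?thesis .
  qed
  then show "AE x in M. norm (f x \<bullet> g x) \<le> norm ((norm (f x))\<^sup>2 + (norm (g x))\<^sup>2)"
    by auto
qed

lemma sq_eq_ip: "sq M f = ip M f f"
  by (simp add: sq_def ip_def power2_norm_eq_inner)

lemma sq_nonneg: "0 \<le> sq M f"
  by (simp add: sq_def)

lemma ip_commute: "ip M f g = ip M g f"
  by (simp add: ip_def inner_commute)

lemma sqint_zero[simp, intro]: "(\<lambda>x. 0) \<in> sqint M"
  by (simp add: sqint_def)

lemma sqint_scale:
  assumes "f \<in> sqint M" shows "(\<lambda>x. c *\<^sub>R f x) \<in> sqint M"
  using assms by (auto simp: sqint_def power_mult_distrib)

lemma sqint_add: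
  assumes "f \<in> sqint M" "g \<in> sqint M" shows "(\<lambda>x. f x + g x) \<in> sqint M"
proof -
  have [measurable]: "f \<in> borel_measurable M" "g \<in> borel_measurable M"
    using assms by (auto dest: sqintD)
  have "integrable M (\<lambda>x. (norm (f x))\<^sup>2 + 2 * (f x \<bullet> g x) + (norm (g x))\<^sup>2)"
    using assms by (intro Bochner_Integration.integrable_add integrable_mult_right sqint_integrable_sq ip_integrable)
  moreover have "(norm (f x + g x))\<^sup>2 = (norm (f x))\<^sup>2 + 2 * (f x \<bullet> g x) + (norm (g x))\<^sup>2" for x
    by (simp add: power2_norm_eq_inner inner_add inner_commute)
  ultimately show ?thesis by (simp add: sqint_def)
qed

lemma sqint_diff:
  assumes "f \<in> sqint M" "g \<in> sqint M" shows "(\<lambda>x. f x - g x) \<in> sqint M"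
  using sqint_add[OF assms(1) sqint_scale[OF assms(2), of "-1"]] by simp

lemma sqint_sum:
  assumes "\<And>i. i \<in> I \<Longrightarrow> f i \<in> sqint M" shows "(\<lambda>x. \<Sum>i\<in>I. f i x) \<in> sqint M"
  using assms
proof (induction I rule: infinite_finite_induct)
  case (insert i I)
  have "(\<lambda>x. f i x + (\<Sum>i\<in>I. f i x)) \<in> sqint M"
    using insert by (intro sqint_add) auto
  then show ?case using insert by simp
qed simp_all

lemma sqint_cmult: "f \<in> sqint M \<Longrightarrow> (\<lambda>x. c * f x :: real) \<in> sqint M"
  using sqint_scale[of f M c] by simp

lemma ip_add_left:
  "f \<in> sqint M \<Longrightarrow> g \<in> sqint M \<Longrightarrow> h \<in> sqint M \<Longrightarrow> ip M (\<lambda>x. f x + g x) h = ip M f h + ip M g h"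
  by (simp add: ip_def inner_add_left Bochner_Integration.integral_add ip_integrable)

lemma ip_diff_left:
  "f \<in> sqint M \<Longrightarrow> g \<in> sqint M \<Longrightarrow> h \<in> sqint M \<Longrightarrow> ip M (\<lambda>x. f x - g x) h = ip M f h - ip M g h"
  by (simp add: ip_def inner_diff_left Bochner_Integration.integral_diff ip_integrable)

lemma ip_scale_left: "ip M (\<lambda>x. c *\<^sub>R f x) h = c * ip M f h"
  by (simp add: ip_def)

lemma ip_cmult_left: "ip M (\<lambda>x. c * f x) h = c * ip M f h" for f :: "'a \<Rightarrow> real"
  using ip_scale_left[of M c f h] by simp

lemma ip_zero_left[simp]: "ip M (\<lambda>x. 0) h = 0"
  by (simp add: ip_def)

lemma ip_sum_left:
  assumes "\<And>i. i \<in> I \<Longrightarrow> f i \<in> sqint M" "h \<in> sqint M"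
  shows "ip M (\<lambda>x. \<Sum>i\<in>I. f i x) h = (\<Sum>i\<in>I. ip M (f i) h)"
  using assms(1)
proof (induction I rule: infinite_finite_induct)
  case (insert i I)
  have "ip M (\<lambda>x. f i x + (\<Sum>i\<in>I. f i x)) h = ip M (f i) h + ip M (\<lambda>x. \<Sum>i\<in>I. f i x) h"
    using insert.prems by (intro ip_add_left assms(2) sqint_sum) auto
  then show ?case using insert by simp
qed simp_all

lemma ip_add_right:
  "f \<in> sqint M \<Longrightarrow> g \<in> sqint M \<Longrightarrow> h \<in> sqint M \<Longrightarrow> ip M h (\<lambda>x. f x + g x) = ip M h f + ip M h g"
  using ip_add_left[of f M g h] by (simp add: ip_commute[of M h])

lemma ip_diff_right:
  "f \<in> sqint M \<Longrightarrow> g \<in> sqint M \<Longrightarrow> h \<in> sqint M \<Longrightarrow> ip M h (\<lambda>x. f x - g x) = ip M h f - ip M h g"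
  using ip_diff_left[of f M g h] by (simp add: ip_commute[of M h])

lemma ip_CS:
  assumes f: "f \<in> sqint M" and g: "g \<in> sqint M"
  shows "(ip M f g)\<^sup>2 \<le> sq M f * sq M g"
proof -
  have *: "0 \<le> sq M f - 2 * t * ip M f g + t\<^sup>2 * sq M g" for t
  proof -
    have tg: "(\<lambda>x. t *\<^sub>R g x) \<in> sqint M" using g by (rule sqint_scale)
    from f tg have d: "(\<lambda>x. f x - t *\<^sub>R g x) \<in> sqint M" by (rule sqint_diff)
    have "sq M (\<lambda>x. f x - t *\<^sub>R g x) = ip M f (\<lambda>x. f x - t *\<^sub>R g x) - t * ip M g (\<lambda>x. f x - t *\<^sub>R g x)"
      using ip_diff_left[OF f tg d] by (simp add: sq_eq_ip ip_scale_left)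
    also have "ip M f (\<lambda>x. f x - t *\<^sub>R g x) = sq M f - t * ip M f g"
      using ip_diff_left[OF f tg f] ip_commute[of M f "\<lambda>x. f x - t *\<^sub>R g x"] ip_commute[of M g f]
      by (simp add: sq_eq_ip ip_scale_left)
    also have "ip M g (\<lambda>x. f x - t *\<^sub>R g x) = ip M f g - t * sq M g"
      using ip_diff_left[OF f tg g] ip_commute[of M g "\<lambda>x. f x - t *\<^sub>R g x"]
      by (simp add: sq_eq_ip ip_scale_left)
    finally have "sq M (\<lambda>x. f x - t *\<^sub>R g x) = sq M f - 2 * t * ip M f g + t\<^sup>2 * sq M g"
      by (simp add: algebra_simps power2_eq_square)
    then show ?thesis using sq_nonneg[of M "\<lambda>x. f x - t *\<^sub>R g x"] by simp
  qed
  show ?thesis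
  proof (cases "sq M g = 0")
    case True
    have "ip M f g = 0"
    proof (rule ccontr)
      assume n: "ip M f g \<noteq> 0"
      have "0 \<le> sq M f - 2 * ((sq M f + 1) / (2 * ip M f g)) * ip M f g"
        using *[of "(sq M f + 1) / (2 * ip M f g)"] True by simp
      also have "2 * ((sq M f + 1) / (2 * ip M f g)) * ip M f g = sq M f + 1"
        using n by simp
      finally show False by simp
    qed
    then show ?thesis using True by simp
  next
    case False
    then have pos: "sq M g > 0" using sq_nonneg[of M g] by simp
    have "0 \<le> (sq M f - 2 * (ip M f g / sq M g) * ip M f g + (ip M f g / sq M g)\<^sup>2 * sq M g) * sq M g"
      using *[of "ip M f g / sq M g"] pos by (intro mult_nonneg_nonneg) auto
    also have "\<dots> = sq M f * sq M g - 2 * (ip M f g / sq M g * sq M g) * ip M f g + (ip M f g / sq M g * sq M g)\<^sup>2"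
      by (simp add: algebra_simps power2_eq_square)
    also have "ip M f g / sq M g * sq M g = ip M f g"
      using pos by simp
    also have "sq M f * sq M g - 2 * ip M f g * ip M f g + (ip M f g)\<^sup>2 = sq M f * sq M g - (ip M f g)\<^sup>2"
      by (simp add: power2_eq_square)
    finally show ?thesis by simp
  qed
qed

lemma ip_abs_le: "f \<in> sqint M \<Longrightarrow> g \<in> sqint M \<Longrightarrow> \<bar>ip M f g\<bar> \<le> sqrt (sq M f) * sqrt (sq M g)"
  using real_sqrt_le_mono[OF ip_CS[of f M g]] by (simp add: real_sqrt_mult)

lemma sq_add_expand:
  assumes "f \<in> sqint M" "g \<in> sqint M"
  shows "sq M (\<lambda>x. f x + g x) = sq M f + 2 * ip M f g + sq M g"
proof -
  have "sq M (\<lambda>x. f x + g x) = ip M f (\<lambda>x. f x + g x) + ip M g (\<lambda>x. f x + g x)"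
    using assms by (simp add: sq_eq_ip ip_add_left sqint_add)
  then show ?thesis
    using assms ip_commute[of M g f] by (simp add: ip_add_right sq_eq_ip)
qed

lemma sq_scale: "sq M (\<lambda>x. c *\<^sub>R f x) = c\<^sup>2 * sq M f"
  by (simp add: sq_def power_mult_distrib)

lemma sq_diff_expand:
  assumes "f \<in> sqint M" "g \<in> sqint M"
  shows "sq M (\<lambda>x. f x - g x) = sq M f - 2 * ip M f g + sq M g"
proof -
  have "sq M (\<lambda>x. f x + (-1) *\<^sub>R g x) = sq M f + 2 * ip M f (\<lambda>x. (-1) *\<^sub>R g x) + sq M (\<lambda>x. (-1) *\<^sub>R g x)"
    using assms by (intro sq_add_expand sqint_scale)
  then show ?thesis unfolding sq_scale ip_commute[of M f "\<lambda>x. (-1) *\<^sub>R g x"] ip_scale_left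
    by (simp add: ip_commute)
qed

lemma sq_diff_commute: "sq M (\<lambda>x. f x - g x) = sq M (\<lambda>x. g x - f x)"
  by (simp add: sq_def norm_minus_commute)

text \<open>For a common factor this is the Cauchy-Schwarz inequality; the two factors are exchanged for
  their limits one after the other.\<close>

lemma ip_tendsto:
  assumes F: "\<And>n. F n \<in> sqint M" "f \<in> sqint M" "(\<lambda>n. sq M (\<lambda>x. F n x - f x)) \<longlonglongrightarrow> 0"
    and G: "\<And>n. G n \<in> sqint M" "g \<in> sqint M" "(\<lambda>n. sq M (\<lambda>x. G n x - g x)) \<longlonglongrightarrow> 0"
  shows "(\<lambda>n. ip M (F n) (G n)) \<longlonglongrightarrow> ip M f g"
proof -
  define a where "a n = sqrt (sq M (\<lambda>x. F n x - f x))" for n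
  define b where "b n = sqrt (sq M (\<lambda>x. G n x - g x))" for n
  have a: "a \<longlonglongrightarrow> 0" and b: "b \<longlonglongrightarrow> 0"
    unfolding a_def b_def using tendsto_real_sqrt[OF F(3)] tendsto_real_sqrt[OF G(3)] by simp_all
  have *: "\<bar>ip M (F n) (G n) - ip M f g\<bar> \<le> a n * b n + a n * sqrt (sq M g) + sqrt (sq M f) * b n" for n
  proof -
    have dF: "(\<lambda>x. F n x - f x) \<in> sqint M" and dG: "(\<lambda>x. G n x - g x) \<in> sqint M"
      using F G by (simp_all add: sqint_diff)
    have 1: "ip M (\<lambda>x. F n x - f x) (\<lambda>x. G n x - g x) = ip M (\<lambda>x. F n x - f x) (G n) - ip M (\<lambda>x. F n x - f x) g"
      by (rule ip_diff_right[OF G(1)[of n] G(2) dF])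
    have 2: "ip M (\<lambda>x. F n x - f x) (G n) = ip M (F n) (G n) - ip M f (G n)"
      by (rule ip_diff_left[OF F(1)[of n] F(2) G(1)])
    have 3: "ip M f (\<lambda>x. G n x - g x) = ip M f (G n) - ip M f g"
      by (rule ip_diff_right[OF G(1)[of n] G(2) F(2)])
    have "ip M (F n) (G n) - ip M f g = ip M (\<lambda>x. F n x - f x) (\<lambda>x. G n x - g x)
       + ip M (\<lambda>x. F n x - f x) g + ip M f (\<lambda>x. G n x - g x)"
      using 1 2 3 by simp
    moreover have "\<bar>ip M (\<lambda>x. F n x - f x) (\<lambda>x. G n x - g x)\<bar> \<le> a n * b n"
      unfolding a_def b_def by (rule ip_abs_le[OF dF dG])
    moreover have "\<bar>ip M (\<lambda>x. F n x - f x) g\<bar> \<le> a n * sqrt (sq M g)"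
      unfolding a_def by (rule ip_abs_le[OF dF G(2)])
    moreover have "\<bar>ip M f (\<lambda>x. G n x - g x)\<bar> \<le> sqrt (sq M f) * b n"
      unfolding b_def by (rule ip_abs_le[OF F(2) dG])
    ultimately show ?thesis by linarith
  qed
  have "(\<lambda>n. a n * b n + a n * sqrt (sq M g) + sqrt (sq M f) * b n) \<longlonglongrightarrow> 0 * 0 + 0 * sqrt (sq M g) + sqrt (sq M f) * 0"
    by (intro tendsto_add tendsto_mult tendsto_const a b)
  then have lim: "(\<lambda>n. a n * b n + a n * sqrt (sq M g) + sqrt (sq M f) * b n) \<longlonglongrightarrow> 0" by simp
  have "\<forall>\<^sub>F n in sequentially. norm (ip M (F n) (G n) - ip M f g)
      \<le> a n * b n + a n * sqrt (sq M g) + sqrt (sq M f) * b n"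
    unfolding real_norm_def by (rule always_eventually) (rule allI, rule *)
  from Lim_null_comparison[OF this lim] show ?thesis by (rule LIM_zero_cancel)
qed

lemma sq_eq_0_iff:
  assumes "f \<in> sqint M"
  shows "sq M f = 0 \<longleftrightarrow> (AE x in M. f x = 0)"
  unfolding sq_def using sqint_integrable_sq[OF assms]
  by (subst integral_nonneg_eq_0_iff_AE) auto

text \<open>Square integrable functions on a finite space are integrable, so that convergence in
  mean square yields convergence almost everywhere along a subsequence.\<close>

lemma (in finite_measure) sqint_imp_integrable:
  assumes "f \<in> sqint M" shows "integrable M f"
proof (rule Bochner_Integration.integrable_bound)
  show "integrable M (\<lambda>x. 1 + (norm (f x))\<^sup>2)" using assms by (auto intro: sqint_integrable_sq)
  have "t \<le> 1 + t\<^sup>2" for t :: real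
    using zero_le_power2[of "t - 1/2"] by (simp add: power2_eq_square algebra_simps)
  then show "AE x in M. norm (f x) \<le> norm (1 + (norm (f x))\<^sup>2)" by auto
qed (use assms in \<open>auto dest: sqintD\<close>)

lemma (in finite_measure) L1_le_L2:
  assumes "f \<in> sqint M" shows "(LINT x|M. norm (f x)) \<le> sqrt (measure M (space M)) * sqrt (sq M f)"
proof -
  have 1: "(\<lambda>x. norm (f x)) \<in> sqint M" "(\<lambda>x. 1::real) \<in> sqint M"
    using assms by (auto simp: sqint_def)
  have "\<bar>ip M (\<lambda>x. 1) (\<lambda>x. norm (f x))\<bar> \<le> sqrt (sq M (\<lambda>x. 1::real)) * sqrt (sq M (\<lambda>x. norm (f x)))"
    by (rule ip_abs_le[OF 1(2,1)])
  then show ?thesis by (simp add: ip_def sq_def)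
qed

lemma (in finite_measure) L2_AE_subseq:
  fixes f :: "nat \<Rightarrow> 'a \<Rightarrow> 'b::euclidean_space"
  assumes "\<And>n. f n \<in> sqint M" "(\<lambda>n. sq M (f n)) \<longlonglongrightarrow> 0"
  shows "\<exists>r::nat\<Rightarrow>nat. strict_mono r \<and> (AE x in M. (\<lambda>n. f (r n) x) \<longlonglongrightarrow> 0)"
proof (rule tendsto_L1_AE_subseq)
  show "integrable M (f n)" for n using assms sqint_imp_integrable by auto
  have "(\<lambda>n. sqrt (measure M (space M)) * sqrt (sq M (f n))) \<longlonglongrightarrow> sqrt (measure M (space M)) * sqrt 0"
    by (rule tendsto_mult[OF tendsto_const tendsto_real_sqrt[OF assms(2)]])
  then have lim: "(\<lambda>n. sqrt (measure M (space M)) * sqrt (sq M (f n))) \<longlonglongrightarrow> 0" by simp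
  show "(\<lambda>n. LINT x|M. norm (f n x)) \<longlonglongrightarrow> 0"
  proof (rule Lim_null_comparison[OF _ lim])
    show "\<forall>\<^sub>F n in sequentially. norm (LINT x|M. norm (f n x)) \<le> sqrt (measure M (space M)) * sqrt (sq M (f n))"
      using L1_le_L2[OF assms(1)] by (simp add: integral_nonneg_AE)
  qed
qed

section \<open>Functions expanded in an orthonormal basis\<close>

text \<open>Fatou's lemma for a sequence of real functions whose integrals have a common bound.\<close>

lemma fatou_real:
  fixes f :: "nat \<Rightarrow> 'a \<Rightarrow> real"
  assumes f: "\<And>k. integrable M (f k)" "\<And>k x. 0 \<le> f k x"
    and g: "g \<in> borel_measurable M" "\<And>x. 0 \<le> g x"
    and lim: "AE x in M. (\<lambda>k. f k x) \<longlonglongrightarrow> g x"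
    and C: "\<And>k. (LINT x|M. f k x) \<le> C"
  shows "integrable M g" "(LINT x|M. g x) \<le> C"
proof -
  have C0: "0 \<le> C" using C[of 0] Bochner_Integration.integral_nonneg[of M "f 0"] f(2) by fastforce
  have [measurable]: "f k \<in> borel_measurable M" "g \<in> borel_measurable M" for k using f g by auto
  have "(\<integral>\<^sup>+x. ennreal (g x) \<partial>M) = (\<integral>\<^sup>+x. liminf (\<lambda>k. ennreal (f k x)) \<partial>M)"
  proof (rule nn_integral_cong_AE)
    show "AE x in M. ennreal (g x) = liminf (\<lambda>k. ennreal (f k x))"
      using lim
    proof eventually_elim
      case (elim x)
      then have "(\<lambda>k. ennreal (f k x)) \<longlonglongrightarrow> ennreal (g x)" by (rule tendsto_ennrealI)
      then show ?case by (simp add: lim_imp_Liminf)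
    qed
  qed
  also have "\<dots> \<le> liminf (\<lambda>k. \<integral>\<^sup>+x. ennreal (f k x) \<partial>M)"
    by (rule nn_integral_liminf) auto
  also have "\<dots> \<le> ennreal C"
  proof (rule Liminf_le)
    show "\<forall>\<^sub>F k in sequentially. (\<integral>\<^sup>+x. ennreal (f k x) \<partial>M) \<le> ennreal C"
      using C f by (intro always_eventually allI) (subst nn_integral_eq_integral, auto intro: ennreal_leI)
  qed simp
  finally have *: "(\<integral>\<^sup>+x. ennreal (g x) \<partial>M) \<le> ennreal C" .
  show int: "integrable M g"
    by (rule integrableI_nonneg) (use g * le_less_trans in \<open>auto simp: top.not_eq_extremum[symmetric] top_unique\<close>)
  show "(LINT x|M. g x) \<le> C"
    using * int g C0 by (simp add: nn_integral_eq_integral)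
qed

locale sobolev_basis = finite_measure M for M :: "'a measure" +
  fixes \<phi> :: "nat \<Rightarrow> 'a \<Rightarrow> real" and \<Lambda> :: "nat \<Rightarrow> real"
  assumes basis_sqint: "\<phi> j \<in> sqint M"
    and orthonormal: "ip M (\<phi> i) (\<phi> j) = (if i = j then 1 else 0)"
    and complete: "u \<in> sqint M \<Longrightarrow> (\<lambda>n. sq M (\<lambda>x. (\<Sum>j<n. ip M u (\<phi> j) * \<phi> j x) - u x)) \<longlonglongrightarrow> 0"
    and Lam_mono: "i \<le> j \<Longrightarrow> \<Lambda> i \<le> \<Lambda> j"
    and Lam_pos: "0 < \<Lambda> j"
begin

definition co :: "('a \<Rightarrow> real) \<Rightarrow> nat \<Rightarrow> real" where
  "co u j = ip M u (\<phi> j)"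

text \<open>With \<open>\<Lambda> j\<close> the eigenvalues of a positive operator and \<open>\<phi> j\<close> its eigenfunctions, \<open>FE\<close> is the domain
  of the quadratic form of the operator and \<open>D\<close> the associated bilinear form.\<close>

definition FE :: "('a \<Rightarrow> real) \<Rightarrow> bool" where
  "FE u \<longleftrightarrow> u \<in> sqint M \<and> summable (\<lambda>j. \<Lambda> j * (co u j)\<^sup>2)"

definition D :: "('a \<Rightarrow> real) \<Rightarrow> ('a \<Rightarrow> real) \<Rightarrow> real" where
  "D u v = (\<Sum>j. \<Lambda> j * (co u j * co v j))"

definition expand :: "nat \<Rightarrow> (nat \<Rightarrow> real) \<Rightarrow> 'a \<Rightarrow> real" where
  "expand n a x = (\<Sum>j<n. a j * \<phi> j x)"

lemma co_add: "u \<in> sqint M \<Longrightarrow> v \<in> sqint M \<Longrightarrow> co (\<lambda>x. u x + v x) j = co u j + co v j"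
  unfolding co_def by (rule ip_add_left) (auto simp: basis_sqint)

lemma co_diff: "u \<in> sqint M \<Longrightarrow> v \<in> sqint M \<Longrightarrow> co (\<lambda>x. u x - v x) j = co u j - co v j"
  unfolding co_def by (rule ip_diff_left) (auto simp: basis_sqint)

lemma co_cmult: "co (\<lambda>x. c * u x) j = c * co u j"
  unfolding co_def by (rule ip_cmult_left)

lemma co_basis: "co (\<phi> i) j = (if i = j then 1 else 0)"
  unfolding co_def by (rule orthonormal)

lemma expand_sqint: "expand n a \<in> sqint M"
  unfolding expand_def by (intro sqint_sum sqint_cmult basis_sqint)

lemma ip_expand: "v \<in> sqint M \<Longrightarrow> ip M (expand n a) v = (\<Sum>j<n. a j * co v j)"
proof -
  assume v: "v \<in> sqint M"
  have "ip M (expand n a) v = (\<Sum>j<n. ip M (\<lambda>x. a j * \<phi> j x) v)"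
    unfolding expand_def by (rule ip_sum_left) (auto intro: sqint_cmult basis_sqint v)
  also have "\<dots> = (\<Sum>j<n. a j * co v j)"
    unfolding ip_cmult_left co_def ip_commute[of M v] ..
  finally show ?thesis .
qed

lemma co_expand: "co (expand n a) j = (if j < n then a j else 0)"
  unfolding co_def using ip_expand[OF basis_sqint] by (simp add: co_basis if_distrib cong: if_cong)

lemma parseval:
  assumes u: "u \<in> sqint M" and v: "v \<in> sqint M"
  shows "(\<lambda>j. co u j * co v j) sums ip M u v"
proof -
  have c: "(\<lambda>n. sq M (\<lambda>x. expand n (co u) x - u x)) \<longlonglongrightarrow> 0"
    using complete[OF u] unfolding expand_def co_def .
  have c2: "(\<lambda>n::nat. sq M (\<lambda>x. v x - v x)) \<longlonglongrightarrow> 0" by (simp add: sq_def)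
  have "(\<lambda>n. ip M (expand n (co u)) v) \<longlonglongrightarrow> ip M u v"
    by (rule ip_tendsto[OF expand_sqint u c v v c2])
  then show ?thesis unfolding sums_def ip_expand[OF v] .
qed

lemma parseval_sq: "u \<in> sqint M \<Longrightarrow> (\<lambda>j. (co u j)\<^sup>2) sums sq M u"
  using parseval[of u u] by (simp add: power2_eq_square sq_eq_ip)

lemma sq_expand: "sq M (expand n a) = (\<Sum>j<n. (a j)\<^sup>2)"
  unfolding sq_eq_ip ip_expand[OF expand_sqint] by (simp add: co_expand power2_eq_square)

lemma expand_diff: "m \<le> n \<Longrightarrow> expand n a x - expand m a x = expand n (\<lambda>j. if j < m then 0 else a j) x"
proof -
  assume mn: "m \<le> n"
  have "(\<Sum>j<n. (if j < m then 0 else a j) * \<phi> j x) = (\<Sum>j<n. a j * \<phi> j x - (if j < m then a j * \<phi> j x else 0))"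
    by (rule sum.cong) auto
  also have "\<dots> = (\<Sum>j<n. a j * \<phi> j x) - (\<Sum>j\<in>{j\<in>{..<n}. j < m}. a j * \<phi> j x)"
    unfolding sum_subtractf by (subst sum.inter_filter) auto
  also have "{j\<in>{..<n}. j < m} = {..<m}" using mn by auto
  finally show ?thesis unfolding expand_def by simp
qed

lemma sq_expand_diff:
  assumes "m \<le> n" shows "sq M (\<lambda>x. expand n a x - expand m a x) = (\<Sum>j=m..<n. (a j)\<^sup>2)"
proof -
  have "sq M (\<lambda>x. expand n a x - expand m a x) = (\<Sum>j<n. if j < m then 0 else (a j)\<^sup>2)"
    unfolding expand_diff[OF assms] sq_expand by (rule sum.cong) auto
  also have "\<dots> = (\<Sum>j\<in>{m..<n}. (a j)\<^sup>2)"
    by (rule sum.mono_neutral_cong_right) auto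
  finally show ?thesis .
qed

text \<open>The Riesz-Fischer theorem. Along a subsequence the expansions have summable consecutive distances
  in \<open>L\<^sup>1\<close> and thus converge almost everywhere; Fatou's lemma bounds the distance in \<open>L\<^sup>2\<close> from the
  limit by the tails of the series.\<close>

lemma riesz_fischer:
  assumes a: "summable (\<lambda>j. (a j)\<^sup>2)"
  shows "\<exists>u\<in>sqint M. \<forall>j. co u j = a j"
proof -
  define tail where "tail n = (\<Sum>j. (a (j + n))\<^sup>2)" for n
  have tail0: "tail \<longlonglongrightarrow> 0"
    unfolding tail_def using suminf_exist_split2[OF a] by simp
  have tail_bound: "(\<Sum>j=m..<n. (a j)\<^sup>2) \<le> tail m" for m n
  proof -
    have "(\<Sum>j=m..<n. (a j)\<^sup>2) = (\<Sum>j<n-m. (a (j + m))\<^sup>2)"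
      by (rule sum.reindex_bij_witness[of _ "\<lambda>j. j + m" "\<lambda>j. j - m"]) auto
    also have "\<dots> \<le> tail m"
      unfolding tail_def by (rule sum_le_suminf) (use a summable_iff_shift[of "\<lambda>j. (a j)\<^sup>2" m] in auto)
    finally show ?thesis .
  qed
  have "\<exists>N. \<forall>n\<ge>N. tail n < (1/4)^k" for k :: nat
    using tail0 by (intro order_tendstoD(2)[THEN eventually_sequentially[THEN iffD1]]) auto
  then obtain N where N: "\<And>k n. n \<ge> N k \<Longrightarrow> tail n < (1/4)^k" by metis
  \<comment> \<open>sums make the sequence of indices increasing\<close>
  define m where "m k = (\<Sum>i\<le>k. N i)" for k
  have mN: "N k \<le> m k" for k unfolding m_def by (rule member_le_sum) auto
  have mm: "m k \<le> m (Suc k)" for k unfolding m_def by simp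
  define g where "g k = expand (m k) a" for k
  have gs: "g k \<in> sqint M" for k unfolding g_def by (rule expand_sqint)
  have ds: "(\<lambda>x. g (Suc k) x - g k x) \<in> sqint M" for k by (intro sqint_diff gs)
  define C where "C = sqrt (measure M (space M))"
  have L1: "(LINT x|M. norm (g (Suc k) x - g k x)) \<le> C * (1/2)^k" for k
  proof -
    have "sq M (\<lambda>x. g (Suc k) x - g k x) \<le> (1/4)^k"
      unfolding g_def sq_expand_diff[OF mm] using tail_bound N[OF mN, of k] by (meson less_imp_le order_trans)
    then have "sqrt (sq M (\<lambda>x. g (Suc k) x - g k x)) \<le> sqrt ((1/4)^k)" by simp
    also have "sqrt ((1/4)^k) = (1/2::real)^k"
    proof -
      have "(1/4::real)^k = ((1/2)^k)\<^sup>2" by (simp add: power_mult[symmetric] power2_eq_square power_mult_distrib[symmetric])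
      then show ?thesis by simp
    qed
    finally show ?thesis
      using L1_le_L2[OF ds[of k]] unfolding C_def
      by (meson mult_left_mono order_trans real_sqrt_ge_zero measure_nonneg)
  qed
  have [measurable]: "g k \<in> borel_measurable M" for k using gs by (rule sqintD)
  have sumAE: "AE x in M. summable (\<lambda>k. norm (g (Suc k) x - g k x))"
  proof -
    have "(\<integral>\<^sup>+x. (\<Sum>k. ennreal (norm (g (Suc k) x - g k x))) \<partial>M)
        = (\<Sum>k. \<integral>\<^sup>+x. ennreal (norm (g (Suc k) x - g k x)) \<partial>M)"
      by (rule nn_integral_suminf) measurable
    also have "\<dots> \<le> (\<Sum>k. ennreal (C * (1/2)^k))"
    proof (rule suminf_le)
      show "(\<integral>\<^sup>+x. ennreal (norm (g (Suc k) x - g k x)) \<partial>M) \<le> ennreal (C * (1/2)^k)" for k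
        using sqint_imp_integrable[OF ds[of k]] L1[of k]
        by (subst nn_integral_eq_integral) (auto intro: ennreal_leI)
    qed auto
    also have "\<dots> = ennreal (\<Sum>k. C * (1/2)^k)"
      by (rule suminf_ennreal2) (auto simp: C_def intro!: summable_mult)
    also have "\<dots> < \<infinity>" by simp
    finally have "AE x in M. (\<Sum>k. ennreal (norm (g (Suc k) x - g k x))) \<noteq> \<infinity>"
      by (intro nn_integral_noteq_infinite) auto
    then show ?thesis
    proof eventually_elim
      case (elim x)
      then show ?case by (intro summable_suminf_not_top) (auto simp: top_ennreal_def[symmetric])
    qed
  qed
  define w where "w x = lim (\<lambda>k. g k x)" for x
  have [measurable]: "w \<in> borel_measurable M" unfolding w_def by measurable
  have lim: "AE x in M. (\<lambda>k. g k x) \<longlonglongrightarrow> w x"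
    using sumAE
  proof eventually_elim
    case (elim x)
    then have "summable (\<lambda>k. g (Suc k) x - g k x)" by (rule summable_norm_cancel)
    then have "(\<lambda>n. \<Sum>k<n. g (Suc k) x - g k x) \<longlonglongrightarrow> (\<Sum>k. g (Suc k) x - g k x)" by (rule summable_LIMSEQ)
    then have "(\<lambda>n. (g n x - g 0 x) + g 0 x) \<longlonglongrightarrow> (\<Sum>k. g (Suc k) x - g k x) + g 0 x"
      unfolding sum_lessThan_telescope[of "\<lambda>k. g k x"] by (rule tendsto_add[OF _ tendsto_const])
    then have "convergent (\<lambda>n. g n x)" by (auto simp: convergent_def)
    then show ?case unfolding w_def by (simp add: convergent_LIMSEQ_iff)
  qed
  have dist: "integrable M (\<lambda>x. (norm (w x - expand n a x))\<^sup>2)" "sq M (\<lambda>x. w x - expand n a x) \<le> tail n" for n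
  proof -
    have bound: "sq M (\<lambda>x. g k x - expand n a x) \<le> tail n + (if m k < n then tail (m k) else 0)" for k
    proof (cases "m k < n")
      case True
      have "0 \<le> tail n" using tail_bound[of n n] by simp
      then show ?thesis using True tail_bound[of "m k" n] unfolding g_def
        by (subst sq_diff_commute) (simp add: sq_expand_diff)
    next
      case False then show ?thesis unfolding g_def using tail_bound[of n "m k"] by (simp add: sq_expand_diff)
    qed
    have int: "integrable M (\<lambda>x. (norm (g k x - expand n a x))\<^sup>2)" for k
      by (intro sqint_integrable_sq sqint_diff gs expand_sqint)
    have [measurable]: "expand n a \<in> borel_measurable M" by (rule sqintD[OF expand_sqint])
    have AE: "AE x in M. (\<lambda>k. (norm (g (k + i) x - expand n a x))\<^sup>2) \<longlonglongrightarrow> (norm (w x - expand n a x))\<^sup>2" for i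
      using lim
    proof eventually_elim
      case (elim x)
      from LIMSEQ_ignore_initial_segment[OF elim, of i] show ?case
        by (intro tendsto_power tendsto_norm tendsto_diff tendsto_const)
    qed
    have *: "integrable M (\<lambda>x. (norm (w x - expand n a x))\<^sup>2) \<and>
         (LINT x|M. (norm (w x - expand n a x))\<^sup>2) \<le> tail n + (1/4)^i" for i
    proof -
      have b: "(LINT x|M. (norm (g (k + i) x - expand n a x))\<^sup>2) \<le> tail n + (1/4)^i" for k
      proof -
        have "m i \<le> m (k + i)" by (induction k) (use mm order_trans in auto)
        then have "tail (m (k+i)) < (1/4)^i" using N[of i "m (k+i)"] mN[of i] by simp
        moreover have p: "0 \<le> (1/4::real)^i" by simp
        ultimately have "(if m (k + i) < n then tail (m (k + i)) else 0) \<le> (1/4)^i"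
          by (cases "m (k + i) < n") (simp_all only: if_True if_False less_imp_le)
        then show ?thesis using bound[of "k+i"] unfolding sq_def by linarith
      qed
      show ?thesis
        by (intro conjI fatou_real[OF int _ _ _ AE b]) auto
    qed
    then show "integrable M (\<lambda>x. (norm (w x - expand n a x))\<^sup>2)" by blast
    have "(\<lambda>i. tail n + (1/4)^i) \<longlonglongrightarrow> tail n + 0"
      by (intro tendsto_add tendsto_const LIMSEQ_power_zero) simp
    then show "sq M (\<lambda>x. w x - expand n a x) \<le> tail n"
      unfolding sq_def using * by (intro LIMSEQ_le_const[of "\<lambda>i. tail n + (1/4)^i"]) auto
  qed
  have "w \<in> sqint M"
  proof -
    have "(\<lambda>x. w x - expand 0 a x) \<in> sqint M" using dist(1)[of 0] by (simp add: sqint_def expand_def)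
    then show ?thesis by (simp add: expand_def)
  qed
  moreover have "co w j = a j" for j
  proof -
    have "(\<lambda>n. sq M (\<lambda>x. expand n a x - w x)) \<longlonglongrightarrow> 0"
    proof (rule Lim_null_comparison[OF _ tail0])
      show "\<forall>\<^sub>F n in sequentially. norm (sq M (\<lambda>x. expand n a x - w x)) \<le> tail n"
        using dist(2) by (simp add: sq_diff_commute[of M w] sq_nonneg)
    qed
    moreover have "(\<lambda>n::nat. sq M (\<lambda>x. \<phi> j x - \<phi> j x)) \<longlonglongrightarrow> 0" by (simp add: sq_def)
    ultimately have "(\<lambda>n. ip M (expand n a) (\<phi> j)) \<longlonglongrightarrow> ip M w (\<phi> j)"
      by (rule ip_tendsto[OF expand_sqint \<open>w \<in> sqint M\<close> _ basis_sqint basis_sqint])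
    then have "(\<lambda>n. co (expand n a) j) \<longlonglongrightarrow> co w j" unfolding co_def .
    moreover have "(\<lambda>n. co (expand n a) j) \<longlonglongrightarrow> a j"
      by (rule tendsto_eventually) (auto simp: co_expand eventually_sequentially intro!: exI[of _ "Suc j"])
    ultimately show ?thesis by (rule LIMSEQ_unique)
  qed
  ultimately show ?thesis by blast
qed


section \<open>The energy form\<close>

abbreviation E :: "('a \<Rightarrow> real) \<Rightarrow> real" where "E u \<equiv> D u u"

lemma FE_sqint: "FE u \<Longrightarrow> u \<in> sqint M" by (simp add: FE_def)

lemma FE_D_summable:
  assumes "FE u" "FE v" shows "summable (\<lambda>j. \<Lambda> j * (co u j * co v j))"
proof (rule summable_comparison_test)
  show "summable (\<lambda>j. \<Lambda> j * (co u j)\<^sup>2 + \<Lambda> j * (co v j)\<^sup>2)"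
    using assms by (intro summable_add) (auto simp: FE_def)
  have "\<bar>\<Lambda> j * (co u j * co v j)\<bar> \<le> \<Lambda> j * (co u j)\<^sup>2 + \<Lambda> j * (co v j)\<^sup>2" for j
  proof -
    have *: "\<bar>a * b\<bar> \<le> a\<^sup>2 + b\<^sup>2" for a b :: real
    proof -
      have "0 \<le> \<bar>a\<bar> * \<bar>b\<bar>" by simp
      then show ?thesis using sum_squares_bound[of "\<bar>a\<bar>" "\<bar>b\<bar>"] unfolding abs_mult power2_abs by linarith
    qed
    have "\<bar>\<Lambda> j * (co u j * co v j)\<bar> = \<Lambda> j * \<bar>co u j * co v j\<bar>"
      using Lam_pos[of j] by (simp add: abs_mult)
    also have "\<dots> \<le> \<Lambda> j * ((co u j)\<^sup>2 + (co v j)\<^sup>2)"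
      using Lam_pos[of j] * by (intro mult_left_mono) auto
    finally show ?thesis by (simp add: distrib_left)
  qed
  then show "\<exists>N. \<forall>n\<ge>N. norm (\<Lambda> n * (co u n * co v n)) \<le> \<Lambda> n * (co u n)\<^sup>2 + \<Lambda> n * (co v n)\<^sup>2"
    by auto
qed

lemma D_sums: "FE u \<Longrightarrow> FE v \<Longrightarrow> (\<lambda>j. \<Lambda> j * (co u j * co v j)) sums D u v"
  unfolding D_def by (rule summable_sums[OF FE_D_summable])

lemma E_sums: "FE u \<Longrightarrow> (\<lambda>j. \<Lambda> j * (co u j)\<^sup>2) sums E u"
  using D_sums[of u u] by (simp add: power2_eq_square)

lemma E_nonneg: "FE u \<Longrightarrow> 0 \<le> E u"
  using E_sums[of u] Lam_pos by (intro sums_le[OF _ sums_zero E_sums]) (auto simp: less_imp_le)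

lemma FE_cmult: "FE u \<Longrightarrow> FE (\<lambda>x. c * u x)"
  unfolding FE_def co_cmult
  using summable_mult[of "\<lambda>j. \<Lambda> j * (co u j)\<^sup>2" "c\<^sup>2"]
  by (auto simp: sqint_cmult power_mult_distrib mult_ac)

lemma FE_add: assumes u: "FE u" and v: "FE v" shows "FE (\<lambda>x. u x + v x)"
proof -
  have s: "u \<in> sqint M" "v \<in> sqint M" using assms by (auto simp: FE_def)
  have "summable (\<lambda>j. \<Lambda> j * (co u j)\<^sup>2 + 2 * (\<Lambda> j * (co u j * co v j)) + \<Lambda> j * (co v j)\<^sup>2)"
    using u v by (intro summable_add summable_mult FE_D_summable) (auto simp: FE_def)
  moreover have "\<Lambda> j * (co (\<lambda>x. u x + v x) j)\<^sup>2
      = \<Lambda> j * (co u j)\<^sup>2 + 2 * (\<Lambda> j * (co u j * co v j)) + \<Lambda> j * (co v j)\<^sup>2" for j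
    unfolding co_add[OF s] by (simp add: power2_eq_square algebra_simps)
  ultimately show ?thesis using s by (simp add: FE_def sqint_add)
qed

lemma FE_diff: assumes u: "FE u" and v: "FE v" shows "FE (\<lambda>x. u x - v x)"
  using FE_add[OF u FE_cmult[OF v, of "-1"]] by simp

lemma FE_expand: "FE (expand n a)"
  unfolding FE_def
proof (intro conjI expand_sqint summable_finite[of "{..<n}"])
qed (auto simp: co_expand)

lemma D_commute: "D u v = D v u"
  by (simp add: D_def mult.commute)

lemma D_add_left:
  assumes "FE u" "FE v" "FE w" shows "D (\<lambda>x. u x + v x) w = D u w + D v w"
proof -
  have "(\<lambda>j. \<Lambda> j * (co u j * co w j) + \<Lambda> j * (co v j * co w j)) sums (D u w + D v w)"
    by (intro sums_add D_sums assms)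
  moreover have "\<Lambda> j * (co (\<lambda>x. u x + v x) j * co w j) = \<Lambda> j * (co u j * co w j) + \<Lambda> j * (co v j * co w j)" for j
    using assms by (simp add: co_add FE_sqint algebra_simps)
  ultimately show ?thesis using D_sums[OF FE_add[OF assms(1,2)] assms(3)] by (simp add: sums_iff)
qed

lemma D_cmult_left: "D (\<lambda>x. c * u x) w = c * D u w" if "FE u" "FE w"
  using sums_mult[OF D_sums[OF that], of c] unfolding D_def[of "\<lambda>x. c * u x"] co_cmult
  by (simp add: sums_iff mult_ac)

lemma D_add_right: "FE u \<Longrightarrow> FE v \<Longrightarrow> FE w \<Longrightarrow> D w (\<lambda>x. u x + v x) = D w u + D w v"
  unfolding D_commute[of w] by (rule D_add_left)

lemma D_cmult_right: "FE u \<Longrightarrow> FE w \<Longrightarrow> D w (\<lambda>x. c * u x) = c * D w u"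
  unfolding D_commute[of w] by (rule D_cmult_left)

lemma E_add: "FE u \<Longrightarrow> FE v \<Longrightarrow> E (\<lambda>x. u x + v x) = E u + 2 * D u v + E v"
  using D_commute[of v u] by (simp add: D_add_left D_add_right FE_add)

lemma E_cmult: "FE u \<Longrightarrow> E (\<lambda>x. c * u x) = c\<^sup>2 * E u"
  by (simp add: D_cmult_left D_cmult_right FE_cmult power2_eq_square)

text \<open>A form of the Cauchy-Schwarz inequality: the energy of \<open>\<plusminus> t u + v\<close> is nonnegative. The weight \<open>t\<close> is
  free, so that one of the two energies may be merely bounded when the other is small.\<close>

lemma D_bound:
  assumes u: "FE u" and v: "FE v" and t: "0 < t"
  shows "2 * t * \<bar>D u v\<bar> \<le> t\<^sup>2 * E u + E v"
proof -
  have *: "0 \<le> c\<^sup>2 * E u + 2 * c * D u v + E v" for c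
    using E_nonneg[OF FE_add[OF FE_cmult[OF u, of c] v]]
    by (simp add: E_add E_cmult FE_cmult u v D_cmult_left)
  from *[of t] *[of "-t"] t show ?thesis by (cases "0 \<le> D u v") auto
qed

lemma E_add_le: "FE u \<Longrightarrow> FE v \<Longrightarrow> E (\<lambda>x. u x + v x) \<le> 2 * E u + 2 * E v"
  using D_bound[of u v 1] by (simp add: E_add)

lemma sq_le_E: "FE u \<Longrightarrow> \<Lambda> 0 * sq M u \<le> E u"
  by (rule sums_le[OF _ sums_mult[OF parseval_sq] E_sums])
    (auto simp: FE_sqint Lam_mono mult_right_mono)

lemma E_tail:
  assumes "FE u"
  shows "(\<lambda>n. E (\<lambda>x. u x - expand n (co u) x)) \<longlonglongrightarrow> 0"
proof -
  have "E (\<lambda>x. u x - expand n (co u) x) = E u - (\<Sum>j<n. \<Lambda> j * (co u j)\<^sup>2)" for n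
  proof -
    have 1: "(\<lambda>j. \<Lambda> j * (co u j)\<^sup>2 - (if j < n then \<Lambda> j * (co u j)\<^sup>2 else 0)) sums (E u - (\<Sum>j<n. \<Lambda> j * (co u j)\<^sup>2))"
      using sums_If_finite_set[of "{..<n}" "\<lambda>j. \<Lambda> j * (co u j)\<^sup>2"]
      by (intro sums_diff E_sums assms) (simp add: lessThan_def)
    have 2: "(\<lambda>j. \<Lambda> j * (co (\<lambda>x. u x - expand n (co u) x) j)\<^sup>2) sums E (\<lambda>x. u x - expand n (co u) x)"
      by (intro E_sums FE_diff FE_expand assms)
    have "\<Lambda> j * (co (\<lambda>x. u x - expand n (co u) x) j)\<^sup>2 = \<Lambda> j * (co u j)\<^sup>2 - (if j < n then \<Lambda> j * (co u j)\<^sup>2 else 0)" for j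
      using assms by (simp add: co_diff FE_sqint expand_sqint co_expand)
    then show ?thesis using 1 2 by (simp add: sums_iff)
  qed
  moreover have "(\<lambda>n. E u - (\<Sum>j<n. \<Lambda> j * (co u j)\<^sup>2)) \<longlonglongrightarrow> E u - E u"
    using E_sums[OF assms] unfolding sums_def by (intro tendsto_diff tendsto_const)
  ultimately show ?thesis by simp
qed

text \<open>Bounded energy and convergence of the coefficients amount to weak convergence in the energy
  space: a tail of the expansion of \<open>z\<close> has small energy, and the rest is a finite sum.\<close>

lemma D_weak_tendsto:
  assumes z: "FE z" and r: "\<And>n. FE (r n)" "\<And>n. E (r n) \<le> C" "\<And>j. (\<lambda>n. co (r n) j) \<longlonglongrightarrow> 0"
  shows "(\<lambda>n. D z (r n)) \<longlonglongrightarrow> 0"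
proof (rule LIMSEQ_I, unfold diff_zero real_norm_def)
  fix e' :: real assume e': "0 < e'"
  define e where "e = e' / 2"
  have e: "0 < e" using e' by (simp add: e_def)
  \<comment> \<open>with this weight both terms of \<open>D_bound\<close> are at most \<open>t * e\<close>\<close>
  define t where "t = (\<bar>C\<bar> + 1) / e"
  have t: "0 < t" using e by (simp add: t_def)
  have "0 < e / t" using e t by simp
  then obtain J where J: "E (\<lambda>x. z x - expand J (co z) x) < e / t"
    using order_tendstoD(2)[OF E_tail[OF z]] by (auto simp: eventually_sequentially)
  define w where "w = (\<lambda>x. z x - expand J (co z) x)"
  have w: "FE w" unfolding w_def by (intro FE_diff FE_expand z)
  have dec: "D z (r n) = (\<Sum>j<J. \<Lambda> j * (co z j * co (r n) j)) + D w (r n)" for n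
  proof -
    have "D (\<lambda>x. expand J (co z) x + w x) (r n) = D (expand J (co z)) (r n) + D w (r n)"
      by (rule D_add_left[OF FE_expand w r(1)])
    moreover have "D (expand J (co z)) (r n) = (\<Sum>j<J. \<Lambda> j * (co z j * co (r n) j))"
    proof -
      have "(\<lambda>j. \<Lambda> j * (co (expand J (co z)) j * co (r n) j)) sums (\<Sum>j<J. \<Lambda> j * (co (expand J (co z)) j * co (r n) j))"
        by (rule sums_finite) (auto simp: co_expand)
      from sums_unique2[OF D_sums[OF FE_expand r(1), of J "co z" n] this]
      show ?thesis by (simp add: co_expand)
    qed
    ultimately show ?thesis by (simp add: w_def)
  qed
  have w_bound: "\<bar>D w (r n)\<bar> \<le> e" for n
  proof -
    have "2 * t * \<bar>D w (r n)\<bar> \<le> t\<^sup>2 * E w + E (r n)" by (rule D_bound[OF w r(1) t])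
    also have "\<dots> \<le> t\<^sup>2 * (e / t) + (\<bar>C\<bar> + 1)"
      using J r(2)[of n] t unfolding w_def[symmetric] by (intro add_mono mult_left_mono) auto
    also have "t\<^sup>2 * (e / t) = t * e" using t by (simp add: power2_eq_square)
    also have "\<bar>C\<bar> + 1 = t * e" using e by (simp add: t_def)
    also have "t * e + t * e = 2 * t * e" by simp
    finally show ?thesis using t by simp
  qed
  have "(\<lambda>n. \<Sum>j<J. \<Lambda> j * (co z j * co (r n) j)) \<longlonglongrightarrow> (\<Sum>j<J. \<Lambda> j * (co z j * 0))"
    by (intro tendsto_sum tendsto_mult tendsto_const r)
  then have "(\<lambda>n. \<Sum>j<J. \<Lambda> j * (co z j * co (r n) j)) \<longlonglongrightarrow> 0" by simp
  then have "\<forall>\<^sub>F n in sequentially. \<bar>\<Sum>j<J. \<Lambda> j * (co z j * co (r n) j)\<bar> < e"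
    using e by (auto dest!: tendstoD[where e = e] simp: dist_real_def)
  then obtain N where "\<forall>n\<ge>N. \<bar>\<Sum>j<J. \<Lambda> j * (co z j * co (r n) j)\<bar> < e"
    by (auto simp: eventually_sequentially)
  then have "\<bar>D z (r n)\<bar> < e'" if "n \<ge> N" for n
  proof -
    have "\<bar>\<Sum>j<J. \<Lambda> j * (co z j * co (r n) j)\<bar> < e" using \<open>\<forall>n\<ge>N. _\<close> that by blast
    then show ?thesis using w_bound[of n] unfolding dec e_def by linarith
  qed
  then show "\<exists>N. \<forall>n\<ge>N. \<bar>D z (r n)\<bar> < e'" by blast
qed


text \<open>The compact embedding of the energy space: where \<open>\<Lambda>\<close> is large, the energy controls the
  coefficients uniformly, and only finitely many coefficients remain.\<close>

lemma sq_tendsto_0: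
  assumes top: "filterlim \<Lambda> at_top sequentially"
    and r: "\<And>n. FE (r n)" "\<And>n. E (r n) \<le> C" "\<And>j. (\<lambda>n. co (r n) j) \<longlonglongrightarrow> 0"
  shows "(\<lambda>n. sq M (r n)) \<longlonglongrightarrow> 0"
proof (rule LIMSEQ_I, unfold diff_zero real_norm_def)
  fix e :: real assume e: "0 < e"
  define L where "L = (2 * \<bar>C\<bar> + 1) / e"
  have L: "0 < L" using e by (simp add: L_def)
  obtain J where J: "L \<le> \<Lambda> J"
    using top unfolding filterlim_at_top eventually_sequentially by blast
  have bound: "sq M (r n) \<le> (\<Sum>j<J. (co (r n) j)\<^sup>2) + C / L" for n
  proof -
    have "(\<lambda>j. (if j < J then (co (r n) j)\<^sup>2 else 0) + 1 / L * (\<Lambda> j * (co (r n) j)\<^sup>2))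
        sums ((\<Sum>j<J. (co (r n) j)\<^sup>2) + 1 / L * E (r n))"
      using sums_If_finite_set[of "{..<J}" "\<lambda>j. (co (r n) j)\<^sup>2"]
      by (intro sums_add sums_mult E_sums r) (simp add: lessThan_def)
    moreover have "(co (r n) j)\<^sup>2 \<le> (if j < J then (co (r n) j)\<^sup>2 else 0) + 1 / L * (\<Lambda> j * (co (r n) j)\<^sup>2)" for j
    proof (cases "j < J")
      case True then show ?thesis using L Lam_pos[of j] by (simp add: less_imp_le)
    next
      case False
      then have "1 \<le> \<Lambda> j / L" using J Lam_mono[of J j] L by simp
      then have "1 * (co (r n) j)\<^sup>2 \<le> \<Lambda> j / L * (co (r n) j)\<^sup>2" by (rule mult_right_mono) simp
      then show ?thesis using False by simp
    qed
    ultimately have "sq M (r n) \<le> (\<Sum>j<J. (co (r n) j)\<^sup>2) + 1 / L * E (r n)"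
      using parseval_sq[OF FE_sqint[OF r(1)]] by (intro sums_le[OF _ parseval_sq[OF FE_sqint[OF r(1)]]])
    also have "1 / L * E (r n) \<le> 1 / L * C" using L r(2) by (intro mult_left_mono) auto
    finally show ?thesis by simp
  qed
  have "C / L \<le> e / 2"
  proof -
    have "e * (2 * C) \<le> e * (2 * \<bar>C\<bar> + 1)" using e by (intro mult_left_mono) auto
    then show ?thesis using e by (simp add: L_def field_simps)
  qed
  have "(\<lambda>n. \<Sum>j<J. (co (r n) j)\<^sup>2) \<longlonglongrightarrow> (\<Sum>j<J. 0\<^sup>2)"
    by (intro tendsto_sum tendsto_power r)
  then have "(\<lambda>n. \<Sum>j<J. (co (r n) j)\<^sup>2) \<longlonglongrightarrow> 0" by simp
  then have "\<forall>\<^sub>F n in sequentially. (\<Sum>j<J. (co (r n) j)\<^sup>2) < e / 2"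
    using e by (intro order_tendstoD) auto
  then obtain N where N: "\<And>n. n \<ge> N \<Longrightarrow> (\<Sum>j<J. (co (r n) j)\<^sup>2) < e / 2"
    by (auto simp: eventually_sequentially)
  have "\<bar>sq M (r n)\<bar> < e" if "n \<ge> N" for n
    using N[OF that] bound[of n] \<open>C / L \<le> e / 2\<close> sq_nonneg[of M "r n"] by linarith
  then show "\<exists>N. \<forall>n\<ge>N. \<bar>sq M (r n)\<bar> < e" by blast
qed

text \<open>A diagonal sequence makes the coefficients converge; their limits are the coefficients of a
  function of finite energy. The limit \<open>\<rho>\<close> is the energy that is lost.\<close>

lemma compactness:
  assumes top: "filterlim \<Lambda> at_top sequentially"
    and u: "\<And>n. FE (u n)" "\<And>n. E (u n) \<le> C"
  obtains v \<sigma> \<rho> where "strict_mono (\<sigma> :: nat \<Rightarrow> nat)" "FE v"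
    "\<And>j. (\<lambda>n. co (u (\<sigma> n)) j) \<longlonglongrightarrow> co v j"
    "(\<lambda>n. sq M (\<lambda>x. u (\<sigma> n) x - v x)) \<longlonglongrightarrow> 0"
    "AE x in M. (\<lambda>n. u (\<sigma> n) x) \<longlonglongrightarrow> v x"
    "(\<lambda>n. E (\<lambda>x. u (\<sigma> n) x - v x)) \<longlonglongrightarrow> \<rho>"
proof -
  define B where "B = sqrt (C / \<Lambda> 0)"
  have B: "\<bar>co (u n) j\<bar> \<le> B" for n j
  proof -
    have "(co (u n) j)\<^sup>2 \<le> sq M (u n)"
      using sum_le_suminf[of "\<lambda>j. (co (u n) j)\<^sup>2" "{j}"] parseval_sq[OF FE_sqint[OF u(1)]]
      by (simp add: sums_iff)
    also have "\<dots> \<le> C / \<Lambda> 0"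
      using sq_le_E[OF u(1)[of n]] u(2)[of n] Lam_pos[of 0] by (simp add: pos_le_divide_eq mult.commute)
    finally show ?thesis unfolding B_def by (rule real_le_rsqrt[of "\<bar>_\<bar>", simplified])
  qed
  interpret subseqs "\<lambda>j s. convergent (\<lambda>n. co (u (s n)) j)"
  proof
    fix j and s :: "nat \<Rightarrow> nat"
    have "\<forall>n. co (u (s n)) j \<in> {-B..B}" using B by (auto simp: abs_le_iff minus_le_iff)
    from seq_compactE[OF compact_imp_seq_compact[OF compact_Icc] this] obtain r l
      where "strict_mono (r :: nat \<Rightarrow> nat)" "((\<lambda>n. co (u (s n)) j) \<circ> r) \<longlonglongrightarrow> l"
      by metis
    then show "\<exists>r'. strict_mono r' \<and> convergent (\<lambda>n. co (u ((s \<circ> r') n)) j)"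
      by (auto simp: convergent_def o_def)
  qed
  have "convergent (\<lambda>n. co (u (diagseq n)) j)" for j
  proof -
    have "convergent (\<lambda>n. co (u ((diagseq \<circ> (+) (Suc j)) n)) j)"
    proof (rule diagseq_holds)
      show "convergent (\<lambda>n. co (u ((s \<circ> r) n)) j')" if "strict_mono r" "convergent (\<lambda>n. co (u (s n)) j')"
        for r s :: "nat \<Rightarrow> nat" and j'
        using convergent_subseq_convergent[OF that(2,1)] by (simp add: o_def)
    qed
    then have "convergent (\<lambda>n. co (u (diagseq (n + Suc j))) j)"
      unfolding o_def add.commute[of "Suc j"] .
    then show ?thesis
      using convergent_ignore_initial_segment[of "\<lambda>n. co (u (diagseq n)) j" "Suc j"] by (simp only:)
  qed
  then have a': "(\<lambda>n. co (u (diagseq n)) j) \<longlonglongrightarrow> lim (\<lambda>n. co (u (diagseq n)) j)" for j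
    unfolding convergent_LIMSEQ_iff .
  define a where "a j = lim (\<lambda>n. co (u (diagseq n)) j)" for j
  have a: "(\<lambda>n. co (u (diagseq n)) j) \<longlonglongrightarrow> a j" for j
    unfolding a_def by (rule a')
  have aE: "summable (\<lambda>j. \<Lambda> j * (a j)\<^sup>2)"
  proof (rule summableI_nonneg_bounded)
    show "0 \<le> \<Lambda> j * (a j)\<^sup>2" for j using Lam_pos[of j] by simp
    fix J
    have "(\<lambda>n. \<Sum>j<J. \<Lambda> j * (co (u (diagseq n)) j)\<^sup>2) \<longlonglongrightarrow> (\<Sum>j<J. \<Lambda> j * (a j)\<^sup>2)"
      by (intro tendsto_sum tendsto_mult tendsto_const tendsto_power a)
    moreover have "(\<Sum>j<J. \<Lambda> j * (co (u n) j)\<^sup>2) \<le> C" for n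
      using sum_le_suminf[of "\<lambda>j. \<Lambda> j * (co (u n) j)\<^sup>2" "{..<J}"] E_sums[OF u(1)[of n]] u(2)[of n] Lam_pos
      by (simp add: sums_iff less_imp_le)
    ultimately show "(\<Sum>j<J. \<Lambda> j * (a j)\<^sup>2) \<le> C"
      by (intro LIMSEQ_le_const2[of "\<lambda>n. \<Sum>j<J. \<Lambda> j * (co (u (diagseq n)) j)\<^sup>2"]) auto
  qed
  have "summable (\<lambda>j. (a j)\<^sup>2)"
  proof (rule summable_comparison_test)
    show "summable (\<lambda>j. (\<Lambda> j * (a j)\<^sup>2) / \<Lambda> 0)" by (intro summable_divide aE)
    have "(a n)\<^sup>2 \<le> (\<Lambda> n * (a n)\<^sup>2) / \<Lambda> 0" for n
      using Lam_pos[of 0] mult_right_mono[OF Lam_mono[of 0 n], of "(a n)\<^sup>2"]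
      by (simp add: pos_le_divide_eq mult.commute)
    then show "\<exists>N. \<forall>n\<ge>N. norm ((a n)\<^sup>2) \<le> (\<Lambda> n * (a n)\<^sup>2) / \<Lambda> 0" by simp
  qed
  then obtain v where v: "v \<in> sqint M" and cv: "\<And>j. co v j = a j" using riesz_fischer by blast
  have FEv: "FE v" unfolding FE_def using v cv aE by simp
  define r where "r n = (\<lambda>x. u (diagseq n) x - v x)" for n
  have r: "FE (r n)" for n unfolding r_def by (intro FE_diff u FEv)
  have rE: "E (r n) \<le> 2 * C + 2 * E v" for n
  proof -
    have "0 \<le> E (\<lambda>x. u (diagseq n) x + v x)" by (intro E_nonneg FE_add u FEv)
    moreover have "E (\<lambda>x. u (diagseq n) x + v x) = E (u (diagseq n)) + 2 * D (u (diagseq n)) v + E v"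
      by (intro E_add u FEv)
    moreover have "E (\<lambda>x. u (diagseq n) x + (-1) * v x) = E (u (diagseq n)) - 2 * D (u (diagseq n)) v + E v"
      by (simp only: E_add E_cmult D_cmult_right u FEv FE_cmult) simp
    ultimately show ?thesis using u(2)[of "diagseq n"] unfolding r_def by simp
  qed
  have rc: "(\<lambda>n. co (r n) j) \<longlonglongrightarrow> 0" for j
  proof -
    have "(\<lambda>n. co (u (diagseq n)) j - a j) \<longlonglongrightarrow> a j - a j" by (intro tendsto_diff tendsto_const a)
    then show ?thesis unfolding r_def using u FEv by (simp add: co_diff FE_sqint cv)
  qed
  have rsq: "(\<lambda>n. sq M (r n)) \<longlonglongrightarrow> 0" by (rule sq_tendsto_0[OF top r rE rc])
  obtain s where s: "strict_mono (s :: nat \<Rightarrow> nat)" and AE: "AE x in M. (\<lambda>n. r (s n) x) \<longlonglongrightarrow> 0"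
    using L2_AE_subseq[OF FE_sqint[OF r] rsq] by blast
  have "\<forall>n. E (r (s n)) \<in> {0..2 * C + 2 * E v}" using rE r E_nonneg by auto
  from seq_compactE[OF compact_imp_seq_compact[OF compact_Icc] this] obtain t \<rho>
    where t: "strict_mono (t :: nat \<Rightarrow> nat)" and \<rho>: "((\<lambda>n. E (r (s n))) \<circ> t) \<longlonglongrightarrow> \<rho>"
    by metis
  have st: "strict_mono (s \<circ> t)" using s t by (rule strict_mono_o)
  show thesis
  proof (rule that)
    show "strict_mono (diagseq \<circ> (s \<circ> t))" using subseq_diagseq st by (rule strict_mono_o)
    show "FE v" by (rule FEv)
    show "(\<lambda>n. co (u ((diagseq \<circ> (s \<circ> t)) n)) j) \<longlonglongrightarrow> co v j" for j
      using LIMSEQ_subseq_LIMSEQ[OF a st] by (simp add: o_def cv)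
    show "(\<lambda>n. sq M (\<lambda>x. u ((diagseq \<circ> (s \<circ> t)) n) x - v x)) \<longlonglongrightarrow> 0"
      using LIMSEQ_subseq_LIMSEQ[OF rsq st] by (simp add: o_def r_def)
    show "(\<lambda>n. E (\<lambda>x. u ((diagseq \<circ> (s \<circ> t)) n) x - v x)) \<longlonglongrightarrow> \<rho>"
      using \<rho> by (simp add: o_def r_def)
    show "AE x in M. (\<lambda>n. u ((diagseq \<circ> (s \<circ> t)) n) x) \<longlonglongrightarrow> v x"
      using AE
    proof eventually_elim
      case (elim x)
      from LIMSEQ_subseq_LIMSEQ[OF elim t] have "(\<lambda>n. u ((diagseq \<circ> (s \<circ> t)) n) x - v x) \<longlonglongrightarrow> 0"
        by (simp add: o_def r_def)
      then show ?case by (rule LIM_zero_cancel)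
    qed
  qed
qed

end

section \<open>Powers and Lebesgue norms\<close>

lemma powr_convex_comb:
  fixes x y :: real
  assumes p: "1 \<le> p" and t: "0 \<le> t" "t \<le> 1"
  shows "\<bar>(1 - t) * x + t * y\<bar> powr p \<le> (1 - t) * \<bar>x\<bar> powr p + t * \<bar>y\<bar> powr p"
proof -
  have z: "c powr p * a powr p \<le> c * a powr p" if "0 \<le> c" "c \<le> 1" for a c :: real
    using powr_mono'[of 1 p c] that p by (intro mult_right_mono) auto
  have "\<bar>(1 - t) * x + t * y\<bar> \<le> (1 - t) * \<bar>x\<bar> + t * \<bar>y\<bar>"
    using t abs_triangle_ineq[of "(1 - t) * x" "t * y"] by (simp add: abs_mult)
  then have "\<bar>(1 - t) * x + t * y\<bar> powr p \<le> ((1 - t) * \<bar>x\<bar> + t * \<bar>y\<bar>) powr p"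
    using p by (intro powr_mono2) auto
  also have "\<dots> \<le> (1 - t) * \<bar>x\<bar> powr p + t * \<bar>y\<bar> powr p"
  proof (cases "x = 0 \<or> y = 0")
    case True
    then show ?thesis using t z[of t "\<bar>y\<bar>"] z[of "1 - t" "\<bar>x\<bar>"] p by (auto simp: powr_mult)
  next
    case False
    then show ?thesis using convex_onD[OF powr_convex[OF p], of t "\<bar>x\<bar>" "\<bar>y\<bar>"] t by simp
  qed
  finally show ?thesis .
qed

text \<open>Convexity with the weights \<open>1 - t\<close> and \<open>t\<close>. For small \<open>t\<close> the factor in front of \<open>g\<close> is close to \<open>1\<close>, at
  the expense of the one in front of \<open>f\<close>.\<close>

lemma powr_add_split:
  fixes f g :: real
  assumes p: "1 \<le> p" and t: "0 < t" "t < 1"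
  shows "\<bar>f + g\<bar> powr p \<le> (1 - t) powr (1 - p) * \<bar>g\<bar> powr p + t powr (1 - p) * \<bar>f\<bar> powr p"
proof -
  have *: "c * \<bar>a / c\<bar> powr p = c powr (1 - p) * \<bar>a\<bar> powr p" if "0 < c" for a c :: real
    using that by (simp add: powr_divide powr_diff)
  have "\<bar>f + g\<bar> powr p = \<bar>(1 - t) * (g / (1 - t)) + t * (f / t)\<bar> powr p"
    using t by (simp add: add.commute)
  also have "\<dots> \<le> (1 - t) * \<bar>g / (1 - t)\<bar> powr p + t * \<bar>f / t\<bar> powr p"
    using t by (intro powr_convex_comb p) auto
  also have "\<dots> = (1 - t) powr (1 - p) * \<bar>g\<bar> powr p + t powr (1 - p) * \<bar>f\<bar> powr p"
    using t by (simp only: *[of "1 - t"] *[of t] diff_gt_0_iff_gt)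
  finally show ?thesis .
qed

lemma powr_subadditive:
  fixes a b :: real
  assumes q: "0 < q" "q \<le> 1" and ab: "0 \<le> a" "0 \<le> b"
  shows "(a + b) powr q \<le> a powr q + b powr q"
proof (cases "a + b = 0")
  case True then show ?thesis using q by simp
next
  case False
  define s where "s = a + b"
  have s: "0 < s" using False ab by (simp add: s_def)
  have le: "c / s \<le> (c / s) powr q" if "0 \<le> c" "c \<le> s" for c
    using powr_mono'[of q 1 "c / s"] that q s by simp
  have "s powr q = s powr q * (a / s + b / s)" using s by (simp add: s_def add_divide_distrib[symmetric])
  also have "\<dots> \<le> s powr q * ((a / s) powr q + (b / s) powr q)"
    using le[of a] le[of b] ab s by (intro mult_left_mono add_mono) (auto simp: s_def)
  also have "\<dots> = a powr q + b powr q"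
    using ab s by (simp add: powr_divide distrib_left)
  finally show ?thesis unfolding s_def .
qed

lemma abs_powr_has_derivative:
  fixes y :: real
  assumes p: "1 < p"
  shows "((\<lambda>y. \<bar>y\<bar> powr p) has_real_derivative p * \<bar>y\<bar> powr (p - 2) * y) (at y)"
proof -
  consider "y > 0" | "y < 0" | "y = 0" by linarith
  then show ?thesis
  proof cases
    case 1
    have "((\<lambda>y. y powr p) has_real_derivative p * y powr (p - 1)) (at y)"
      by (rule has_real_derivative_powr[OF 1])
    then have "((\<lambda>y. \<bar>y\<bar> powr p) has_real_derivative p * y powr (p - 1)) (at y)"
      by (rule has_field_derivative_transform_within_open[of _ _ _ "{0<..}"]) (use 1 in auto)
    moreover have "y powr (p - 1) = y powr (p - 2) * y"
      using 1 powr_add[of y "p - 2" 1] by simp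
    ultimately show ?thesis using 1 by (simp add: mult.assoc)
  next
    case 2
    have "((\<lambda>y. (-y) powr p) has_real_derivative p * (-y) powr (p - 1) * (-1)) (at y)"
      by (rule DERIV_chain2[OF has_real_derivative_powr]) (use 2 in \<open>auto intro!: derivative_eq_intros\<close>)
    then have "((\<lambda>y. \<bar>y\<bar> powr p) has_real_derivative p * (-y) powr (p - 1) * (-1)) (at y)"
      by (rule has_field_derivative_transform_within_open[of _ _ _ "{..<0}"]) (use 2 in auto)
    moreover have "(-y) powr (p - 1) = (-y) powr (p - 2) * (-y)"
      using 2 powr_add[of "-y" "p - 2" 1] by simp
    ultimately show ?thesis using 2 by (simp add: mult.assoc)
  next
    case 3
    have "((\<lambda>h. (\<bar>0 + h\<bar> powr p - \<bar>0\<bar> powr p) / h) \<longlongrightarrow> 0) (at (0::real))"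
    proof (rule Lim_null_comparison)
      show "\<forall>\<^sub>F h in at (0::real). norm ((\<bar>0 + h\<bar> powr p - \<bar>0\<bar> powr p) / h) \<le> \<bar>h\<bar> powr (p - 1)"
      proof (rule eventually_at_topological[THEN iffD2], intro exI[of _ UNIV] conjI ballI impI)
        fix h :: real assume "h \<noteq> 0"
        then have "\<bar>h\<bar> powr p = \<bar>h\<bar> powr (p - 1) * \<bar>h\<bar>" using powr_add[of "\<bar>h\<bar>" "p - 1" 1] by simp
        then show "norm ((\<bar>0 + h\<bar> powr p - \<bar>0\<bar> powr p) / h) \<le> \<bar>h\<bar> powr (p - 1)"
          using \<open>h \<noteq> 0\<close> p by (simp add: abs_mult)
      qed auto
      have "((\<lambda>h. \<bar>h\<bar> powr (p - 1)) \<longlongrightarrow> \<bar>0\<bar> powr (p - 1)) (at (0::real))"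
        by (rule tendsto_powr2) (use p in \<open>auto intro!: tendsto_eq_intros\<close>)
      then show "((\<lambda>h. \<bar>h\<bar> powr (p - 1)) \<longlongrightarrow> 0) (at (0::real))" by simp
    qed
    then show ?thesis using 3 unfolding DERIV_def by simp
  qed
qed

text \<open>The mean value theorem in \<open>\<tau>\<close>; the bound is independent of \<open>\<tau>\<close>, as dominated convergence requires.\<close>

lemma abs_powr_quotient_bound:
  fixes a b \<tau> :: real
  assumes p: "1 < p" and tau: "\<tau> \<noteq> 0" "\<bar>\<tau>\<bar> \<le> 1"
  shows "\<bar>(\<bar>a + \<tau> * b\<bar> powr p - \<bar>a\<bar> powr p) / \<tau>\<bar> \<le> p * (\<bar>a\<bar> + \<bar>b\<bar>) powr p"
proof -
  define m where "m = \<bar>a\<bar> + \<bar>b\<bar>"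
  have "((\<lambda>\<tau>. \<bar>a + \<tau> * b\<bar> powr p) has_real_derivative p * \<bar>a + t * b\<bar> powr (p - 2) * (a + t * b) * b) (at t)" for t
    by (rule DERIV_chain2[OF abs_powr_has_derivative[OF p]]) (auto intro!: derivative_eq_intros)
  then have d: "((\<lambda>\<tau>. \<bar>a + \<tau> * b\<bar> powr p) has_real_derivative p * \<bar>a + t * b\<bar> powr (p - 2) * (a + t * b) * b) (at t within S)" for t S
    by (rule has_field_derivative_at_within)
  have b: "norm (p * \<bar>a + t * b\<bar> powr (p - 2) * (a + t * b) * b) \<le> p * m powr p" if "\<bar>t\<bar> \<le> 1" for t
  proof -
    have le: "\<bar>a + t * b\<bar> \<le> m"
    proof -
      have "\<bar>t * b\<bar> \<le> 1 * \<bar>b\<bar>" unfolding abs_mult by (rule mult_right_mono[OF that]) simp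
      then show ?thesis using abs_triangle_ineq[of a "t * b"] unfolding m_def by simp
    qed
    have "\<bar>a + t * b\<bar> powr (p - 2) * \<bar>a + t * b\<bar> = \<bar>a + t * b\<bar> powr (p - 1)"
      using powr_add[of "\<bar>a + t * b\<bar>" "p - 2" 1] by simp
    also have "\<dots> \<le> m powr (p - 1)" using le p by (intro powr_mono2) auto
    finally have "\<bar>a + t * b\<bar> powr (p - 2) * \<bar>a + t * b\<bar> * \<bar>b\<bar> \<le> m powr (p - 1) * m"
      by (intro mult_mono) (auto simp: m_def)
    also have "\<dots> = m powr p" using powr_add[of m "p - 1" 1] by (simp add: m_def)
    finally show ?thesis using p by (simp add: abs_mult mult.assoc)
  qed
  have "norm (\<bar>a + \<tau> * b\<bar> powr p - \<bar>a + 0 * b\<bar> powr p) \<le> p * m powr p * norm (\<tau> - 0)"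
    by (rule field_differentiable_bound[OF _ d, of "{-1..1}"]) (use tau b in \<open>auto simp: abs_le_iff\<close>)
  then show ?thesis using tau(1) unfolding m_def by (simp add: abs_divide pos_divide_le_eq)
qed

definition Lp :: "'a measure \<Rightarrow> real \<Rightarrow> ('a \<Rightarrow> real) set" where
  "Lp M p = {u \<in> borel_measurable M. integrable M (\<lambda>x. \<bar>u x\<bar> powr p)}"

definition Lp_int :: "'a measure \<Rightarrow> real \<Rightarrow> ('a \<Rightarrow> real) \<Rightarrow> real" where
  "Lp_int M p u = (LINT x|M. \<bar>u x\<bar> powr p)"

definition Lp_norm :: "'a measure \<Rightarrow> real \<Rightarrow> ('a \<Rightarrow> real) \<Rightarrow> real" where
  "Lp_norm M p u = Lp_int M p u powr (1 / p)"

lemma Lp_int_nonneg: "0 \<le> Lp_int M p u" by (simp add: Lp_int_def)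
lemma Lp_norm_nonneg: "0 \<le> Lp_norm M p u" by (simp add: Lp_norm_def)

lemma Lp_int_eq_norm: "0 < p \<Longrightarrow> Lp_int M p u = Lp_norm M p u powr p"
  by (simp add: Lp_norm_def powr_powr Lp_int_nonneg)

lemma Lp_cmult: "u \<in> Lp M p \<Longrightarrow> (\<lambda>x. c * u x) \<in> Lp M p"
  by (auto simp: Lp_def abs_mult powr_mult)

lemma Lp_int_cmult: "Lp_int M p (\<lambda>x. c * u x) = \<bar>c\<bar> powr p * Lp_int M p u"
  by (simp add: Lp_int_def abs_mult powr_mult)

lemma Lp_norm_cmult: "0 < p \<Longrightarrow> Lp_norm M p (\<lambda>x. c * u x) = \<bar>c\<bar> * Lp_norm M p u"
  by (simp add: Lp_norm_def Lp_int_cmult powr_mult powr_powr Lp_int_nonneg)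

lemma Lp_add:
  assumes p: "1 \<le> p" and u: "u \<in> Lp M p" and v: "v \<in> Lp M p"
  shows "(\<lambda>x. u x + v x) \<in> Lp M p"
proof -
  have [measurable]: "u \<in> borel_measurable M" "v \<in> borel_measurable M" using u v by (auto simp: Lp_def)
  have "integrable M (\<lambda>x. \<bar>u x + v x\<bar> powr p)"
  proof (rule Bochner_Integration.integrable_bound)
    show "integrable M (\<lambda>x. (1 - 1/2) powr (1 - p) * \<bar>v x\<bar> powr p + (1/2) powr (1 - p) * \<bar>u x\<bar> powr p)"
      using u v by (auto simp: Lp_def)
    show "AE x in M. norm (\<bar>u x + v x\<bar> powr p)
       \<le> norm ((1 - 1/2) powr (1 - p) * \<bar>v x\<bar> powr p + (1/2) powr (1 - p) * \<bar>u x\<bar> powr p)"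
      using powr_add_split[OF p, of "1/2"] by (intro AE_I2) (auto simp: abs_of_nonneg)
  qed measurable
  then show ?thesis by (simp add: Lp_def)
qed

text \<open>Minkowski's inequality. The normalisations by a number slightly larger than the norm
  avoid a case distinction for functions that vanish.\<close>

lemma Lp_norm_triangle:
  assumes p: "1 \<le> p" and u: "u \<in> Lp M p" and v: "v \<in> Lp M p"
  shows "Lp_norm M p (\<lambda>x. u x + v x) \<le> Lp_norm M p u + Lp_norm M p v"
proof (rule field_le_epsilon)
  fix e :: real assume e: "0 < e"
  define a b where "a = Lp_norm M p u + e / 2" and "b = Lp_norm M p v + e / 2"
  define s where "s = a + b"
  have pos: "0 < a" "0 < b" "0 < s"
    using Lp_norm_nonneg[of M p u] Lp_norm_nonneg[of M p v] e by (auto simp: a_def b_def s_def)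
  have le1: "Lp_int M p u \<le> a powr p" "Lp_int M p v \<le> b powr p"
    using p e Lp_norm_nonneg[of M p u] Lp_norm_nonneg[of M p v]
    by (auto simp: Lp_int_eq_norm a_def b_def intro!: powr_mono2)
  have intu: "integrable M (\<lambda>x. \<bar>u x\<bar> powr p)" and intv: "integrable M (\<lambda>x. \<bar>v x\<bar> powr p)"
    using u v by (auto simp: Lp_def)
  have pw: "\<bar>u x + v x\<bar> powr p \<le> s powr p * (a / s / a powr p * \<bar>u x\<bar> powr p + b / s / b powr p * \<bar>v x\<bar> powr p)" for x
  proof -
    have 1: "1 - b / s = a / s" using pos by (simp add: s_def field_simps)
    have "u x + v x = s * ((1 - b / s) * (u x / a) + b / s * (v x / b))"
      unfolding 1 using pos by (simp add: field_simps)
    then have "\<bar>u x + v x\<bar> powr p = s powr p * \<bar>(1 - b / s) * (u x / a) + b / s * (v x / b)\<bar> powr p"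
      using pos by (simp add: abs_mult powr_mult)
    also have "\<dots> \<le> s powr p * ((1 - b / s) * \<bar>u x / a\<bar> powr p + b / s * \<bar>v x / b\<bar> powr p)"
      using pos by (intro mult_left_mono powr_convex_comb p) (auto simp: s_def)
    finally show ?thesis unfolding 1 using pos by (simp add: powr_divide abs_divide)
  qed
  have "Lp_int M p (\<lambda>x. u x + v x)
     \<le> (LINT x|M. s powr p * (a / s / a powr p * \<bar>u x\<bar> powr p + b / s / b powr p * \<bar>v x\<bar> powr p))"
    unfolding Lp_int_def
    by (rule integral_mono) (use Lp_add[OF p u v] intu intv pw in \<open>auto simp: Lp_def\<close>)
  also have "\<dots> = s powr p * (a / s * (Lp_int M p u / a powr p) + b / s * (Lp_int M p v / b powr p))"
    using intu intv by (simp add: Lp_int_def)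
  also have "\<dots> \<le> s powr p * (a / s * 1 + b / s * 1)"
    using pos le1 by (intro mult_left_mono add_mono) (auto simp: divide_le_eq)
  also have "a / s * 1 + b / s * 1 = 1" using pos by (simp add: s_def add_divide_distrib[symmetric])
  finally have "Lp_int M p (\<lambda>x. u x + v x) powr (1 / p) \<le> (s powr p) powr (1 / p)"
    using p by (intro powr_mono2) (auto simp: Lp_int_nonneg)
  then show "Lp_norm M p (\<lambda>x. u x + v x) \<le> Lp_norm M p u + Lp_norm M p v + e"
    using p pos by (simp add: Lp_norm_def powr_powr s_def a_def b_def)
qed

lemma Lp_norm_sq_convex:
  assumes p: "1 \<le> p" and u: "u \<in> Lp M p" and v: "v \<in> Lp M p" and t: "0 \<le> t" "t \<le> 1"
  shows "(Lp_norm M p (\<lambda>x. (1 - t) * u x + t * v x))\<^sup>2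
     \<le> (1 - t) * (Lp_norm M p u)\<^sup>2 + t * (Lp_norm M p v)\<^sup>2"
proof -
  let ?a = "Lp_norm M p u" and ?b = "Lp_norm M p v"
  have "Lp_norm M p (\<lambda>x. (1 - t) * u x + t * v x) \<le> (1 - t) * ?a + t * ?b"
    using Lp_norm_triangle[OF p Lp_cmult[OF u, of "1 - t"] Lp_cmult[OF v, of t]] p t
    by (simp add: Lp_norm_cmult)
  then have "(Lp_norm M p (\<lambda>x. (1 - t) * u x + t * v x))\<^sup>2 \<le> ((1 - t) * ?a + t * ?b)\<^sup>2"
    by (rule power_mono) (rule Lp_norm_nonneg)
  also have "\<dots> = (1 - t) * ?a\<^sup>2 + t * ?b\<^sup>2 - t * (1 - t) * (?a - ?b)\<^sup>2"
    by (simp add: power2_eq_square algebra_simps)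
  also have "\<dots> \<le> (1 - t) * ?a\<^sup>2 + t * ?b\<^sup>2" using t by simp
  finally show ?thesis .
qed

text \<open>Hoelder's inequality between \<open>L\<^sup>2\<close> and \<open>L\<^sup>p\<close>; the tangent to the convex function
  \<open>t\<^sup>p\<^sup>/\<^sup>2\<close> at the mean of \<open>u\<^sup>2\<close> gives Jensen's inequality.\<close>

lemma (in finite_measure) sq_le_Lp_norm:
  assumes p: "2 \<le> p" and u: "u \<in> Lp M p" "u \<in> sqint M"
  shows "sq M u \<le> measure M (space M) powr (1 - 2 / p) * (Lp_norm M p u)\<^sup>2"
proof (cases "sq M u = 0")
  case True then show ?thesis by simp
next
  case False
  then have s: "0 < sq M u" using sq_nonneg[of M u] by simp
  define m where "m = measure M (space M)"
  have m: "0 < m"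
  proof (rule ccontr)
    assume "\<not> 0 < m"
    then have "measure M (space M) = 0" using measure_nonneg[of M "space M"] unfolding m_def by linarith
    then have "space M \<in> null_sets M" by (simp add: null_sets_def emeasure_eq_measure)
    then have "AE x in M. u x = 0" by (rule AE_I') auto
    then show False using False sq_eq_0_iff[OF u(2)] by blast
  qed
  define A where "A = sq M u / m"
  have A: "0 < A" using s m by (simp add: A_def)
  define q where "q = p / 2"
  have q: "1 \<le> q" using p by (simp add: q_def)
  have tangent: "A powr q + q * A powr (q - 1) * (t - A) \<le> t powr q" if t: "0 \<le> t" for t
  proof (cases "t = 0")
    case True
    have "A powr q = A powr (q - 1) * A" using powr_add[of A "q - 1" 1] A by simp
    then have "A powr q + q * A powr (q - 1) * (0 - A) = (1 - q) * A powr q" by (simp add: algebra_simps)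
    also have "\<dots> \<le> 0" using q by (simp add: mult_nonpos_nonneg)
    finally show ?thesis using True by simp
  next
    case False
    then have t: "0 < t" using t by simp
    have "q * A powr (q - 1) * (t - A) \<le> t powr q - A powr q"
    proof (rule convex_on_imp_above_tangent[OF powr_convex[OF q]])
      show "((\<lambda>x. x powr q) has_real_derivative q * A powr (q - 1)) (at A within {0<..})"
        by (rule has_field_derivative_at_within[OF has_real_derivative_powr[OF A]])
    qed (use A t in \<open>auto simp: connected_Ioi interior_open\<close>)
    then show ?thesis by simp
  qed
  have pw: "A powr q + q * A powr (q - 1) * ((u x)\<^sup>2 - A) \<le> \<bar>u x\<bar> powr p" for x
  proof -
    have "((u x)\<^sup>2) powr q = \<bar>u x\<bar> powr p"
    proof (cases "u x = 0")
      case False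
      then have "(u x)\<^sup>2 = \<bar>u x\<bar> powr 2" by simp
      then show ?thesis by (simp only: powr_powr) (simp add: q_def)
    qed (use p q in simp)
    then show ?thesis using tangent[of "(u x)\<^sup>2"] by simp
  qed
  have int: "integrable M (\<lambda>x. (u x)\<^sup>2)" using sqint_integrable_sq[OF u(2)] by simp
  have "(LINT x|M. A powr q + q * A powr (q - 1) * ((u x)\<^sup>2 - A)) \<le> Lp_int M p u"
    unfolding Lp_int_def by (rule integral_mono) (use u int pw in \<open>auto simp: Lp_def\<close>)
  also have "(LINT x|M. A powr q + q * A powr (q - 1) * ((u x)\<^sup>2 - A)) = m * A powr q"
    using int m by (simp add: sq_def A_def m_def)
  finally have "(m * A powr q) powr (1 / p) \<le> Lp_norm M p u"
    unfolding Lp_norm_def using p m by (intro powr_mono2) auto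
  then have "((m * A powr q) powr (1 / p))\<^sup>2 \<le> (Lp_norm M p u)\<^sup>2" by (rule power_mono) simp
  moreover have "((m * A powr q) powr (1 / p))\<^sup>2 = m powr (2 / p) * A"
  proof -
    have "((m * A powr q) powr (1 / p))\<^sup>2 = ((m * A powr q) powr (1 / p)) powr 2" using m A by simp
    also have "\<dots> = m powr (2 / p) * A powr (q * (2 / p))"
      using m A by (simp add: powr_powr powr_mult)
    also have "q * (2 / p) = 1" using p by (simp add: q_def)
    finally show ?thesis using A by simp
  qed
  ultimately have "m powr (1 - 2 / p) * (m powr (2 / p) * A) \<le> m powr (1 - 2 / p) * (Lp_norm M p u)\<^sup>2"
    by (intro mult_left_mono) auto
  moreover have "m powr (1 - 2 / p) * (m powr (2 / p) * A) = sq M u"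
  proof -
    have "m powr (1 - 2 / p) * m powr (2 / p) = m" using m by (simp add: powr_add[symmetric])
    then show ?thesis using m by (simp add: mult.assoc[symmetric] A_def)
  qed
  ultimately show ?thesis by (simp add: m_def)
qed

text \<open>Half of the Brezis-Lieb lemma: the part \<open>g n\<close> that converges to zero almost everywhere
  and the fixed part \<open>f\<close> do not interact in the limit. Convexity bounds
  \<open>\<bar>f + g n\<bar>\<^sup>p - (1 - t)\<^sup>1\<^sup>-\<^sup>p \<bar>g n\<bar>\<^sup>p\<close> from above by a multiple of \<open>\<bar>f\<bar>\<^sup>p\<close>, which is the
  domination needed to pass to the limit.\<close>

lemma brezis_lieb_upper:
  assumes p: "1 \<le> p" and t: "0 < t" "t < 1" and eta: "0 < \<eta>"
    and f: "f \<in> Lp M p" and g: "\<And>n. g n \<in> Lp M p" and lim: "AE x in M. (\<lambda>n. g n x) \<longlonglongrightarrow> 0"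
  shows "\<forall>\<^sub>F n in sequentially.
    Lp_int M p (\<lambda>x. f x + g n x) \<le> (1 - t) powr (1 - p) * Lp_int M p (g n) + (Lp_int M p f + \<eta>)"
proof -
  define A where "A = (1 - t) powr (1 - p)"
  define W where "W n x = max 0 (\<bar>f x + g n x\<bar> powr p - A * \<bar>g n x\<bar> powr p)" for n x
  have [measurable]: "f \<in> borel_measurable M" "\<And>n. g n \<in> borel_measurable M"
    using f g by (auto simp: Lp_def)
  have meas[measurable]: "W n \<in> borel_measurable M" for n unfolding W_def by measurable
  have dom: "integrable M (\<lambda>x. t powr (1 - p) * \<bar>f x\<bar> powr p)" using f by (auto simp: Lp_def)
  have bound: "norm (W n x) \<le> t powr (1 - p) * \<bar>f x\<bar> powr p" for n x
    using powr_add_split[OF p t, of "f x" "g n x"] unfolding W_def A_def by simp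
  have WAE: "AE x in M. (\<lambda>n. W n x) \<longlonglongrightarrow> \<bar>f x\<bar> powr p"
    using lim
  proof eventually_elim
    case (elim x)
    have "(\<lambda>n. \<bar>f x + g n x\<bar> powr p) \<longlonglongrightarrow> \<bar>f x + 0\<bar> powr p"
      using p by (intro tendsto_powr2[OF tendsto_rabs[OF tendsto_add[OF tendsto_const elim]] tendsto_const]) auto
    moreover have "(\<lambda>n. \<bar>g n x\<bar> powr p) \<longlonglongrightarrow> \<bar>0\<bar> powr p"
      using p by (intro tendsto_powr2[OF tendsto_rabs[OF elim] tendsto_const]) auto
    ultimately have "(\<lambda>n. W n x) \<longlonglongrightarrow> max 0 (\<bar>f x + 0\<bar> powr p - A * \<bar>0\<bar> powr p)"
      unfolding W_def by (intro tendsto_max tendsto_const tendsto_diff tendsto_mult)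
    then show ?case using p by (simp add: max_absorb2)
  qed
  have "(\<lambda>n. LINT x|M. W n x) \<longlonglongrightarrow> (LINT x|M. \<bar>f x\<bar> powr p)"
    by (rule integral_dominated_convergence[OF _ _ dom WAE]) (use bound in auto)
  then have "\<forall>\<^sub>F n in sequentially. (LINT x|M. W n x) < Lp_int M p f + \<eta>"
    using eta unfolding Lp_int_def by (intro order_tendstoD(2)) auto
  then show ?thesis
  proof eventually_elim
    case (elim n)
    have W: "integrable M (W n)"
      by (rule Bochner_Integration.integrable_bound[OF dom meas]) (use bound in \<open>auto intro!: AE_I2 order_trans[OF bound]\<close>)
    have "Lp_int M p (\<lambda>x. f x + g n x) - A * Lp_int M p (g n)
        = (LINT x|M. \<bar>f x + g n x\<bar> powr p - A * \<bar>g n x\<bar> powr p)"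
      using Lp_add[OF p f g] g unfolding Lp_int_def by (simp add: Lp_def)
    also have "\<dots> \<le> (LINT x|M. W n x)"
      by (rule integral_mono[OF _ W]) (use Lp_add[OF p f g] g in \<open>auto simp: Lp_def W_def\<close>)
    finally show ?case using elim unfolding A_def by simp
  qed
qed

lemma Lp_int_has_derivative:
  assumes p: "1 < p" and z: "z \<in> Lp M p" and h: "h \<in> Lp M p"
  shows "((\<lambda>\<tau>. Lp_int M p (\<lambda>x. z x + \<tau> * h x)) has_real_derivative
      p * (LINT x|M. \<bar>z x\<bar> powr (p - 2) * z x * h x)) (at 0)"
proof -
  have [measurable]: "z \<in> borel_measurable M" "h \<in> borel_measurable M"
    using z h by (auto simp: Lp_def)
  have p1: "1 \<le> p" using p by simp
  define w where "w x = p * (\<bar>z x\<bar> + \<bar>h x\<bar>) powr p" for x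
  have w: "integrable M w"
  proof -
    have "(\<lambda>x. \<bar>z x\<bar>) \<in> Lp M p" "(\<lambda>x. \<bar>h x\<bar>) \<in> Lp M p" using z h by (auto simp: Lp_def)
    from Lp_add[OF p1 this] show ?thesis unfolding w_def Lp_def by simp
  qed
  have zt: "integrable M (\<lambda>x. \<bar>z x + t * h x\<bar> powr p)" for t
    using Lp_add[OF p1 z Lp_cmult[OF h]] by (simp add: Lp_def)
  show ?thesis
    unfolding DERIV_def tendsto_at_iff_sequentially
  proof (intro allI impI)
    fix X :: "nat \<Rightarrow> real" assume X: "\<forall>i. X i \<in> UNIV - {0}" and X0: "X \<longlonglongrightarrow> 0"
    define q where "q n x = (\<bar>z x + X n * h x\<bar> powr p - \<bar>z x\<bar> powr p) / X n" for n x
    obtain n0 where n0: "\<And>n. n \<ge> n0 \<Longrightarrow> \<bar>X n\<bar> < 1"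
      using X0[THEN tendstoD, of 1] by (auto simp: eventually_sequentially dist_real_def)
    have "(\<lambda>n. LINT x|M. q (n + n0) x) \<longlonglongrightarrow> (LINT x|M. p * \<bar>z x\<bar> powr (p - 2) * z x * h x)"
    proof (rule integral_dominated_convergence[OF _ _ w])
      show "AE x in M. (\<lambda>n. q (n + n0) x) \<longlonglongrightarrow> p * \<bar>z x\<bar> powr (p - 2) * z x * h x"
      proof (rule AE_I2)
        fix x
        have "((\<lambda>\<tau>. \<bar>z x + \<tau> * h x\<bar> powr p) has_real_derivative p * \<bar>z x + 0 * h x\<bar> powr (p - 2) * (z x + 0 * h x) * h x) (at 0)"
          by (rule DERIV_chain2[OF abs_powr_has_derivative[OF p]]) (auto intro!: derivative_eq_intros)
        then have "(\<lambda>n. q n x) \<longlonglongrightarrow> p * \<bar>z x\<bar> powr (p - 2) * z x * h x"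
          unfolding DERIV_def tendsto_at_iff_sequentially q_def using X X0 by (auto simp: o_def)
        then show "(\<lambda>n. q (n + n0) x) \<longlonglongrightarrow> p * \<bar>z x\<bar> powr (p - 2) * z x * h x"
          by (rule LIMSEQ_ignore_initial_segment)
      qed
      show "AE x in M. norm (q (n + n0) x) \<le> w x" for n
        using abs_powr_quotient_bound[OF p] X n0[of "n + n0"] unfolding q_def w_def by (intro AE_I2) auto
    qed (auto simp: q_def)
    then have "(\<lambda>n. LINT x|M. q n x) \<longlonglongrightarrow> (LINT x|M. p * \<bar>z x\<bar> powr (p - 2) * z x * h x)"
      by (rule LIMSEQ_offset)
    moreover have "(LINT x|M. q n x) = (Lp_int M p (\<lambda>x. z x + X n * h x) - Lp_int M p z) / X n" for n
      using zt[of "X n"] z unfolding q_def Lp_int_def by (simp add: Lp_def)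
    ultimately show "((\<lambda>h'. (Lp_int M p (\<lambda>x. z x + (0 + h') * h x) - Lp_int M p (\<lambda>x. z x + 0 * h x)) / h') \<circ> X)
        \<longlonglongrightarrow> p * (LINT x|M. \<bar>z x\<bar> powr (p - 2) * z x * h x)"
      by (simp add: o_def mult.assoc)
  qed
qed

lemma Lp_norm_sq: "0 < p \<Longrightarrow> (Lp_norm M p u)\<^sup>2 = Lp_int M p u powr (2 / p)"
proof -
  assume p: "0 < p"
  have "(Lp_norm M p u)\<^sup>2 = Lp_norm M p u powr 2" using Lp_norm_nonneg[of M p u] by simp
  then show ?thesis unfolding Lp_norm_def by (simp add: powr_powr)
qed

lemma Lp_norm_sq_has_derivative:
  assumes p: "1 < p" and z: "z \<in> Lp M p" and h: "h \<in> Lp M p" and pos: "0 < Lp_int M p z"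
  shows "((\<lambda>\<tau>. (Lp_norm M p (\<lambda>x. z x + \<tau> * h x))\<^sup>2) has_real_derivative
      2 * Lp_int M p z powr (2 / p - 1) * (LINT x|M. \<bar>z x\<bar> powr (p - 2) * z x * h x)) (at 0)"
proof -
  have "((\<lambda>\<tau>. Lp_int M p (\<lambda>x. z x + \<tau> * h x) powr (2 / p)) has_real_derivative
      2 / p * Lp_int M p (\<lambda>x. z x + 0 * h x) powr (2 / p - 1) * (p * (LINT x|M. \<bar>z x\<bar> powr (p - 2) * z x * h x))) (at 0)"
    by (rule DERIV_chain2[OF has_real_derivative_powr Lp_int_has_derivative[OF p z h]]) (use pos in simp)
  then show ?thesis using p by (simp add: Lp_norm_sq mult.assoc)
qed

lemma Lp_duality_integrable:
  assumes p: "1 < p" and z: "z \<in> Lp M p" and h: "h \<in> Lp M p"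
  shows "integrable M (\<lambda>x. \<bar>z x\<bar> powr (p - 2) * z x * h x)"
proof (rule Bochner_Integration.integrable_bound)
  have [measurable]: "z \<in> borel_measurable M" "h \<in> borel_measurable M"
    using z h by (auto simp: Lp_def)
  show "(\<lambda>x. \<bar>z x\<bar> powr (p - 2) * z x * h x) \<in> borel_measurable M" by measurable
  have "(\<lambda>x. \<bar>z x\<bar>) \<in> Lp M p" "(\<lambda>x. \<bar>h x\<bar>) \<in> Lp M p" using z h by (auto simp: Lp_def)
  from Lp_add[OF less_imp_le[OF p] this]
  show "integrable M (\<lambda>x. (\<bar>z x\<bar> + \<bar>h x\<bar>) powr p)" by (simp add: Lp_def)
  show "AE x in M. norm (\<bar>z x\<bar> powr (p - 2) * z x * h x) \<le> norm ((\<bar>z x\<bar> + \<bar>h x\<bar>) powr p)"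
  proof (rule AE_I2)
    fix x
    define m where "m = \<bar>z x\<bar> + \<bar>h x\<bar>"
    have "\<bar>z x\<bar> powr (p - 2) * \<bar>z x\<bar> = \<bar>z x\<bar> powr (p - 1)"
      using powr_add[of "\<bar>z x\<bar>" "p - 2" 1] by simp
    also have "\<dots> \<le> m powr (p - 1)" using p by (intro powr_mono2) (auto simp: m_def)
    finally have "\<bar>z x\<bar> powr (p - 2) * \<bar>z x\<bar> * \<bar>h x\<bar> \<le> m powr (p - 1) * m"
      by (intro mult_mono) (auto simp: m_def)
    also have "\<dots> = m powr p" using powr_add[of m "p - 1" 1] by (simp add: m_def)
    finally show "norm (\<bar>z x\<bar> powr (p - 2) * z x * h x) \<le> norm ((\<bar>z x\<bar> + \<bar>h x\<bar>) powr p)"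
      by (simp add: abs_mult m_def)
  qed
qed


section \<open>Sobolev inequality and spectral gap\<close>

text \<open>Indicator functions of sets of arbitrarily small positive measure keep \<open>L\<^sup>p\<close> from being all of
  \<open>L\<^sup>2\<close>.\<close>

locale sobolev_embedding = sobolev_basis +
  fixes p S :: real
  assumes p: "2 < p" and S: "0 < S"
    and small_sets: "0 < e \<Longrightarrow> \<exists>A\<in>sets M. 0 < measure M A \<and> measure M A < e"
    and FE_Lp: "FE u \<Longrightarrow> u \<in> Lp M p"
    and sobolev: "FE u \<Longrightarrow> S * (Lp_norm M p u)\<^sup>2 \<le> E u"
begin

text \<open>If the eigenvalues were bounded, the energy would be bounded by the square norm, and the
  Sobolev inequality would fail for indicator functions of small sets: their norm in \<open>L\<^sup>p\<close> is of
  larger order than their norm in \<open>L\<^sup>2\<close>.\<close>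

lemma Lam_at_top: "filterlim \<Lambda> at_top sequentially"
proof -
  have "\<exists>j. L < \<Lambda> j" if L: "0 < L" for L
  proof (rule ccontr)
    assume "\<not> (\<exists>j. L < \<Lambda> j)"
    then have le: "\<Lambda> j \<le> L" for j by (simp add: not_less)
    have q: "0 < 1 - 2 / p" using p by simp
    \<comment> \<open>sets of measure \<open>a < e\<close> violate \<open>S a\<^sup>2\<^sup>/\<^sup>p \<le> L a\<close>\<close>
    define e where "e = (S / L) powr (1 / (1 - 2 / p))"
    have "0 < e" using S L by (simp add: e_def)
    then obtain A where A: "A \<in> sets M" "0 < measure M A" "measure M A < e" using small_sets by blast
    define a where "a = measure M A"
    have a: "0 < a" "a < e" using A by (auto simp: a_def)
    define i where "i = (indicator A :: 'a \<Rightarrow> real)"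
    have i2: "(i x)\<^sup>2 = indicator A x" "\<bar>i x\<bar> powr p = indicator A x" for x
      using p by (auto simp: i_def indicator_def)
    have [measurable]: "i \<in> borel_measurable M" using A by (simp add: i_def)
    have ii: "integrable M (indicator A :: 'a \<Rightarrow> real)"
      using A by (intro integrable_real_indicator) (auto simp: less_top[symmetric])
    have isq: "i \<in> sqint M" using ii by (simp add: sqint_def i2)
    have sqi: "sq M i = a" using A by (simp add: sq_def i2 a_def)
    have Li: "Lp_int M p i = a" using A by (simp add: Lp_int_def i2 a_def)
    have summ: "summable (\<lambda>j. L * (co i j)\<^sup>2)" using parseval_sq[OF isq] by (intro summable_mult) (simp add: sums_iff)
    have pw: "\<Lambda> j * (co i j)\<^sup>2 \<le> L * (co i j)\<^sup>2" for j using le by (intro mult_right_mono) auto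
    have FEi: "FE i" unfolding FE_def
    proof (intro conjI isq summable_comparison_test[OF _ summ] exI[of _ 0] allI impI)
      show "norm (\<Lambda> n * (co i n)\<^sup>2) \<le> L * (co i n)\<^sup>2" for n
        using pw[of n] Lam_pos[of n] by simp
    qed
    have "E i \<le> L * a"
      by (rule sums_le[OF pw E_sums[OF FEi] sums_mult[OF parseval_sq[OF isq, unfolded sqi]]])
    then have "S * a powr (2 / p) \<le> L * a"
      using sobolev[OF FEi] p by (simp add: Lp_norm_sq Li)
    moreover have "L * a = L * (a powr (1 - 2 / p)) * a powr (2 / p)"
      using a by (simp add: powr_add[symmetric] mult.assoc)
    ultimately have "S * a powr (2 / p) \<le> L * (a powr (1 - 2 / p)) * a powr (2 / p)" by simp
    then have "S \<le> L * (a powr (1 - 2 / p))" using a by simp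
    also have "a powr (1 - 2 / p) < e powr (1 - 2 / p)" using a q by (intro powr_less_mono2) auto
    also have "e powr (1 - 2 / p) = S / L" using q S L p by (simp add: e_def powr_powr)
    finally show False using L by simp
  qed
  then have *: "\<exists>j. L \<le> \<Lambda> j" for L by (metis less_imp_le linorder_not_le order_trans zero_less_one)
  show ?thesis
    unfolding filterlim_at_top eventually_sequentially
  proof
    fix Z
    obtain j where "Z \<le> \<Lambda> j" using * by blast
    then show "\<exists>N. \<forall>n\<ge>N. Z \<le> \<Lambda> n" using Lam_mono order_trans by blast
  qed
qed

abbreviation N :: "('a \<Rightarrow> real) \<Rightarrow> real" where "N u \<equiv> (Lp_norm M p u)\<^sup>2"

lemma N_le_E: "FE u \<Longrightarrow> N u \<le> E u / S"
  using sobolev S by (simp add: pos_le_divide_eq mult.commute)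

lemma N_cmult: "N (\<lambda>x. c * u x) = c\<^sup>2 * N u"
  using p by (simp add: Lp_norm_cmult power_mult_distrib)

lemma co_tendsto_0:
  assumes r: "\<And>n. FE (r n)" and lim: "(\<lambda>n. E (r n)) \<longlonglongrightarrow> 0"
  shows "(\<lambda>n. co (r n) j) \<longlonglongrightarrow> 0"
proof -
  have bound: "norm (co (r n) j) \<le> sqrt (E (r n) / \<Lambda> 0)" for n
  proof -
    have "(co (r n) j)\<^sup>2 \<le> sq M (r n)"
      using sum_le_suminf[of "\<lambda>j. (co (r n) j)\<^sup>2" "{j}"] parseval_sq[OF FE_sqint[OF r]]
      by (simp add: sums_iff)
    also have "\<dots> \<le> E (r n) / \<Lambda> 0"
      using sq_le_E[OF r[of n]] Lam_pos[of 0] by (simp add: pos_le_divide_eq mult.commute)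
    finally have "sqrt ((co (r n) j)\<^sup>2) \<le> sqrt (E (r n) / \<Lambda> 0)" by (rule real_sqrt_le_mono)
    then show ?thesis by simp
  qed
  have "(\<lambda>n. sqrt (E (r n) / \<Lambda> 0)) \<longlonglongrightarrow> sqrt (0 / \<Lambda> 0)"
    using Lam_pos[of 0] by (intro tendsto_real_sqrt tendsto_divide lim tendsto_const) auto
  then have lim0: "(\<lambda>n. sqrt (E (r n) / \<Lambda> 0)) \<longlonglongrightarrow> 0" by simp
  show ?thesis by (rule Lim_null_comparison[OF always_eventually lim0]) (rule allI, rule bound)
qed

lemma N_tendsto:
  assumes w: "FE w" and wn: "\<And>n. FE (wn n)" and lim: "(\<lambda>n. E (\<lambda>x. wn n x - w x)) \<longlonglongrightarrow> 0"
  shows "(\<lambda>n. N (wn n)) \<longlonglongrightarrow> N w"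
proof -
  have p1: "1 \<le> p" using p by simp
  have bound: "norm (Lp_norm M p (wn n) - Lp_norm M p w) \<le> sqrt (E (\<lambda>x. wn n x - w x) / S)" for n
  proof -
    have d: "FE (\<lambda>x. wn n x - w x)" by (intro FE_diff w wn)
    have "Lp_norm M p (\<lambda>x. wn n x - w x) \<le> sqrt (E (\<lambda>x. wn n x - w x) / S)"
      by (rule real_le_rsqrt[OF N_le_E[OF d]])
    moreover have "Lp_norm M p (wn n) \<le> Lp_norm M p (\<lambda>x. wn n x - w x) + Lp_norm M p w"
      using Lp_norm_triangle[OF p1 FE_Lp[OF d] FE_Lp[OF w]] by simp
    moreover have "Lp_norm M p w \<le> Lp_norm M p (\<lambda>x. (-1) * (wn n x - w x)) + Lp_norm M p (wn n)"
      using Lp_norm_triangle[OF p1 Lp_cmult[OF FE_Lp[OF d], of "-1"] FE_Lp[OF wn[of n]]] by simp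
    moreover have "Lp_norm M p (\<lambda>x. (-1) * (wn n x - w x)) = Lp_norm M p (\<lambda>x. wn n x - w x)"
      using Lp_norm_cmult[of p M "-1" "\<lambda>x. wn n x - w x"] p by simp
    ultimately show ?thesis unfolding real_norm_def by linarith
  qed
  have "(\<lambda>n. sqrt (E (\<lambda>x. wn n x - w x) / S)) \<longlonglongrightarrow> sqrt (0 / S)"
    using S by (intro tendsto_real_sqrt tendsto_divide lim tendsto_const) auto
  then have lim0: "(\<lambda>n. sqrt (E (\<lambda>x. wn n x - w x) / S)) \<longlonglongrightarrow> 0" by simp
  have "(\<lambda>n. Lp_norm M p (wn n) - Lp_norm M p w) \<longlonglongrightarrow> 0"
    by (rule Lim_null_comparison[OF always_eventually lim0]) (rule allI, rule bound)
  then have "(\<lambda>n. Lp_norm M p (wn n)) \<longlonglongrightarrow> Lp_norm M p w" by (rule LIM_zero_cancel)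
  then show ?thesis by (rule tendsto_power)
qed

lemma E_eq_0_imp_N: "FE u \<Longrightarrow> E u = 0 \<Longrightarrow> N u = 0"
  using N_le_E[of u] by (simp add: antisym)

lemma Lp_int_pos:
  assumes "FE u" "co u j \<noteq> 0" shows "0 < Lp_int M p u"
proof -
  have "0 < (co u j)\<^sup>2" using assms by simp
  also have "\<dots> \<le> sq M u"
    using sum_le_suminf[of "\<lambda>j. (co u j)\<^sup>2" "{j}"] parseval_sq[OF FE_sqint[OF assms(1)]]
    by (simp add: sums_iff)
  also have "\<dots> \<le> measure M (space M) powr (1 - 2 / p) * N u"
    using p by (intro sq_le_Lp_norm FE_Lp FE_sqint assms) auto
  finally have "N u \<noteq> 0" by auto
  then have "Lp_int M p u \<noteq> 0" using p by (auto simp: Lp_norm_def)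
  then show ?thesis using Lp_int_nonneg[of M p u] by simp
qed

end

text \<open>The number \<open>\<mu>\<close> lies between consecutive distinct eigenvalues, and so close to the upper one that
  the quotients \<open>Q / N\<close> stay below \<open>S\<close> on the span of the first \<open>K + 1\<close> basis functions.\<close>

locale spectral_gap = sobolev_embedding +
  fixes \<mu> :: real and K :: nat
  assumes K: "0 < K" and mu_nonneg: "0 \<le> \<mu>" and gap: "\<Lambda> (K - 1) < \<mu>" "\<mu> < \<Lambda> K"
    and small_gap: "(\<Lambda> K - \<mu>) * measure M (space M) powr (1 - 2 / p) < S"
begin

definition B :: "('a \<Rightarrow> real) \<Rightarrow> ('a \<Rightarrow> real) \<Rightarrow> real" where
  "B u v = D u v - \<mu> * ip M u v"

abbreviation Q :: "('a \<Rightarrow> real) \<Rightarrow> real" where "Q u \<equiv> B u u"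

text \<open>The spaces \<open>H\<^sup>+\<close> and \<open>H\<^sup>-\<close>, the latter spanned by the basis functions with index below \<open>K\<close>.\<close>

definition Plus :: "('a \<Rightarrow> real) \<Rightarrow> bool" where
  "Plus u \<longleftrightarrow> FE u \<and> (\<forall>j<K. co u j = 0)"

definition Minus :: "('a \<Rightarrow> real) \<Rightarrow> bool" where
  "Minus u \<longleftrightarrow> FE u \<and> (\<forall>j\<ge>K. co u j = 0)"

lemma Plus_FE: "Plus u \<Longrightarrow> FE u" and Minus_FE: "Minus u \<Longrightarrow> FE u"
  by (auto simp: Plus_def Minus_def)

lemma below_gap: "j < K \<Longrightarrow> \<Lambda> j \<le> \<Lambda> (K - 1)"
  by (rule Lam_mono) simp

lemma B_sums: "FE u \<Longrightarrow> FE v \<Longrightarrow> (\<lambda>j. (\<Lambda> j - \<mu>) * (co u j * co v j)) sums B u v"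
  using sums_diff[OF D_sums[of u v] sums_mult[OF parseval[of u v], of \<mu>]]
  by (simp add: B_def FE_sqint left_diff_distrib)

lemma B_commute: "B u v = B v u"
  by (simp add: B_def D_commute[of u v] ip_commute[of M u v])

lemma B_add_right: "FE u \<Longrightarrow> FE v \<Longrightarrow> FE w \<Longrightarrow> B w (\<lambda>x. u x + v x) = B w u + B w v"
  by (simp add: B_def D_add_right ip_add_right FE_sqint algebra_simps)

lemma B_cmult_right: "FE u \<Longrightarrow> FE w \<Longrightarrow> B w (\<lambda>x. c * u x) = c * B w u"
  using ip_cmult_left[of M c u w]
  by (simp add: B_def D_cmult_right ip_commute[of M w] algebra_simps)

lemma B_add_left: "FE u \<Longrightarrow> FE v \<Longrightarrow> FE w \<Longrightarrow> B (\<lambda>x. u x + v x) w = B u w + B v w"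
  unfolding B_commute[of _ w] by (rule B_add_right)

lemma B_cmult_left: "FE u \<Longrightarrow> FE w \<Longrightarrow> B (\<lambda>x. c * u x) w = c * B u w"
  unfolding B_commute[of _ w] by (rule B_cmult_right)

lemma Q_add: "FE u \<Longrightarrow> FE v \<Longrightarrow> Q (\<lambda>x. u x + v x) = Q u + 2 * B u v + Q v"
  using B_commute[of v u] by (simp add: B_add_left B_add_right FE_add)

lemma Q_cmult: "FE u \<Longrightarrow> Q (\<lambda>x. c * u x) = c\<^sup>2 * Q u"
  by (simp add: B_cmult_left B_cmult_right FE_cmult power2_eq_square)

lemma Plus_add: "Plus u \<Longrightarrow> Plus v \<Longrightarrow> Plus (\<lambda>x. u x + v x)"
  by (simp add: Plus_def FE_add co_add FE_sqint)

lemma Plus_cmult: "Plus u \<Longrightarrow> Plus (\<lambda>x. c * u x)"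
  by (simp add: Plus_def FE_cmult co_cmult)

lemma Minus_add: "Minus u \<Longrightarrow> Minus v \<Longrightarrow> Minus (\<lambda>x. u x + v x)"
  by (simp add: Minus_def FE_add co_add FE_sqint)

lemma Minus_cmult: "Minus u \<Longrightarrow> Minus (\<lambda>x. c * u x)"
  by (simp add: Minus_def FE_cmult co_cmult)

lemma Minus_zero: "Minus (\<lambda>x. 0)"
  using Minus_cmult[of "expand K (\<lambda>_. 0)" 0] by (simp add: Minus_def FE_expand co_expand)

lemma B_Plus_Minus: "Plus u \<Longrightarrow> Minus v \<Longrightarrow> B u v = 0"
proof -
  assume a: "Plus u" "Minus v"
  have "(\<Lambda> j - \<mu>) * (co u j * co v j) = 0" for j
    using a by (cases "j < K") (auto simp: Plus_def Minus_def)
  then have "(\<lambda>j. (\<Lambda> j - \<mu>) * (co u j * co v j)) sums 0"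
    by (simp only: sums_zero)
  then show "B u v = 0"
    by (rule sums_unique2[OF B_sums[OF Plus_FE[OF a(1)] Minus_FE[OF a(2)]]])
qed

lemma Q_Plus_Minus: "Plus u \<Longrightarrow> Minus v \<Longrightarrow> Q (\<lambda>x. u x + v x) = Q u + Q v"
  by (simp add: Q_add B_Plus_Minus Plus_FE Minus_FE)

text \<open>The constants that compare the energy with \<open>Q\<close> on the two subspaces; the eigenvalues next to
  \<open>\<mu>\<close> are the worst ones.\<close>

definition kp :: real where "kp = \<Lambda> K / (\<Lambda> K - \<mu>)"
definition km :: real where "km = \<Lambda> (K - 1) / (\<mu> - \<Lambda> (K - 1))"

lemma kp_pos: "0 < kp" and km_pos: "0 < km"
  using gap Lam_pos by (auto simp: kp_def km_def)

lemma E_le_Q_Plus: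
  assumes "Plus u" shows "E u \<le> kp * Q u"
proof (rule sums_le[OF _ E_sums sums_mult[OF B_sums]])
  fix j
  show "\<Lambda> j * (co u j)\<^sup>2 \<le> kp * ((\<Lambda> j - \<mu>) * (co u j * co u j))"
  proof (cases "j < K")
    case True then show ?thesis using assms by (simp add: Plus_def)
  next
    case False
    then have le: "\<Lambda> K \<le> \<Lambda> j" by (intro Lam_mono) simp
    have "\<mu> * (\<Lambda> j - \<Lambda> K) \<ge> 0" using le mu_nonneg by simp
    then have "\<Lambda> j * (\<Lambda> K - \<mu>) \<le> \<Lambda> K * (\<Lambda> j - \<mu>)" by (simp add: algebra_simps)
    then have "\<Lambda> j \<le> kp * (\<Lambda> j - \<mu>)" using gap by (simp add: kp_def pos_le_divide_eq)
    from mult_right_mono[OF this, of "(co u j)\<^sup>2"] show ?thesis by (simp add: power2_eq_square mult.assoc)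
  qed
qed (use assms Plus_FE in auto)

lemma E_le_Q_Minus:
  assumes "Minus u" shows "E u \<le> km * (- Q u)"
proof -
  have "(\<lambda>j. km * (- ((\<Lambda> j - \<mu>) * (co u j * co u j)))) sums (km * (- Q u))"
    by (intro sums_mult sums_minus B_sums Minus_FE assms)
  moreover have "\<Lambda> j * (co u j)\<^sup>2 \<le> km * (- ((\<Lambda> j - \<mu>) * (co u j * co u j)))" for j
  proof (cases "j < K")
    case False then show ?thesis using assms by (simp add: Minus_def)
  next
    case True
    have le: "\<Lambda> j \<le> \<Lambda> (K - 1)" by (rule below_gap[OF True])
    have "\<mu> * (\<Lambda> (K - 1) - \<Lambda> j) \<ge> 0" using le mu_nonneg by simp
    then have "\<Lambda> j * (\<mu> - \<Lambda> (K - 1)) \<le> \<Lambda> (K - 1) * (\<mu> - \<Lambda> j)" by (simp add: algebra_simps)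
    then have "\<Lambda> j \<le> km * (\<mu> - \<Lambda> j)" using gap by (simp add: km_def pos_le_divide_eq)
    from mult_right_mono[OF this, of "(co u j)\<^sup>2"] show ?thesis by (simp add: power2_eq_square algebra_simps)
  qed
  ultimately show ?thesis by (intro sums_le[OF _ E_sums[OF Minus_FE[OF assms]]])
qed

lemma Q_Plus_nonneg: "Plus u \<Longrightarrow> 0 \<le> Q u"
  using order_trans[OF E_nonneg[OF Plus_FE] E_le_Q_Plus, of u] kp_pos by (simp add: zero_le_mult_iff)

lemma Q_Minus_nonpos: "Minus u \<Longrightarrow> Q u \<le> 0"
  using order_trans[OF E_nonneg[OF Minus_FE] E_le_Q_Minus, of u] km_pos
  by (simp add: mult_le_0_iff)

text \<open>The energy splits in the limit because the mixed terms vanish under weak convergence; the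
  square norms of the vanishing part tend to zero by compactness.\<close>

lemma Q_split:
  assumes w: "FE w" and r: "\<And>n. FE (r n)" "\<And>n. E (r n) \<le> C" "\<And>j. (\<lambda>n. co (r n) j) \<longlonglongrightarrow> 0"
    and lim: "(\<lambda>n. E (r n)) \<longlonglongrightarrow> \<rho>"
  shows "(\<lambda>n. Q (\<lambda>x. w x + r n x)) \<longlonglongrightarrow> Q w + \<rho>"
proof -
  have s: "(\<lambda>n. sq M (r n)) \<longlonglongrightarrow> 0" by (rule sq_tendsto_0[OF Lam_at_top r])
  have "(\<lambda>n. sqrt (sq M w) * sqrt (sq M (r n))) \<longlonglongrightarrow> sqrt (sq M w) * sqrt 0"
    by (rule tendsto_mult[OF tendsto_const tendsto_real_sqrt[OF s]])
  then have lim0: "(\<lambda>n. sqrt (sq M w) * sqrt (sq M (r n))) \<longlonglongrightarrow> 0" by simp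
  have i: "(\<lambda>n. ip M w (r n)) \<longlonglongrightarrow> 0"
  proof (rule Lim_null_comparison[OF always_eventually lim0], rule allI)
    show "norm (ip M w (r n)) \<le> sqrt (sq M w) * sqrt (sq M (r n))" for n
      unfolding real_norm_def by (rule ip_abs_le[OF FE_sqint[OF w] FE_sqint[OF r(1)]])
  qed
  have "(\<lambda>n. Q w + 2 * (D w (r n) - \<mu> * ip M w (r n)) + (E (r n) - \<mu> * sq M (r n)))
     \<longlonglongrightarrow> Q w + 2 * (0 - \<mu> * 0) + (\<rho> - \<mu> * 0)"
    by (rule tendsto_add[OF tendsto_add[OF tendsto_const tendsto_mult[OF tendsto_const
          tendsto_diff[OF D_weak_tendsto[OF w r] tendsto_mult[OF tendsto_const i]]]]
          tendsto_diff[OF lim tendsto_mult[OF tendsto_const s]]])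
  moreover have "Q (\<lambda>x. w x + r n x) = Q w + 2 * (D w (r n) - \<mu> * ip M w (r n)) + (E (r n) - \<mu> * sq M (r n))" for n
    unfolding Q_add[OF w r(1)] by (simp add: B_def sq_eq_ip)
  ultimately show ?thesis by simp
qed

lemma Q_tendsto:
  assumes w: "FE w" and wn: "\<And>n. FE (wn n)" and lim: "(\<lambda>n. E (\<lambda>x. wn n x - w x)) \<longlonglongrightarrow> 0"
  shows "(\<lambda>n. Q (wn n)) \<longlonglongrightarrow> Q w"
proof -
  have r: "FE (\<lambda>x. wn n x - w x)" for n by (intro FE_diff w wn)
  obtain C where C: "\<And>n. norm (E (\<lambda>x. wn n x - w x)) \<le> C"
    using convergent_imp_bounded[OF lim] by (auto simp: bounded_iff)
  have "(\<lambda>n. Q (\<lambda>x. w x + (wn n x - w x))) \<longlonglongrightarrow> Q w + 0"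
    using C by (intro Q_split[OF w r _ co_tendsto_0[OF r lim] lim]) (auto simp: abs_le_iff)
  then show ?thesis by simp
qed

text \<open>Bounded sequences in \<open>H\<^sup>-\<close> converge strongly along a subsequence, since only \<open>K\<close> coefficients
  differ from zero.\<close>

lemma Minus_compact:
  assumes v: "\<And>n. Minus (v n)" "\<And>n. E (v n) \<le> C"
  obtains w \<sigma> where "strict_mono (\<sigma> :: nat \<Rightarrow> nat)" "Minus w" "(\<lambda>n. E (\<lambda>x. v (\<sigma> n) x - w x)) \<longlonglongrightarrow> 0"
proof -
  obtain w \<sigma> where \<sigma>: "strict_mono (\<sigma> :: nat \<Rightarrow> nat)" and w: "FE w"
    and lim: "\<And>j. (\<lambda>n. co (v (\<sigma> n)) j) \<longlonglongrightarrow> co w j"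
    by (rule compactness[where u = v and C = C, OF Lam_at_top Minus_FE[OF v(1)] v(2)]) auto
  have w0: "co w j = 0" if "j \<ge> K" for j
  proof -
    have "(\<lambda>n. co (v (\<sigma> n)) j) = (\<lambda>n. 0)" using v(1) that by (auto simp: Minus_def)
    then show ?thesis using LIMSEQ_unique[OF lim[of j]] by (simp add: LIMSEQ_const_iff)
  qed
  have Mw: "Minus w" using w w0 by (simp add: Minus_def)
  have Eeq: "E (\<lambda>x. v (\<sigma> n) x - w x) = (\<Sum>j<K. \<Lambda> j * (co (v (\<sigma> n)) j - co w j)\<^sup>2)" for n
  proof -
    have "(\<lambda>j. \<Lambda> j * (co (\<lambda>x. v (\<sigma> n) x - w x) j)\<^sup>2) sums (\<Sum>j<K. \<Lambda> j * (co (\<lambda>x. v (\<sigma> n) x - w x) j)\<^sup>2)"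
      using v(1) Mw by (intro sums_finite) (auto simp: Minus_def co_diff FE_sqint)
    from sums_unique2[OF E_sums[OF FE_diff[OF Minus_FE[OF v(1)] w]] this] show ?thesis
      using FE_sqint[OF Minus_FE[OF v(1)]] FE_sqint[OF w] by (simp add: co_diff)
  qed
  have "(\<lambda>n. \<Sum>j<K. \<Lambda> j * (co (v (\<sigma> n)) j - co w j)\<^sup>2) \<longlonglongrightarrow> (\<Sum>j<K. \<Lambda> j * (co w j - co w j)\<^sup>2)"
    by (intro tendsto_sum tendsto_mult tendsto_const tendsto_power tendsto_diff lim)
  then have "(\<lambda>n. E (\<lambda>x. v (\<sigma> n) x - w x)) \<longlonglongrightarrow> 0" unfolding Eeq by simp
  with \<sigma> Mw show thesis by (rule that)
qed


section \<open>The minimax problem\<close>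

text \<open>The inverse of an admissible number bounds the linking level
  \<open>inf\<^sub>u sup\<^sub>v Q (u + v) / N (u + v)\<close> from below. Stating the bound without quotients covers the
  functions at which \<open>N\<close> or \<open>Q\<close> vanish.\<close>

definition admissible :: "real \<Rightarrow> bool" where
  "admissible c \<longleftrightarrow> 0 < c \<and>
     (\<forall>u. Plus u \<longrightarrow> (\<exists>v. Minus v \<and> N (\<lambda>x. u x + v x) \<le> c * Q (\<lambda>x. u x + v x)))"

text \<open>On \<open>H\<^sup>+\<close> the choice \<open>v = 0\<close> suffices, by the Sobolev inequality.\<close>

lemma admissible_kp: "admissible (kp / S)"
  unfolding admissible_def
proof (intro conjI allI impI)
  show "0 < kp / S" using kp_pos S by simp
  fix u assume u: "Plus u"
  have "N u \<le> E u / S" by (rule N_le_E[OF Plus_FE[OF u]])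
  also have "\<dots> \<le> kp * Q u / S" using E_le_Q_Plus[OF u] S by (simp add: divide_right_mono)
  finally show "\<exists>v. Minus v \<and> N (\<lambda>x. u x + v x) \<le> kp / S * Q (\<lambda>x. u x + v x)"
    using Minus_zero by (intro exI[of _ "\<lambda>x. 0"]) simp
qed

lemma Plus_basis: "Plus (\<phi> K)"
  unfolding Plus_def FE_def
  by (intro conjI basis_sqint summable_finite[of "{K}"]) (auto simp: co_basis)

text \<open>Testing with \<open>\<phi> K\<close>: on the span of \<open>H\<^sup>-\<close> and \<open>\<phi> K\<close> one has \<open>Q \<le> (\<Lambda> K - \<mu>) \<parallel>w\<parallel>\<^sup>2\<close>, which Hoelder's inequality
  bounds by a multiple of \<open>N w\<close> whose factor is below \<open>S\<close>.\<close>

lemma admissible_lower_bound: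
  assumes c: "admissible c" shows "1 / S < c"
proof -
  define m where "m = measure M (space M) powr (1 - 2 / p)"
  obtain v where v: "Minus v" and le: "N (\<lambda>x. \<phi> K x + v x) \<le> c * Q (\<lambda>x. \<phi> K x + v x)"
    using c Plus_basis unfolding admissible_def by blast
  define w where "w = (\<lambda>x. \<phi> K x + v x)"
  have w: "FE w" unfolding w_def by (intro FE_add Plus_FE[OF Plus_basis] Minus_FE[OF v])
  have cw: "co w j = (if j = K then 1 else co v j)" for j
    unfolding w_def using v FE_sqint[OF Minus_FE[OF v]]
    by (auto simp: co_add basis_sqint co_basis Minus_def)
  have "Q w \<le> (\<Lambda> K - \<mu>) * sq M w"
  proof (rule sums_le[OF _ B_sums[OF w w] sums_mult[OF parseval_sq[OF FE_sqint[OF w]]]])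
    fix j
    show "(\<Lambda> j - \<mu>) * (co w j * co w j) \<le> (\<Lambda> K - \<mu>) * (co w j)\<^sup>2"
    proof (cases "j \<le> K")
      case True
      then show ?thesis unfolding power2_eq_square by (intro mult_right_mono) (auto simp: Lam_mono)
    next
      case False then show ?thesis using v by (simp add: cw Minus_def)
    qed
  qed
  also have "\<dots> \<le> (\<Lambda> K - \<mu>) * (m * N w)"
    unfolding m_def using gap p by (intro mult_left_mono sq_le_Lp_norm FE_Lp FE_sqint w) auto
  finally have Qle: "Q w \<le> (\<Lambda> K - \<mu>) * m * N w" by (simp add: mult.assoc)
  have Npos: "0 < N w"
    using Lp_int_pos[OF w, of K] p by (simp add: cw Lp_norm_def)
  have c0: "0 < c" using c by (simp add: admissible_def)
  have "N w \<le> c * Q w" using le unfolding w_def .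
  also have "\<dots> \<le> c * ((\<Lambda> K - \<mu>) * m * N w)" using Qle c0 by (intro mult_left_mono) auto
  finally have "1 * N w \<le> (c * ((\<Lambda> K - \<mu>) * m)) * N w" by (simp add: mult.assoc)
  then have "1 \<le> c * ((\<Lambda> K - \<mu>) * m)" using Npos by (rule mult_right_le_imp_le)
  also have "\<dots> < c * S" using small_gap c0 unfolding m_def by (intro mult_strict_left_mono)
  finally show ?thesis using S by (simp add: pos_divide_less_eq)
qed

text \<open>The infimum is itself admissible: functions \<open>v\<close> that serve for numbers decreasing to it are
  bounded, as \<open>Q (u + v) \<ge> 0\<close>, and converge by \<open>Minus_compact\<close>.\<close>

lemma obtain_least_admissible:
  obtains c where "admissible c" "1 / S < c" "\<And>d. 0 < d \<Longrightarrow> d < c \<Longrightarrow> \<not> admissible d"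
proof -
  define A where "A = {c. admissible c}"
  define c where "c = Inf A"
  have ne: "A \<noteq> {}" using admissible_kp by (auto simp: A_def)
  have bdd: "bdd_below A" by (rule bdd_belowI[of _ "1 / S"]) (auto simp: A_def dest: admissible_lower_bound)
  have "1 / S \<le> c" unfolding c_def by (rule cInf_greatest[OF ne]) (auto simp: A_def dest: admissible_lower_bound)
  then have c0: "0 < c" using S by (meson less_le_trans zero_less_divide_1_iff)
  have adm: "admissible c"
    unfolding admissible_def
  proof (intro conjI c0 allI impI)
    fix u assume u: "Plus u"
    define e where "e n = c + 1 / real (Suc n)" for n
    have e0: "0 < e n" for n using c0 unfolding e_def by (simp add: add_pos_pos)
    have "\<exists>v. Minus v \<and> N (\<lambda>x. u x + v x) \<le> e n * Q (\<lambda>x. u x + v x)" for n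
    proof -
      have "Inf A < e n" unfolding c_def[symmetric] e_def by simp
      then obtain a where a: "a \<in> A" "a < e n" using cInf_lessD[OF ne] by blast
      then obtain v where v: "Minus v" "N (\<lambda>x. u x + v x) \<le> a * Q (\<lambda>x. u x + v x)" and a0: "0 < a"
        using u by (auto simp: A_def admissible_def)
      have "0 \<le> a * Q (\<lambda>x. u x + v x)" using v(2) by (meson order_trans zero_le_power2)
      then have "0 \<le> Q (\<lambda>x. u x + v x)" using a0 by (simp add: zero_le_mult_iff)
      then have "a * Q (\<lambda>x. u x + v x) \<le> e n * Q (\<lambda>x. u x + v x)" using a by (intro mult_right_mono) auto
      then show ?thesis using v by (meson order_trans)
    qed
    then obtain v where v: "\<And>n. Minus (v n)" and le: "\<And>n. N (\<lambda>x. u x + v n x) \<le> e n * Q (\<lambda>x. u x + v n x)"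
      by metis
    have Ev: "E (v n) \<le> km * Q u" for n
    proof -
      have "0 \<le> e n * Q (\<lambda>x. u x + v n x)" using le[of n] by (meson order_trans zero_le_power2)
      then have "0 \<le> Q (\<lambda>x. u x + v n x)" using e0[of n] by (simp add: zero_le_mult_iff)
      then have "- Q (v n) \<le> Q u" using Q_Plus_Minus[OF u v, of n] by simp
      then have "km * (- Q (v n)) \<le> km * Q u" using km_pos by (intro mult_left_mono) auto
      then show ?thesis using E_le_Q_Minus[OF v[of n]] by linarith
    qed
    obtain w \<sigma> where \<sigma>: "strict_mono (\<sigma> :: nat \<Rightarrow> nat)" and w: "Minus w"
      and lim: "(\<lambda>n. E (\<lambda>x. v (\<sigma> n) x - w x)) \<longlonglongrightarrow> 0"
      by (rule Minus_compact[where v = v and C = "km * Q u", OF v Ev]) auto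
    have FEw: "FE (\<lambda>x. u x + w x)" by (intro FE_add Plus_FE[OF u] Minus_FE[OF w])
    have FEv: "FE (\<lambda>x. u x + v (\<sigma> n) x)" for n by (intro FE_add Plus_FE[OF u] Minus_FE[OF v])
    have lim': "(\<lambda>n. E (\<lambda>x. (u x + v (\<sigma> n) x) - (u x + w x))) \<longlonglongrightarrow> 0" using lim by simp
    have "(\<lambda>n. e n) \<longlonglongrightarrow> c + 0"
      unfolding e_def by (rule tendsto_add[OF tendsto_const LIMSEQ_inverse_real_of_nat[unfolded inverse_eq_divide]])
    from LIMSEQ_subseq_LIMSEQ[OF this \<sigma>] have elim: "(\<lambda>n. e (\<sigma> n)) \<longlonglongrightarrow> c" by (simp add: o_def)
    have "N (\<lambda>x. u x + w x) \<le> c * Q (\<lambda>x. u x + w x)"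
      by (rule LIMSEQ_le[OF N_tendsto[OF FEw FEv lim'] tendsto_mult[OF elim Q_tendsto[OF FEw FEv lim']]])
        (intro exI[of _ 0] allI impI le)
    then show "\<exists>v. Minus v \<and> N (\<lambda>x. u x + v x) \<le> c * Q (\<lambda>x. u x + v x)" using w by blast
  qed
  show thesis
  proof (rule that[OF adm admissible_lower_bound[OF adm]])
    fix d assume "0 < d" "d < c"
    then show "\<not> admissible d" using cInf_lower[OF _ bdd, of d] unfolding c_def A_def by auto
  qed
qed

lemma Plus_limit:
  assumes u: "\<And>n. Plus (u n)" and w: "FE w" and lim: "\<And>j. (\<lambda>n. co (u n) j) \<longlonglongrightarrow> co w j"
  shows "Plus w"
  unfolding Plus_def
proof (intro conjI w allI impI)
  fix j assume "j < K"
  then have "(\<lambda>n. co (u n) j) = (\<lambda>n. 0)" using u by (auto simp: Plus_def)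
  then show "co w j = 0" using lim[of j] by (simp add: LIMSEQ_const_iff)
qed

text \<open>A vanishing part of energy \<open>\<rho>\<close> increases \<open>N\<close> by at most \<open>\<rho> / S\<close> in the limit. The parameter of
  \<open>brezis_lieb_upper\<close> tends to zero after \<open>n\<close> has tended to infinity, and \<open>2 / p \<le> 1\<close> makes the power
  \<open>2 / p\<close> subadditive.\<close>

lemma N_asymptotic_bound:
  assumes f: "FE f" and r: "\<And>n. FE (r n)" and AE: "AE x in M. (\<lambda>n. r n x) \<longlonglongrightarrow> 0"
    and lim: "(\<lambda>n. E (r n)) \<longlonglongrightarrow> \<rho>"
    and q: "\<And>n. q n \<le> N (\<lambda>x. f x + r n x)" "q \<longlonglongrightarrow> l"
  shows "l \<le> \<rho> / S + N f"
proof -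
  have p1: "1 \<le> p" using p by simp
  define t where "t m = inverse (real (Suc (Suc m)))" for m
  have t: "0 < t m" "t m < 1" for m by (auto simp: t_def inverse_eq_divide)
  have t0: "t \<longlonglongrightarrow> 0" unfolding t_def by (rule LIMSEQ_Suc[OF LIMSEQ_inverse_real_of_nat])
  define A where "A m = ((1 - t m) powr (1 - p)) powr (2 / p)" for m
  have bound: "l \<le> A m * (\<rho> / S) + (Lp_int M p f + t m) powr (2 / p)" for m
  proof -
    have "\<forall>\<^sub>F n in sequentially. q n \<le> A m * (E (r n) / S) + (Lp_int M p f + t m) powr (2 / p)"
      using brezis_lieb_upper[OF p1 t[of m] t(1)[of m] FE_Lp[OF f] FE_Lp[OF r] AE]
    proof eventually_elim
      case (elim n)
      have "q n \<le> N (\<lambda>x. f x + r n x)" by (rule q(1))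
      also have "\<dots> = Lp_int M p (\<lambda>x. f x + r n x) powr (2 / p)" using p by (simp add: Lp_norm_sq)
      also have "\<dots> \<le> ((1 - t m) powr (1 - p) * Lp_int M p (r n) + (Lp_int M p f + t m)) powr (2 / p)"
        using elim p by (intro powr_mono2) (auto simp: Lp_int_nonneg)
      also have "\<dots> \<le> ((1 - t m) powr (1 - p) * Lp_int M p (r n)) powr (2 / p) + (Lp_int M p f + t m) powr (2 / p)"
        using p t(1)[of m] by (intro powr_subadditive) (auto simp: Lp_int_nonneg less_imp_le add_nonneg_nonneg)
      also have "((1 - t m) powr (1 - p) * Lp_int M p (r n)) powr (2 / p) = A m * N (r n)"
        using p by (simp add: powr_mult Lp_int_nonneg A_def Lp_norm_sq)
      also have "A m * N (r n) \<le> A m * (E (r n) / S)"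
        by (intro mult_left_mono N_le_E r) (simp add: A_def)
      finally show ?case by simp
    qed
    moreover have "(\<lambda>n. A m * (E (r n) / S) + (Lp_int M p f + t m) powr (2 / p))
        \<longlonglongrightarrow> A m * (\<rho> / S) + (Lp_int M p f + t m) powr (2 / p)"
      using S by (intro tendsto_add tendsto_mult tendsto_const tendsto_divide lim) auto
    ultimately show ?thesis using q(2) by (intro tendsto_le[OF sequentially_bot]) auto
  qed
  have "(\<lambda>m. ((1 - t m) powr (1 - p)) powr (2 / p)) \<longlonglongrightarrow> ((1 - 0) powr (1 - p)) powr (2 / p)"
    by (rule tendsto_powr[OF tendsto_powr[OF tendsto_diff[OF tendsto_const t0] tendsto_const] tendsto_const]) auto
  then have A1: "A \<longlonglongrightarrow> 1" unfolding A_def by simp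
  have "(\<lambda>m. (Lp_int M p f + t m) powr (2 / p)) \<longlonglongrightarrow> (Lp_int M p f + 0) powr (2 / p)"
    using p t(1) by (intro tendsto_powr2[OF tendsto_add[OF tendsto_const t0] tendsto_const])
      (auto simp: Lp_int_nonneg less_imp_le add_nonneg_nonneg)
  then have "(\<lambda>m. (Lp_int M p f + t m) powr (2 / p)) \<longlonglongrightarrow> N f" using p by (simp add: Lp_norm_sq)
  from tendsto_add[OF tendsto_mult[OF A1 tendsto_const] this]
  have "(\<lambda>m. A m * (\<rho> / S) + (Lp_int M p f + t m) powr (2 / p)) \<longlonglongrightarrow> 1 * (\<rho> / S) + N f" .
  then have "l \<le> 1 * (\<rho> / S) + N f" by (rule LIMSEQ_le_const) (use bound in blast)
  then show ?thesis by simp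
qed


text \<open>Functions \<open>u n\<close> that violate admissibility for numbers increasing to \<open>c\<close> are normalised by \<open>Q = 1\<close>. The
  energy \<open>\<rho>\<close> lost in the weak limit costs \<open>c \<rho>\<close> on the side of \<open>Q\<close> but gains at most \<open>\<rho> / S < c \<rho>\<close> on the
  side of \<open>N\<close>; comparison with the admissibility of \<open>c\<close> leaves no room for \<open>\<rho> > 0\<close>.\<close>

lemma minimax_attained:
  assumes adm: "admissible c" and cS: "1 / S < c" and least: "\<And>d. 0 < d \<Longrightarrow> d < c \<Longrightarrow> \<not> admissible d"
  obtains u where "Plus u" "Q u = 1" "\<And>v. Minus v \<Longrightarrow> c * Q (\<lambda>x. u x + v x) \<le> N (\<lambda>x. u x + v x)"
proof -
  have c0: "0 < c" using adm by (simp add: admissible_def)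
  define d where "d n = c * (1 - inverse (real (Suc (Suc n))))" for n
  have d: "0 < d n" "d n < c" for n using c0 by (auto simp: d_def inverse_eq_divide)
  have dlim: "d \<longlonglongrightarrow> c"
  proof -
    have "d \<longlonglongrightarrow> c * (1 - 0)"
      unfolding d_def
      by (rule tendsto_mult[OF tendsto_const tendsto_diff[OF tendsto_const LIMSEQ_Suc[OF LIMSEQ_inverse_real_of_nat]]])
    then show ?thesis by simp
  qed
  have "\<exists>u. Plus u \<and> Q u = 1 \<and> (\<forall>v. Minus v \<longrightarrow> d n * Q (\<lambda>x. u x + v x) < N (\<lambda>x. u x + v x))" for n
  proof -
    obtain U where U: "Plus U" and bad: "\<And>v. Minus v \<Longrightarrow> d n * Q (\<lambda>x. U x + v x) < N (\<lambda>x. U x + v x)"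
      using least[OF d] d(1) unfolding admissible_def by (meson not_le)
    have "Q U \<noteq> 0"
    proof
      assume Q0: "Q U = 0"
      then have "E U = 0" using E_le_Q_Plus[OF U] E_nonneg[OF Plus_FE[OF U]] by simp
      then have "N U = 0" by (rule E_eq_0_imp_N[OF Plus_FE[OF U]])
      then show False using bad[OF Minus_zero] Q0 by simp
    qed
    then have Qpos: "0 < Q U" using Q_Plus_nonneg[OF U] by simp
    define s where "s = sqrt (Q U)"
    have s: "0 < s" "s\<^sup>2 = Q U" using Qpos by (auto simp: s_def)
    define u where "u = (\<lambda>x. 1 / s * U x)"
    have "Plus u" unfolding u_def by (rule Plus_cmult[OF U])
    moreover have "Q u = 1" unfolding u_def Q_cmult[OF Plus_FE[OF U]] using s Qpos by (simp add: power_divide)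
    moreover have "d n * Q (\<lambda>x. u x + v x) < N (\<lambda>x. u x + v x)" if v: "Minus v" for v
    proof -
      have sv: "Minus (\<lambda>x. s * v x)" by (rule Minus_cmult[OF v])
      have eq: "(\<lambda>x. u x + v x) = (\<lambda>x. 1 / s * (U x + s * v x))"
        unfolding u_def using s by (simp add: distrib_left)
      have "(1 / s)\<^sup>2 * (d n * Q (\<lambda>x. U x + s * v x)) < (1 / s)\<^sup>2 * N (\<lambda>x. U x + s * v x)"
        using bad[OF sv] s by (intro mult_strict_left_mono) auto
      then show ?thesis unfolding eq N_cmult
        by (subst Q_cmult[OF FE_add[OF Plus_FE[OF U] Minus_FE[OF sv]]]) (simp add: mult_ac)
    qed
    ultimately show ?thesis by blast
  qed
  then obtain u where u: "\<And>n. Plus (u n)" "\<And>n. Q (u n) = 1"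
    and bad: "\<And>n v. Minus v \<Longrightarrow> d n * Q (\<lambda>x. u n x + v x) < N (\<lambda>x. u n x + v x)"
    by metis
  have Eu: "E (u n) \<le> kp" for n using E_le_Q_Plus[OF u(1)[of n]] u(2) by simp
  obtain w \<sigma> \<rho> where \<sigma>: "strict_mono (\<sigma> :: nat \<Rightarrow> nat)" and w: "FE w"
    and colim: "\<And>j. (\<lambda>n. co (u (\<sigma> n)) j) \<longlonglongrightarrow> co w j"
    and AE: "AE x in M. (\<lambda>n. u (\<sigma> n) x) \<longlonglongrightarrow> w x"
    and Elim: "(\<lambda>n. E (\<lambda>x. u (\<sigma> n) x - w x)) \<longlonglongrightarrow> \<rho>"
    by (rule compactness[where u = u and C = kp, OF Lam_at_top Plus_FE[OF u(1)] Eu]) auto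
  have Pw: "Plus w" by (rule Plus_limit[OF u(1) w colim])
  define r where "r n = (\<lambda>x. u (\<sigma> n) x - w x)" for n
  have r: "FE (r n)" for n unfolding r_def by (intro FE_diff Plus_FE[OF u(1)] w)
  have rlim: "(\<lambda>n. E (r n)) \<longlonglongrightarrow> \<rho>" using Elim unfolding r_def .
  obtain C where "\<And>n. norm (E (r n)) \<le> C"
    using convergent_imp_bounded[OF rlim] by (auto simp: bounded_iff)
  then have rC: "E (r n) \<le> C" for n by (simp add: abs_le_iff)
  have rco: "(\<lambda>n. co (r n) j) \<longlonglongrightarrow> 0" for j
    using LIM_zero[OF colim[of j]] unfolding r_def
    by (simp add: co_diff FE_sqint[OF Plus_FE[OF u(1)]] FE_sqint[OF w])
  have rAE: "AE x in M. (\<lambda>n. r n x) \<longlonglongrightarrow> 0"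
    using AE
  proof eventually_elim
    case (elim x) then show ?case unfolding r_def by (rule LIM_zero)
  qed
  have rho0: "0 \<le> \<rho>" by (rule LIMSEQ_le_const[OF rlim]) (use E_nonneg[OF r] in blast)
  have Qsplit: "(\<lambda>n. Q (\<lambda>x. f x + r n x)) \<longlonglongrightarrow> Q f + \<rho>" if "FE f" for f
    by (rule Q_split[OF that r rC rco rlim])
  have "(\<lambda>n. Q (\<lambda>x. w x + r n x)) \<longlonglongrightarrow> Q w + \<rho>" by (rule Qsplit[OF w])
  then have "(\<lambda>n::nat. 1) \<longlonglongrightarrow> Q w + \<rho>" unfolding r_def using u(2) by simp
  then have Q1: "Q w + \<rho> = 1" by (simp add: LIMSEQ_const_iff)
  have key: "c * (Q (\<lambda>x. w x + v x) + \<rho>) \<le> \<rho> / S + N (\<lambda>x. w x + v x)" if v: "Minus v" for v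
  proof (rule N_asymptotic_bound[OF _ r rAE rlim])
    show f: "FE (\<lambda>x. w x + v x)" by (intro FE_add w Minus_FE[OF v])
    have "(\<lambda>n. d (\<sigma> n)) \<longlonglongrightarrow> c" using LIMSEQ_subseq_LIMSEQ[OF dlim \<sigma>] by (simp add: o_def)
    then show "(\<lambda>n. d (\<sigma> n) * Q (\<lambda>x. w x + v x + r n x)) \<longlonglongrightarrow> c * (Q (\<lambda>x. w x + v x) + \<rho>)"
      by (rule tendsto_mult[OF _ Qsplit[OF f]])
    show "d (\<sigma> n) * Q (\<lambda>x. w x + v x + r n x) \<le> N (\<lambda>x. w x + v x + r n x)" for n
    proof -
      have eq: "(\<lambda>x. w x + v x + r n x) = (\<lambda>x. u (\<sigma> n) x + v x)" by (rule ext) (simp add: r_def)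
      show ?thesis unfolding eq by (rule less_imp_le[OF bad[OF v]])
    qed
  qed
  obtain v where v: "Minus v" "N (\<lambda>x. w x + v x) \<le> c * Q (\<lambda>x. w x + v x)"
    using adm Pw unfolding admissible_def by blast
  have "(c - 1 / S) * \<rho> \<le> 0" using key[OF v(1)] v(2) by (simp add: algebra_simps)
  then have rho: "\<rho> = 0" using cS rho0 by (simp add: mult_le_0_iff)
  show thesis
  proof (rule that[OF Pw])
    show "Q w = 1" using Q1 unfolding rho by simp
    show "c * Q (\<lambda>x. w x + v x) \<le> N (\<lambda>x. w x + v x)" if "Minus v" for v
      using key[OF that] unfolding rho by simp
  qed
qed


section \<open>The Euler-Lagrange equation\<close>

text \<open>\<open>N\<close> is convex and \<open>Q\<close> strictly concave on \<open>u + H\<^sup>-\<close>, so that \<open>N - c Q\<close> would be negative at the midpoint of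
  two distinct zeros.\<close>

lemma Minus_optimum_unique:
  assumes c: "0 < c" and u: "Plus u"
    and lower: "\<And>v. Minus v \<Longrightarrow> c * Q (\<lambda>x. u x + v x) \<le> N (\<lambda>x. u x + v x)"
    and v: "Minus v" "N (\<lambda>x. u x + v x) \<le> c * Q (\<lambda>x. u x + v x)"
    and w: "Minus w" "N (\<lambda>x. u x + w x) \<le> c * Q (\<lambda>x. u x + w x)"
  shows "E (\<lambda>x. v x - w x) = 0"
proof -
  have p1: "1 \<le> p" using p by simp
  have FE: "FE u" "FE v" "FE w" using u v w Plus_FE Minus_FE by auto
  define m where "m = (\<lambda>x. 1/2 * v x + 1/2 * w x)"
  have m: "Minus m" unfolding m_def by (intro Minus_add Minus_cmult v w)
  have eq: "(\<lambda>x. u x + m x) = (\<lambda>x. (1 - 1/2) * (u x + v x) + 1/2 * (u x + w x))"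
    by (rule ext) (simp add: m_def field_simps)
  have conv: "N (\<lambda>x. u x + m x) \<le> (1 - 1/2) * N (\<lambda>x. u x + v x) + 1/2 * N (\<lambda>x. u x + w x)"
    unfolding eq by (intro Lp_norm_sq_convex p1 FE_Lp FE_add FE) auto
  have Qm: "Q m = 1/4 * Q v + 1/2 * B v w + 1/4 * Q w"
    unfolding m_def
    by (simp only: Q_add[OF FE_cmult[OF FE(2)] FE_cmult[OF FE(3)]] Q_cmult[OF FE(2)] Q_cmult[OF FE(3)]
        B_cmult_left[OF FE(2) FE_cmult[OF FE(3)]] B_cmult_right[OF FE(3) FE(2)])
      (simp add: power2_eq_square)
  have Qd: "Q (\<lambda>x. v x + (-1) * w x) = Q v - 2 * B v w + Q w"
    by (simp only: Q_add[OF FE(2) FE_cmult[OF FE(3)]] Q_cmult[OF FE(3)] B_cmult_right[OF FE(3) FE(2)]) simp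
  have Md: "Minus (\<lambda>x. v x + (-1) * w x)" by (intro Minus_add Minus_cmult v w)
  have "c * (Q u + Q m) \<le> N (\<lambda>x. u x + m x)" using lower[OF m] Q_Plus_Minus[OF u m] by simp
  also have "\<dots> \<le> 1/2 * (c * (Q u + Q v)) + 1/2 * (c * (Q u + Q w))"
    using conv v(2) w(2) Q_Plus_Minus[OF u v(1)] Q_Plus_Minus[OF u w(1)] by simp
  also have "\<dots> = c * (Q u + 1/2 * Q v + 1/2 * Q w)" by (simp add: algebra_simps)
  finally have "Q u + Q m \<le> Q u + 1/2 * Q v + 1/2 * Q w" by (rule mult_left_le_imp_le[OF _ c])
  then have "0 \<le> Q (\<lambda>x. v x + (-1) * w x)" unfolding Qd Qm by simp
  then have "Q (\<lambda>x. v x + (-1) * w x) = 0" using Q_Minus_nonpos[OF Md] by simp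
  then have "E (\<lambda>x. v x + (-1) * w x) \<le> 0" using E_le_Q_Minus[OF Md] by simp
  then have "E (\<lambda>x. v x + (-1) * w x) = 0" using E_nonneg[OF Minus_FE[OF Md]] by simp
  then show ?thesis by simp
qed

text \<open>For the small shifts \<open>u + t n h\<close>, admissibility gives \<open>w n\<close> in \<open>H\<^sup>-\<close> with \<open>N \<le> c Q\<close> at
  \<open>u + t n h + w n\<close>, while \<open>N \<ge> c Q\<close> at \<open>u + w n\<close>. Hence the slope of \<open>N\<close> from the second point to the first
  is at most that of \<open>c Q\<close>. As \<open>N\<close> is convex, the slope on the other side of \<open>u + w n\<close>, over a step of
  fixed length \<open>\<tau>\<close>, is smaller still. By uniqueness \<open>w n\<close> tends to \<open>v\<close>, and the inequality passes to
  the limit.\<close>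

lemma N_difference_bound:
  assumes c: "0 < c" and adm: "admissible c" and u: "Plus u" and Qu: "Q u = 1"
    and lower: "\<And>v. Minus v \<Longrightarrow> c * Q (\<lambda>x. u x + v x) \<le> N (\<lambda>x. u x + v x)"
    and v: "Minus v" "N (\<lambda>x. u x + v x) \<le> c * Q (\<lambda>x. u x + v x)"
    and h: "Plus h" and tau: "0 < \<tau>"
  shows "N (\<lambda>x. u x + v x) \<le> N (\<lambda>x. u x + v x + \<tau> * (- h x)) + 2 * \<tau> * c * B u h"
proof -
  have p1: "1 \<le> p" using p by simp
  have FEu: "FE u" "FE h" using u h Plus_FE by auto
  define t where "t n = inverse (real (Suc n))" for n
  have t: "0 < t n" "t n \<le> 1" for n by (auto simp: t_def inverse_eq_divide)
  have t0: "t \<longlonglongrightarrow> 0" unfolding t_def by (rule LIMSEQ_inverse_real_of_nat)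
  have Pth: "Plus (\<lambda>x. u x + t n * h x)" for n by (intro Plus_add Plus_cmult u h)
  have Qth: "Q (\<lambda>x. u x + t n * h x) = 1 + 2 * t n * B u h + (t n)\<^sup>2 * Q h" for n
    by (simp only: Q_add[OF FEu(1) FE_cmult[OF FEu(2)]] Q_cmult[OF FEu(2)] B_cmult_right[OF FEu(2,1)] Qu
        mult.assoc)
  have "\<exists>w. Minus w \<and> N (\<lambda>x. u x + t n * h x + w x) \<le> c * Q (\<lambda>x. u x + t n * h x + w x)" for n
    by (rule adm[unfolded admissible_def, THEN conjunct2, rule_format, OF Pth])
  from choice[OF allI[OF this]] obtain w where
    "\<forall>n. Minus (w n) \<and> N (\<lambda>x. u x + t n * h x + w n x) \<le> c * Q (\<lambda>x. u x + t n * h x + w n x)" ..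
  then have w: "\<And>n. Minus (w n)"
    and le: "\<And>n. N (\<lambda>x. u x + t n * h x + w n x) \<le> c * Q (\<lambda>x. u x + t n * h x + w n x)"
    by blast+
  define C where "C = km * (1 + 2 * \<bar>B u h\<bar> + Q h)"
  have Ew: "E (w n) \<le> C" for n
  proof -
    have "0 \<le> c * Q (\<lambda>x. u x + t n * h x + w n x)" using le[of n] by (meson order_trans zero_le_power2)
    then have "0 \<le> Q (\<lambda>x. u x + t n * h x + w n x)" using c by (simp add: zero_le_mult_iff)
    then have 1: "- Q (w n) \<le> 1 + 2 * t n * B u h + (t n)\<^sup>2 * Q h"
      using Q_Plus_Minus[OF Pth[of n] w[of n]] unfolding Qth by simp
    have 2: "t n * B u h \<le> \<bar>B u h\<bar>"
    proof -
      have "t n * B u h \<le> t n * \<bar>B u h\<bar>" using t[of n] by (intro mult_left_mono) auto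
      also have "\<dots> \<le> 1 * \<bar>B u h\<bar>" using t[of n] by (intro mult_right_mono) auto
      finally show ?thesis by simp
    qed
    have 3: "(t n)\<^sup>2 * Q h \<le> 1 * Q h"
      using t[of n] Q_Plus_nonneg[OF h] by (intro mult_right_mono) (auto simp: power_le_one)
    have "- Q (w n) \<le> 1 + 2 * \<bar>B u h\<bar> + Q h" using 1 2 3 by (simp add: mult.assoc)
    then have "km * (- Q (w n)) \<le> C" unfolding C_def using km_pos by (intro mult_left_mono) auto
    then show ?thesis using E_le_Q_Minus[OF w[of n]] by linarith
  qed
  obtain w' \<sigma> where \<sigma>: "strict_mono (\<sigma> :: nat \<Rightarrow> nat)" and w': "Minus w'"
    and wlim: "(\<lambda>n. E (\<lambda>x. w (\<sigma> n) x - w' x)) \<longlonglongrightarrow> 0"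
    by (rule Minus_compact[where v = w and C = C, OF w Ew]) auto
  have tlim: "(\<lambda>n. t (\<sigma> n)) \<longlonglongrightarrow> 0" using LIMSEQ_subseq_LIMSEQ[OF t0 \<sigma>] by (simp add: o_def)
  have FEw: "FE (w n)" "FE w'" "FE v" for n using w w' v Minus_FE by auto
  have FEuw: "FE (\<lambda>x. u x + w' x)" "FE (\<lambda>x. u x + t (\<sigma> n) * h x + w (\<sigma> n) x)" for n
    by (intro FE_add FE_cmult FEu FEw)+
  have lim1: "(\<lambda>n. E (\<lambda>x. (u x + t (\<sigma> n) * h x + w (\<sigma> n) x) - (u x + w' x))) \<longlonglongrightarrow> 0"
  proof -
    have "(\<lambda>n. 2 * ((t (\<sigma> n))\<^sup>2 * E h) + 2 * E (\<lambda>x. w (\<sigma> n) x - w' x)) \<longlonglongrightarrow> 2 * (0\<^sup>2 * E h) + 2 * 0"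
      by (intro tendsto_add tendsto_mult tendsto_const tendsto_power tlim wlim)
    then have l0: "(\<lambda>n. 2 * ((t (\<sigma> n))\<^sup>2 * E h) + 2 * E (\<lambda>x. w (\<sigma> n) x - w' x)) \<longlonglongrightarrow> 0" by simp
    show ?thesis
    proof (rule Lim_null_comparison[OF always_eventually l0], rule allI)
      fix n
      have eq: "(\<lambda>x. (u x + t (\<sigma> n) * h x + w (\<sigma> n) x) - (u x + w' x)) = (\<lambda>x. t (\<sigma> n) * h x + (w (\<sigma> n) x - w' x))"
        by (rule ext) simp
      have d: "FE (\<lambda>x. w (\<sigma> n) x - w' x)" by (intro FE_diff FEw)
      have th: "FE (\<lambda>x. t (\<sigma> n) * h x)" by (intro FE_cmult FEu)
      show "norm (E (\<lambda>x. (u x + t (\<sigma> n) * h x + w (\<sigma> n) x) - (u x + w' x)))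
        \<le> 2 * ((t (\<sigma> n))\<^sup>2 * E h) + 2 * E (\<lambda>x. w (\<sigma> n) x - w' x)"
        unfolding eq real_norm_def abs_of_nonneg[OF E_nonneg[OF FE_add[OF th d]]]
        using E_add_le[OF th d] unfolding E_cmult[OF FEu(2)] .
    qed
  qed
  have "N (\<lambda>x. u x + w' x) \<le> c * Q (\<lambda>x. u x + w' x)"
    by (rule LIMSEQ_le[OF N_tendsto[OF FEuw(1) FEuw(2) lim1]
          tendsto_mult[OF tendsto_const Q_tendsto[OF FEuw(1) FEuw(2) lim1]]])
      (intro exI[of _ 0] allI impI le)
  from Minus_optimum_unique[OF c u lower w' this v] have wv: "E (\<lambda>x. w' x - v x) = 0" .
  define y where "y n = (\<lambda>x. u x + w (\<sigma> n) x)" for n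
  define z where "z = (\<lambda>x. u x + v x)"
  have FEy: "FE (y n)" and FEz: "FE z" for n unfolding y_def z_def by (intro FE_add FEu FEw)+
  have ylim: "(\<lambda>n. E (\<lambda>x. y n x - z x)) \<longlonglongrightarrow> 0"
  proof -
    have "(\<lambda>n. 2 * E (\<lambda>x. w (\<sigma> n) x - w' x) + 2 * E (\<lambda>x. w' x - v x)) \<longlonglongrightarrow> 2 * 0 + 2 * 0"
      unfolding wv by (intro tendsto_add tendsto_mult tendsto_const wlim)
    then have l0: "(\<lambda>n. 2 * E (\<lambda>x. w (\<sigma> n) x - w' x) + 2 * E (\<lambda>x. w' x - v x)) \<longlonglongrightarrow> 0" by simp
    show ?thesis
    proof (rule Lim_null_comparison[OF always_eventually l0], rule allI)
      fix n
      have eq: "(\<lambda>x. y n x - z x) = (\<lambda>x. (w (\<sigma> n) x - w' x) + (w' x - v x))"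
        by (rule ext) (simp add: y_def z_def)
      have d: "FE (\<lambda>x. w (\<sigma> n) x - w' x)" "FE (\<lambda>x. w' x - v x)" by (intro FE_diff FEw)+
      show "norm (E (\<lambda>x. y n x - z x)) \<le> 2 * E (\<lambda>x. w (\<sigma> n) x - w' x) + 2 * E (\<lambda>x. w' x - v x)"
        unfolding eq real_norm_def abs_of_nonneg[OF E_nonneg[OF FE_add[OF d]]] by (rule E_add_le[OF d])
    qed
  qed
  have FEyt: "FE (\<lambda>x. y n x + \<tau> * (- h x))" "FE (\<lambda>x. z x + \<tau> * (- h x))" for n
    using FE_add[OF FEy FE_cmult[OF FEu(2), of "-\<tau>"]] FE_add[OF FEz FE_cmult[OF FEu(2), of "-\<tau>"]] by simp_all
  have "(\<lambda>x. y n x + \<tau> * (- h x) - (z x + \<tau> * (- h x))) = (\<lambda>x. y n x - z x)" for n by (rule ext) simp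
  then have ylim': "(\<lambda>n. E (\<lambda>x. y n x + \<tau> * (- h x) - (z x + \<tau> * (- h x)))) \<longlonglongrightarrow> 0" using ylim by simp
  have step: "N (y n) \<le> N (\<lambda>x. y n x + \<tau> * (- h x)) + \<tau> * c * (2 * B u h + t (\<sigma> n) * Q h)" for n
  proof -
    define r where "r = t (\<sigma> n)"
    have r: "0 < r" using t by (simp add: r_def)
    define s where "s = \<tau> / (r + \<tau>)"
    have s: "0 \<le> s" "s \<le> 1" "1 - s = r / (r + \<tau>)" using r tau by (auto simp: s_def field_simps)
    have FEr: "FE (\<lambda>x. y n x + r * h x)" by (intro FE_add FE_cmult FEy FEu)
    have eq: "y n x = (1 - s) * (y n x + \<tau> * (- h x)) + s * (y n x + r * h x)" for x
    proof -
      have "(1 - s) * \<tau> = s * r" unfolding s(3) unfolding s_def by simp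
      moreover have "(1 - s) * (y n x + \<tau> * (- h x)) + s * (y n x + r * h x) = y n x + (s * r - (1 - s) * \<tau>) * h x"
        by (simp add: algebra_simps)
      ultimately show ?thesis by simp
    qed
    have "N (\<lambda>x. y n x + r * h x) \<le> c * Q (\<lambda>x. y n x + r * h x)"
      using le[of "\<sigma> n"] unfolding y_def r_def by (simp add: ac_simps)
    also have "Q (\<lambda>x. y n x + r * h x) = Q (y n) + 2 * r * B u h + r\<^sup>2 * Q h"
    proof -
      have "B (y n) h = B u h"
        unfolding y_def B_add_left[OF FEu(1) FEw(1) FEu(2)] B_commute[of "w _" h] B_Plus_Minus[OF h w] by simp
      then show ?thesis
        by (simp only: Q_add[OF FEy FE_cmult[OF FEu(2)]] Q_cmult[OF FEu(2)] B_cmult_right[OF FEu(2) FEy] mult.assoc)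
    qed
    also have "c * (Q (y n) + 2 * r * B u h + r\<^sup>2 * Q h) \<le> N (y n) + c * (2 * r * B u h + r\<^sup>2 * Q h)"
      using lower[OF w[of "\<sigma> n"]] unfolding y_def by (simp add: distrib_left)
    finally have up: "s * N (\<lambda>x. y n x + r * h x) \<le> s * (N (y n) + c * (2 * r * B u h + r\<^sup>2 * Q h))"
      using s by (intro mult_left_mono)
    have "N (y n) = N (\<lambda>x. (1 - s) * (y n x + \<tau> * (- h x)) + s * (y n x + r * h x))"
      unfolding eq[symmetric] ..
    also have "\<dots> \<le> (1 - s) * N (\<lambda>x. y n x + \<tau> * (- h x)) + s * N (\<lambda>x. y n x + r * h x)"
      by (intro Lp_norm_sq_convex p1 FE_Lp FEyt FEr s)
    finally have "N (y n) \<le> (1 - s) * N (\<lambda>x. y n x + \<tau> * (- h x)) + s * (N (y n) + c * (2 * r * B u h + r\<^sup>2 * Q h))"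
      using up by linarith
    then have "(1 - s) * N (y n) \<le> (1 - s) * N (\<lambda>x. y n x + \<tau> * (- h x)) + s * r * (c * (2 * B u h + r * Q h))"
      by (simp add: algebra_simps power2_eq_square)
    also have "s * r = (1 - s) * \<tau>" unfolding s(3) unfolding s_def by simp
    finally have "(1 - s) * N (y n) \<le> (1 - s) * (N (\<lambda>x. y n x + \<tau> * (- h x)) + \<tau> * (c * (2 * B u h + r * Q h)))"
      by (simp add: distrib_left mult.assoc)
    then have "N (y n) \<le> N (\<lambda>x. y n x + \<tau> * (- h x)) + \<tau> * (c * (2 * B u h + r * Q h))"
      by (rule mult_left_le_imp_le) (use s r tau in simp)
    then show ?thesis unfolding r_def by (simp add: mult.assoc)
  qed
  have "N z \<le> N (\<lambda>x. z x + \<tau> * (- h x)) + \<tau> * c * (2 * B u h + 0 * Q h)"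
    by (rule LIMSEQ_le[OF N_tendsto[OF FEz FEy ylim] tendsto_add[OF N_tendsto[OF FEyt(2) FEyt(1) ylim']
        tendsto_mult[OF tendsto_const tendsto_add[OF tendsto_const tendsto_mult[OF tlim tendsto_const]]]]])
      (intro exI[of _ 0] allI impI step)
  then show ?thesis unfolding z_def by simp
qed

text \<open>In the directions of \<open>H\<^sup>-\<close> the function \<open>N - c Q\<close> has a minimum at \<open>z\<close>. In those of \<open>H\<^sup>+\<close> the derivative has
  a sign by \<open>N_difference_bound\<close>, and replacing \<open>h\<close> by \<open>- h\<close> gives equality.\<close>

lemma euler_lagrange:
  assumes c: "0 < c" and adm: "admissible c" and u: "Plus u" and Qu: "Q u = 1"
    and lower: "\<And>v. Minus v \<Longrightarrow> c * Q (\<lambda>x. u x + v x) \<le> N (\<lambda>x. u x + v x)"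
  obtains z where "FE z" "0 < Lp_int M p z"
    "\<And>h. FE h \<Longrightarrow> Lp_int M p z powr (2 / p - 1) * (LINT x|M. \<bar>z x\<bar> powr (p - 2) * z x * h x) = c * B z h"
proof -
  have p1: "1 < p" using p by simp
  obtain v where v: "Minus v" "N (\<lambda>x. u x + v x) \<le> c * Q (\<lambda>x. u x + v x)"
    using adm u unfolding admissible_def by blast
  have FE: "FE u" "FE v" using u v Plus_FE Minus_FE by auto
  define z where "z = (\<lambda>x. u x + v x)"
  have z: "FE z" unfolding z_def by (intro FE_add FE)
  have "\<exists>j. co u j \<noteq> 0"
  proof (rule ccontr)
    assume "\<not> (\<exists>j. co u j \<noteq> 0)"
    then have "(\<lambda>j. (\<Lambda> j - \<mu>) * (co u j * co u j)) sums 0" by simp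
    from sums_unique2[OF this B_sums[OF FE(1) FE(1)]] show False using Qu by simp
  qed
  then obtain j where j: "co u j \<noteq> 0" by blast
  then have "\<not> j < K" using u by (auto simp: Plus_def)
  then have "co z j \<noteq> 0" using j v(1) FE unfolding z_def by (simp add: co_add FE_sqint Minus_def)
  then have pos: "0 < Lp_int M p z" by (rule Lp_int_pos[OF z])
  define I where "I h = (LINT x|M. \<bar>z x\<bar> powr (p - 2) * z x * h x)" for h
  define a where "a = Lp_int M p z powr (2 / p - 1)"
  have deriv: "((\<lambda>\<tau>. N (\<lambda>x. z x + \<tau> * h x)) has_real_derivative 2 * a * I h) (at 0)" if "FE h" for h
    unfolding a_def I_def by (rule Lp_norm_sq_has_derivative[OF p1 FE_Lp[OF z] FE_Lp[OF that] pos])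
  have Nz: "N z = c * Q z"
    using v(2) lower[OF v(1)] unfolding z_def by (rule antisym)
  have minus: "a * I h = c * B z h" if h: "Minus h" for h
  proof -
    have FEh: "FE h" by (rule Minus_FE[OF h])
    have "((\<lambda>\<tau>. N (\<lambda>x. z x + \<tau> * h x) - c * (Q z + 2 * \<tau> * B z h + \<tau>\<^sup>2 * Q h)) has_real_derivative
        2 * a * I h - 2 * c * B z h) (at 0)"
      by (rule derivative_eq_intros deriv[OF FEh] refl | simp)+
    then have "2 * a * I h - 2 * c * B z h = 0"
    proof (rule DERIV_local_min[where d = 1], simp, intro allI impI)
      fix \<tau> :: real
      have eq: "(\<lambda>x. z x + \<tau> * h x) = (\<lambda>x. u x + (v x + \<tau> * h x))" by (rule ext) (simp add: z_def)
      have "c * Q (\<lambda>x. z x + \<tau> * h x) \<le> N (\<lambda>x. z x + \<tau> * h x)"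
        unfolding eq by (intro lower Minus_add Minus_cmult v h)
      moreover have "Q (\<lambda>x. z x + \<tau> * h x) = Q z + 2 * \<tau> * B z h + \<tau>\<^sup>2 * Q h"
        by (simp only: Q_add[OF z FE_cmult[OF FEh]] Q_cmult[OF FEh] B_cmult_right[OF FEh z]
            mult.assoc)
      ultimately show "N (\<lambda>x. z x + 0 * h x) - c * (Q z + 2 * 0 * B z h + 0\<^sup>2 * Q h)
         \<le> N (\<lambda>x. z x + \<tau> * h x) - c * (Q z + 2 * \<tau> * B z h + \<tau>\<^sup>2 * Q h)"
        using Nz by simp
    qed
    then show ?thesis by simp
  qed
  have Bz: "B z h = B u h" if h: "Plus h" for h
    unfolding z_def B_add_left[OF FE(1) FE(2) Plus_FE[OF h]] B_commute[of v h] B_Plus_Minus[OF h v(1)] by simp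
  have I_uminus: "I (\<lambda>x. - h x) = - I h" for h unfolding I_def by simp
  have plus_le: "a * I h \<le> c * B z h" if h: "Plus h" for h
  proof (rule ccontr)
    assume "\<not> a * I h \<le> c * B z h"
    then have neg: "2 * a * I (\<lambda>x. - h x) + 2 * c * B u h < 0" unfolding I_uminus Bz[OF h] by simp
    have FEh: "FE (\<lambda>x. - h x)" using FE_cmult[OF Plus_FE[OF h], of "-1"] by simp
    have "((\<lambda>\<tau>. N (\<lambda>x. z x + \<tau> * (- h x)) + 2 * \<tau> * c * B u h) has_real_derivative
        2 * a * I (\<lambda>x. - h x) + 2 * c * B u h) (at 0)"
      by (rule derivative_eq_intros deriv[OF FEh] refl | simp)+
    from DERIV_neg_dec_right[OF this neg] obtain d where d: "0 < d"
      and dec: "\<And>t. 0 < t \<Longrightarrow> t < d \<Longrightarrow> N (\<lambda>x. z x + (0 + t) * (- h x)) + 2 * (0 + t) * c * B u h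
         < N (\<lambda>x. z x + 0 * (- h x)) + 2 * 0 * c * B u h"
      by blast
    have "N (\<lambda>x. z x + d / 2 * (- h x)) + 2 * (d / 2) * c * B u h < N z"
      using dec[of "d / 2"] d by simp
    moreover have "N z \<le> N (\<lambda>x. z x + d / 2 * (- h x)) + 2 * (d / 2) * c * B u h"
      unfolding z_def using d by (intro N_difference_bound[OF c adm u Qu lower v h]) auto
    ultimately show False by simp
  qed
  have plus: "a * I h = c * B z h" if h: "Plus h" for h
  proof (rule antisym[OF plus_le[OF h]])
    have "Plus (\<lambda>x. (-1) * h x)" by (rule Plus_cmult[OF h])
    from plus_le[OF this] show "c * B z h \<le> a * I h"
      unfolding B_cmult_right[OF Plus_FE[OF h] z] using I_uminus[of h] by simp
  qed
  show thesis
  proof (rule that[OF z pos])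
    fix h assume h: "FE h"
    define hm hp where "hm = expand K (co h)" and "hp = (\<lambda>x. h x - hm x)"
    have hm: "Minus hm" unfolding Minus_def hm_def by (simp add: FE_expand co_expand)
    have hp: "Plus hp" unfolding Plus_def hp_def hm_def
      using h by (simp add: FE_diff FE_expand co_diff FE_sqint co_expand)
    have eq: "h = (\<lambda>x. hm x + hp x)" by (rule ext) (simp add: hp_def)
    have lin: "2 * a * I h = 2 * a * I hm + 2 * a * I hp"
    proof -
      have int: "integrable M (\<lambda>x. \<bar>z x\<bar> powr (p - 2) * z x * g x)" if g: "FE g" for g
        by (rule Lp_duality_integrable[OF p1 FE_Lp[OF z] FE_Lp[OF g]])
      have "I (\<lambda>x. hm x + hp x) = I hm + I hp"
        unfolding I_def distrib_left
        by (rule Bochner_Integration.integral_add[OF int[OF Minus_FE[OF hm]] int[OF Plus_FE[OF hp]]])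
      then show ?thesis unfolding eq[symmetric] by (simp add: distrib_left)
    qed
    have "B z h = B z hm + B z hp"
      using B_add_right[OF Minus_FE[OF hm] Plus_FE[OF hp] z] unfolding eq[symmetric] .
    then show "Lp_int M p z powr (2 / p - 1) * (LINT x|M. \<bar>z x\<bar> powr (p - 2) * z x * h x) = c * B z h"
      using lin minus[OF hm] plus[OF hp] unfolding a_def[symmetric] I_def[symmetric]
      by (simp add: distrib_left)
  qed
qed

text \<open>Multiplying \<open>z\<close> by \<open>b\<close> multiplies the nonlinear term by \<open>b\<^sup>p\<^sup>-\<^sup>1\<close> and the linear ones by \<open>b\<close>, which
  allows the factor in the Euler-Lagrange equation to be removed.\<close>

theorem nontrivial_weak_solution:
  obtains w where "FE w" "\<not> (AE x in M. w x = 0)"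
    "\<And>h. FE h \<Longrightarrow> D w h = \<mu> * ip M w h + (LINT x|M. \<bar>w x\<bar> powr (p - 2) * w x * h x)"
proof -
  obtain c where adm: "admissible c" and cS: "1 / S < c"
    and least: "\<And>d. 0 < d \<Longrightarrow> d < c \<Longrightarrow> \<not> admissible d"
    using obtain_least_admissible by blast
  have c: "0 < c" using adm by (simp add: admissible_def)
  obtain u where u: "Plus u" "Q u = 1"
    and lower: "\<And>v. Minus v \<Longrightarrow> c * Q (\<lambda>x. u x + v x) \<le> N (\<lambda>x. u x + v x)"
    using minimax_attained[OF adm cS least] by blast
  obtain z where z: "FE z" and pos: "0 < Lp_int M p z"
    and EL: "\<And>h. FE h \<Longrightarrow> Lp_int M p z powr (2 / p - 1) * (LINT x|M. \<bar>z x\<bar> powr (p - 2) * z x * h x) = c * B z h"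
    using euler_lagrange[OF c adm u lower] by blast
  define k where "k = Lp_int M p z powr (2 / p - 1) / c"
  have k: "0 < k" using pos c by (simp add: k_def)
  define b where "b = k powr (1 / (p - 2))"
  have b: "0 < b" "b powr (p - 2) = k" using k p by (auto simp: b_def powr_powr)
  define w where "w = (\<lambda>x. b * z x)"
  show thesis
  proof (rule that)
    show "FE w" unfolding w_def by (rule FE_cmult[OF z])
    show "\<not> (AE x in M. w x = 0)"
    proof
      assume "AE x in M. w x = 0"
      then have "AE x in M. \<bar>z x\<bar> powr p = 0" using b by (auto simp: w_def)
      then have "Lp_int M p z = 0" unfolding Lp_int_def by (rule integral_eq_zero_AE)
      then show False using pos by simp
    qed
    fix h assume h: "FE h"
    have "(LINT x|M. \<bar>w x\<bar> powr (p - 2) * w x * h x) = (LINT x|M. (b powr (p - 2) * b) * (\<bar>z x\<bar> powr (p - 2) * z x * h x))"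
      unfolding w_def using b(1) by (intro Bochner_Integration.integral_cong refl) (simp add: abs_mult powr_mult mult_ac)
    also have "\<dots> = b * (k * (LINT x|M. \<bar>z x\<bar> powr (p - 2) * z x * h x))"
      unfolding b(2) by simp
    also have "k * (LINT x|M. \<bar>z x\<bar> powr (p - 2) * z x * h x) = B z h"
      using EL[OF h] c by (simp add: k_def)
    also have "b * B z h = B w h" unfolding w_def by (rule B_cmult_left[OF z h, symmetric])
    finally show "D w h = \<mu> * ip M w h + (LINT x|M. \<bar>w x\<bar> powr (p - 2) * w x * h x)"
      by (simp add: B_def)
  qed
qed

end

section \<open>Smooth functions\<close>

lemma Ck_on_const: "Ck_on k UNIV (\<lambda>x. c)"
  by (induction k arbitrary: c) auto

lemma Ck_on_SucD: "Ck_on (Suc k) UNIV f \<Longrightarrow> Ck_on k UNIV f"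
proof (induction k arbitrary: f)
  case 0
  then show ?case by (auto intro!: continuous_at_imp_continuous_on differentiable_imp_continuous_within)
next
  case (Suc k)
  then show ?case by (metis Ck_on.simps(2))
qed

lemma Ck_on_continuous: "Ck_on k UNIV f \<Longrightarrow> continuous_on UNIV f"
  by (induction k) (use Ck_on_SucD in auto)

lemma frechet_derivative_works': "f differentiable (at x) \<Longrightarrow> (f has_derivative frechet_derivative f (at x)) (at x)"
  by (simp add: frechet_derivative_works)

lemma Ck_on_add: "Ck_on k UNIV f \<Longrightarrow> Ck_on k UNIV g \<Longrightarrow> Ck_on k UNIV (\<lambda>x. f x + g x)"
proof (induction k arbitrary: f g)
  case 0 then show ?case by (auto intro: continuous_on_add)
next
  case (Suc k)
  have d: "((\<lambda>x. f x + g x) has_derivative (\<lambda>e. frechet_derivative f (at x) e + frechet_derivative g (at x) e)) (at x)" for x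
    using Suc.prems by (intro has_derivative_add frechet_derivative_works') auto
  have "frechet_derivative (\<lambda>x. f x + g x) (at x) = (\<lambda>e. frechet_derivative f (at x) e + frechet_derivative g (at x) e)" for x
    using frechet_derivative_at[OF d] by simp
  moreover have "(\<lambda>x. f x + g x) differentiable at x" for x
    using d by (auto simp: differentiable_def)
  ultimately show ?case using Suc.IH Suc.prems by auto
qed

lemma Ck_on_mult:
  fixes f g :: "'a::euclidean_space \<Rightarrow> real"
  shows "Ck_on k UNIV f \<Longrightarrow> Ck_on k UNIV g \<Longrightarrow> Ck_on k UNIV (\<lambda>x. f x * g x)"
proof (induction k arbitrary: f g)
  case 0 then show ?case by (auto intro: continuous_on_mult)
next
  case (Suc k)
  have d: "((\<lambda>x. f x * g x) has_derivative (\<lambda>e. f x * frechet_derivative g (at x) e + frechet_derivative f (at x) e * g x)) (at x)" for x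
    using Suc.prems by (intro has_derivative_mult frechet_derivative_works') auto
  have "frechet_derivative (\<lambda>x. f x * g x) (at x) = (\<lambda>e. f x * frechet_derivative g (at x) e + frechet_derivative f (at x) e * g x)" for x
    using frechet_derivative_at[OF d] by simp
  moreover have "(\<lambda>x. f x * g x) differentiable at x" for x
    using d by (auto simp: differentiable_def)
  moreover have "Ck_on k UNIV (\<lambda>x. f x * frechet_derivative g (at x) e + frechet_derivative f (at x) e * g x)" if "e \<in> Basis" for e
    using that Suc.prems Suc.IH[OF Ck_on_SucD[OF Suc.prems(1)]] Suc.IH[OF _ Ck_on_SucD[OF Suc.prems(2)]]
    by (intro Ck_on_add) auto
  ultimately show ?case by simp
qed

text \<open>Stating the lemma for a sequence of successive derivatives lets the induction on \<open>k\<close> move from \<open>F i\<close> to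
  \<open>F (Suc i)\<close>.\<close>

lemma Ck_on_compose:
  fixes q :: "'a::euclidean_space \<Rightarrow> real" and F :: "nat \<Rightarrow> real \<Rightarrow> real"
  assumes F: "\<And>i t. (F i has_real_derivative F (Suc i) t) (at t)"
  shows "Ck_on k UNIV q \<Longrightarrow> Ck_on k UNIV (\<lambda>x. F i (q x))"
proof (induction k arbitrary: i)
  case 0
  have "continuous_on UNIV (F i)"
    by (rule continuous_at_imp_continuous_on) (intro ballI DERIV_isCont[OF F])
  from continuous_on_compose2[OF this, of UNIV q] 0 show ?case by simp
next
  case (Suc k)
  have d: "((\<lambda>x. F i (q x)) has_derivative (\<lambda>e. F (Suc i) (q x) * frechet_derivative q (at x) e)) (at x)" for x
    using Suc.prems
    by (intro has_derivative_compose[OF frechet_derivative_works' F[unfolded has_field_derivative_def]]) auto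
  have "frechet_derivative (\<lambda>x. F i (q x)) (at x) = (\<lambda>e. F (Suc i) (q x) * frechet_derivative q (at x) e)" for x
    using frechet_derivative_at[OF d] by simp
  moreover have "(\<lambda>x. F i (q x)) differentiable at x" for x
    using d by (auto simp: differentiable_def)
  moreover have "Ck_on k UNIV (\<lambda>x. F (Suc i) (q x) * frechet_derivative q (at x) e)" if "e \<in> Basis" for e
    using that Suc.prems by (intro Ck_on_mult Suc.IH Ck_on_SucD[OF Suc.prems]) auto
  ultimately show ?case by simp
qed

lemma Ck_on_affine:
  fixes a :: "'a::euclidean_space"
  shows "Ck_on k UNIV (\<lambda>x. x \<bullet> a + c)"
proof (cases k)
  case 0 then show ?thesis by (auto intro!: continuous_intros)
next
  case (Suc k)
  have d: "((\<lambda>x. x \<bullet> a + c) has_derivative (\<lambda>e. e \<bullet> a)) (at x)" for x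
    by (auto intro!: derivative_eq_intros)
  have "frechet_derivative (\<lambda>x. x \<bullet> a + c) (at x) = (\<lambda>e. e \<bullet> a)" for x
    using frechet_derivative_at[OF d] by simp
  moreover have "(\<lambda>x. x \<bullet> a + c) differentiable at x" for x
    using d by (auto simp: differentiable_def)
  ultimately show ?thesis using Suc by (simp add: Ck_on_const)
qed

lemma Ck_on_dist_square:
  fixes a :: "'a::euclidean_space"
  shows "Ck_on k UNIV (\<lambda>x. c - (x - a) \<bullet> (x - a))"
proof (cases k)
  case 0 then show ?thesis by (auto intro!: continuous_intros)
next
  case (Suc k)
  have d: "((\<lambda>x. c - (x - a) \<bullet> (x - a)) has_derivative (\<lambda>e. x \<bullet> (-2 *\<^sub>R e) + 2 * (a \<bullet> e))) (at x)" for x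
    by (auto intro!: derivative_eq_intros simp: fun_eq_iff inner_diff inner_commute algebra_simps)
  have "frechet_derivative (\<lambda>x. c - (x - a) \<bullet> (x - a)) (at x) = (\<lambda>e. x \<bullet> (-2 *\<^sub>R e) + 2 * (a \<bullet> e))" for x
    using frechet_derivative_at[OF d] by simp
  moreover have "(\<lambda>x. c - (x - a) \<bullet> (x - a)) differentiable at x" for x
    using d by (auto simp: differentiable_def)
  ultimately show ?thesis unfolding Suc Ck_on.simps by (simp only: Ck_on_affine) blast
qed

text \<open>Every derivative of \<open>exp (- 1 / t)\<close>, extended by zero to \<open>t \<le> 0\<close>, is \<open>exp (- 1 / t)\<close>
  times a polynomial in \<open>1 / t\<close>.\<close>

definition flat :: "real poly \<Rightarrow> real \<Rightarrow> real" where
  "flat P t = (if 0 < t then poly P (1 / t) * exp (- (1 / t)) else 0)"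

primrec flat_poly :: "nat \<Rightarrow> real poly" where
  "flat_poly 0 = 1"
| "flat_poly (Suc n) = [:0, 0, 1:] * (flat_poly n - pderiv (flat_poly n))"

lemma poly_exp_tendsto_0: "((\<lambda>y. poly P y * exp (- y)) \<longlongrightarrow> (0::real)) at_top"
proof -
  have "((\<lambda>y. \<Sum>i\<le>degree P. coeff P i * (y ^ i / exp y)) \<longlongrightarrow> (\<Sum>i\<le>degree P. coeff P i * 0)) at_top"
    by (intro tendsto_sum tendsto_mult tendsto_const tendsto_power_div_exp_0)
  moreover have "poly P y * exp (- y) = (\<Sum>i\<le>degree P. coeff P i * (y ^ i / exp y))" for y
    by (simp add: poly_altdef sum_distrib_right exp_minus divide_inverse mult.assoc)
  ultimately show ?thesis by simp
qed

lemma flat_has_derivative: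
  "(flat P has_real_derivative flat ([:0, 0, 1:] * (P - pderiv P)) t) (at t)"
proof -
  consider "t > 0" | "t < 0" | "t = 0" by linarith
  then show ?thesis
  proof cases
    case 1
    have "((\<lambda>t. poly P (1 / t) * exp (- (1 / t))) has_real_derivative
        poly ([:0, 0, 1:] * (P - pderiv P)) (1 / t) * exp (- (1 / t))) (at t)"
      using 1 by (auto intro!: derivative_eq_intros poly_DERIV[THEN DERIV_chain2]
        simp: field_simps power2_eq_square)
    then have "(flat P has_real_derivative poly ([:0, 0, 1:] * (P - pderiv P)) (1 / t) * exp (- (1 / t))) (at t)"
      by (rule has_field_derivative_transform_within_open[of _ _ _ "{0<..}"]) (use 1 in \<open>auto simp: flat_def\<close>)
    then show ?thesis using 1 by (simp add: flat_def)
  next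
    case 2
    have "((\<lambda>t. 0::real) has_real_derivative 0) (at t)" by simp
    then have "(flat P has_real_derivative 0) (at t)"
      by (rule has_field_derivative_transform_within_open[of _ _ _ "{..<0}"]) (use 2 in \<open>auto simp: flat_def\<close>)
    then show ?thesis using 2 by (simp add: flat_def)
  next
    case 3
    have "((\<lambda>h. poly ([:0, 1:] * P) (inverse h) * exp (- inverse h)) \<longlongrightarrow> 0) (at_right (0::real))"
      by (rule filterlim_compose[OF poly_exp_tendsto_0 filterlim_inverse_at_top_right])
    then have "((\<lambda>h. (flat P (0 + h) - flat P 0) / h) \<longlongrightarrow> 0) (at_right 0)"
    proof (rule Lim_transform_eventually)
      show "\<forall>\<^sub>F h in at_right (0::real). poly ([:0, 1:] * P) (inverse h) * exp (- inverse h)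
          = (flat P (0 + h) - flat P 0) / h"
        by (rule eventually_at_right_less[THEN eventually_mono]) (simp add: flat_def divide_inverse mult_ac)
    qed
    moreover have "((\<lambda>h. (flat P (0 + h) - flat P 0) / h) \<longlongrightarrow> 0) (at_left 0)"
      by (rule tendsto_eventually) (auto simp: eventually_at_left_field flat_def intro!: exI[of _ "-1"])
    ultimately have "((\<lambda>h. (flat P (0 + h) - flat P 0) / h) \<longlongrightarrow> 0) (at 0)"
      by (simp add: filterlim_split_at)
    then show ?thesis using 3 unfolding DERIV_def by (simp add: flat_def)
  qed
qed

definition ball_bump :: "'a::euclidean_space \<Rightarrow> real \<Rightarrow> 'a \<Rightarrow> real" where
  "ball_bump a r x = flat 1 (r\<^sup>2 - (x - a) \<bullet> (x - a))"

lemma Ck_on_ball_bump: "Ck_on k UNIV (ball_bump a r)"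
proof -
  have "Ck_on k UNIV (\<lambda>x. (flat \<circ> flat_poly) 0 (r\<^sup>2 - (x - a) \<bullet> (x - a)))"
    by (rule Ck_on_compose[OF _ Ck_on_dist_square]) (use flat_has_derivative in simp)
  then show ?thesis by (simp add: ball_bump_def[abs_def])
qed

lemma ball_bump_nonneg: "0 \<le> ball_bump a r x"
  by (simp add: ball_bump_def flat_def)

lemma ball_bump_pos_iff: "0 < r \<Longrightarrow> 0 < ball_bump a r x \<longleftrightarrow> x \<in> ball a r"
proof -
  assume r: "0 < r"
  have "0 < ball_bump a r x \<longleftrightarrow> (norm (x - a))\<^sup>2 < r\<^sup>2"
    by (simp add: ball_bump_def flat_def power2_norm_eq_inner)
  also have "\<dots> \<longleftrightarrow> norm (x - a) < r" using r by (simp add: power_mono_iff abs_le_square_iff[symmetric] not_le[symmetric])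
  finally show ?thesis by (simp add: dist_norm norm_minus_commute)
qed

lemma Ck_on_sum: "(\<And>i. i \<in> I \<Longrightarrow> Ck_on k UNIV (f i)) \<Longrightarrow> Ck_on k UNIV (\<lambda>x. \<Sum>i\<in>I. f i x)"
  by (induction I rule: infinite_finite_induct) (auto simp: Ck_on_const Ck_on_add)

text \<open>The open set is a countable union of balls; a finite sum \<open>b n\<close> of bumps is positive exactly on
  the union of the first ones, and \<open>1 - exp (- n b n)\<close> tends to the indicator function.\<close>

lemma test_functions_approximate_open_set:
  fixes U :: "(real^'n) set"
  assumes U: "open U"
  obtains \<psi> where "\<And>n::nat. test_function U (\<psi> n)" "\<And>n x. \<bar>\<psi> n x\<bar> \<le> 1"
    "\<And>x. (\<lambda>n. \<psi> n x) \<longlonglongrightarrow> indicator U x"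
proof (cases "U = {}")
  case True
  have "test_function U (\<lambda>x. 0)" by (simp add: test_function_def smooth_on_def Ck_on_const)
  then show thesis using that[of "\<lambda>_ _. 0"] True by simp
next
  case False
  define \<F> where "\<F> = {ball x r | x r. 0 < r \<and> cball x r \<subseteq> U}"
  have op: "\<And>S. S \<in> \<F> \<Longrightarrow> open S" by (auto simp: \<F>_def)
  have cover: "\<Union>\<F> = U"
  proof
    show "\<Union>\<F> \<subseteq> U" by (fastforce simp: \<F>_def)
    show "U \<subseteq> \<Union>\<F>"
    proof
      fix x assume "x \<in> U"
      then obtain r where "0 < r" "cball x r \<subseteq> U" using U open_contains_cball by blast
      then show "x \<in> \<Union>\<F>" unfolding \<F>_def by (intro UnionI[of "ball x r"]) auto
    qed
  qed
  obtain \<G> where G: "\<G> \<subseteq> \<F>" "countable \<G>" "\<Union>\<G> = U"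
    using Lindelof[OF op] cover by metis
  have "\<G> \<noteq> {}" using G(3) False by auto
  then obtain B where B: "range (B :: nat \<Rightarrow> _) = \<G>" using G(2) uncountable_def by metis
  have "\<exists>x r. B n = ball x r \<and> 0 < r \<and> cball x r \<subseteq> U" for n
    using B G(1) unfolding \<F>_def by blast
  then obtain c r where cr: "\<And>n. B n = ball (c n) (r n)" "\<And>n. 0 < r n" "\<And>n. cball (c n) (r n) \<subseteq> U"
    by metis
  define b where "b n x = (\<Sum>j\<le>n. ball_bump (c j) (r j) x)" for n x
  have b0: "0 \<le> b n x" for n x unfolding b_def by (intro sum_nonneg ball_bump_nonneg)
  define \<psi> where "\<psi> n x = 1 - exp (- real n * b n x)" for n x
  have "test_function U (\<psi> n)" for n
  proof -
    define F where "F i t = (if i = 0 then 1 - exp (- real n * t) else - ((- real n) ^ i * exp (- real n * t)))" for i t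
    have F: "(F i has_real_derivative F (Suc i) t) (at t)" for i t
    proof -
      have "((\<lambda>t. (if i = 0 then 1 - exp (- real n * t) else - ((- real n) ^ i * exp (- real n * t))))
         has_real_derivative - ((- real n) ^ Suc i * exp (- real n * t))) (at t)"
        by (cases "i = 0") (auto intro!: derivative_eq_intros)
      then show ?thesis by (simp add: F_def[abs_def])
    qed
    have "Ck_on k UNIV (\<lambda>x. F 0 (b n x))" for k
      unfolding b_def by (rule Ck_on_compose[where F = F]) (rule F, intro Ck_on_sum Ck_on_ball_bump)
    then have smooth: "smooth_on UNIV (\<psi> n)" by (simp add: smooth_on_def F_def \<psi>_def[abs_def])
    define K where "K = (\<Union>j\<le>n. cball (c j) (r j))"
    have K: "compact K" "K \<subseteq> U" unfolding K_def using cr(3) by (auto intro!: compact_UN)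
    have "{x. \<psi> n x \<noteq> 0} \<subseteq> K"
    proof
      fix x assume "x \<in> {x. \<psi> n x \<noteq> 0}"
      then have "b n x \<noteq> 0" by (auto simp: \<psi>_def)
      then obtain j where j: "j \<le> n" "ball_bump (c j) (r j) x \<noteq> 0"
        unfolding b_def by (meson atMost_iff sum.neutral)
      then have "0 < ball_bump (c j) (r j) x" using ball_bump_nonneg[of "c j" "r j" x] by simp
      then have "x \<in> ball (c j) (r j)" using ball_bump_pos_iff[OF cr(2)[of j]] by blast
      then show "x \<in> K" using j unfolding K_def by (intro UN_I[of j]) auto
    qed
    then have sub: "closure {x. \<psi> n x \<noteq> 0} \<subseteq> K" by (rule closure_minimal[OF _ compact_imp_closed[OF K(1)]])
    have "compact (K \<inter> closure {x. \<psi> n x \<noteq> 0})" by (rule compact_Int_closed[OF K(1) closed_closure])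
    then have "compact (closure {x. \<psi> n x \<noteq> 0})" unfolding Int_absorb1[OF sub] .
    then show ?thesis unfolding test_function_def using smooth order_trans[OF sub K(2)] by simp
  qed
  moreover have "\<bar>\<psi> n x\<bar> \<le> 1" for n x
    using b0[of n x] unfolding \<psi>_def by (simp add: abs_le_iff mult_nonneg_nonneg)
  moreover have "(\<lambda>n. \<psi> n x) \<longlonglongrightarrow> indicator U x" for x
  proof (cases "x \<in> U")
    case True
    then obtain j where j: "x \<in> ball (c j) (r j)" using G(3) B cr(1) by (metis UnionE rangeE)
    then have pos: "0 < ball_bump (c j) (r j) x" using ball_bump_pos_iff[OF cr(2)] by blast
    define e where "e = ball_bump (c j) (r j) x"
    have e: "0 < e" using pos by (simp add: e_def)
    have le: "e \<le> b n x" if "j \<le> n" for n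
      unfolding b_def e_def using that by (intro member_le_sum ball_bump_nonneg) auto
    have lim: "(\<lambda>n. exp (- e) ^ n) \<longlonglongrightarrow> 0"
      by (rule LIMSEQ_power_zero) (use e in simp)
    have "(\<lambda>n. exp (- real n * b n x)) \<longlonglongrightarrow> 0"
    proof (rule Lim_null_comparison[OF _ lim])
      show "\<forall>\<^sub>F n in sequentially. norm (exp (- real n * b n x)) \<le> exp (- e) ^ n"
        unfolding eventually_sequentially
      proof (intro exI[of _ j] allI impI)
        fix n assume "j \<le> n"
        then have "real n * e \<le> real n * b n x" using le by (intro mult_left_mono) auto
        then show "norm (exp (- real n * b n x)) \<le> exp (- e) ^ n"
          by (simp add: exp_of_nat_mult[symmetric])
      qed
    qed
    from tendsto_diff[OF tendsto_const[of 1] this] show ?thesis using True by (simp add: \<psi>_def)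
  next
    case False
    have "ball_bump (c j) (r j) x = 0" for j
      using False cr(3)[of j] ball_bump_pos_iff[OF cr(2)[of j], of "c j" x] ball_bump_nonneg[of "c j" "r j" x]
      by force
    then show ?thesis using False by (simp add: \<psi>_def b_def)
  qed
  ultimately show thesis by (rule that)
qed


section \<open>Weak gradients of smooth functions\<close>

lemma grad_nth: "grad f x $ i = frechet_derivative f (at x) (axis i 1)"
  by (simp add: grad_def)

lemma axis_1_Basis: "axis i (1::real) \<in> Basis"
  by (simp add: axis_in_Basis_iff)

lemma continuous_on_grad: "Ck_on 1 UNIV f \<Longrightarrow> continuous_on UNIV (grad f)"
  unfolding grad_def by (intro continuous_on_vec_lambda) (simp add: axis_1_Basis)

lemma integrable_on_bounded_open:
  fixes f :: "real^'n \<Rightarrow> 'b::euclidean_space"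
  assumes "open \<Omega>" "bounded \<Omega>" and f: "continuous_on UNIV f"
  shows "integrable (lebesgue_on \<Omega>) f"
proof -
  have lm: "\<Omega> \<in> lmeasurable" using assms by (simp add: lmeasurable_open)
  then interpret finite_measure "lebesgue_on \<Omega>" by (rule finite_measure_lebesgue_on)
  have "compact (f ` closure \<Omega>)"
    using assms by (intro compact_continuous_image continuous_on_subset[OF f]) auto
  then obtain C where C: "\<And>x. x \<in> closure \<Omega> \<Longrightarrow> norm (f x) \<le> C"
    using compact_imp_bounded by (fastforce simp: bounded_iff)
  have "f \<in> borel_measurable borel" using f by (rule borel_measurable_continuous_onI)
  then have "f \<in> borel_measurable lebesgue" by (simp add: measurable_completion)
  then have "f \<in> borel_measurable (lebesgue_on \<Omega>)" by (simp add: measurable_restrict_space1)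
  then show ?thesis
    using C subsetD[OF closure_subset, of _ \<Omega>] by (intro integrable_const_bound[of _ C]) (auto intro!: AE_I2)
qed

lemma continuous_in_L2:
  fixes f :: "real^'n \<Rightarrow> 'b::euclidean_space"
  assumes "open \<Omega>" "bounded \<Omega>" and f: "continuous_on UNIV f"
  shows "f \<in> L2 \<Omega>"
proof -
  have "continuous_on UNIV (\<lambda>x. (norm (f x))\<^sup>2)" by (intro continuous_intros f)
  from integrable_on_bounded_open[OF assms(1,2) this] integrable_on_bounded_open[OF assms]
  show ?thesis by (auto simp: L2_def)
qed

text \<open>The integral of a partial derivative of a compactly supported function vanishes: difference
  quotients have integral zero by translation invariance, and they are uniformly bounded.\<close>

lemma integral_partial_derivative_eq_0:
  fixes f :: "'a::euclidean_space \<Rightarrow> real"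
  assumes f: "Ck_on 1 UNIV f" and K: "compact K" "\<And>x. x \<notin> K \<Longrightarrow> f x = 0" and e: "e \<in> Basis"
  shows "(LINT x|lborel. frechet_derivative f (at x) e) = 0"
proof -
  define f' where "f' x = frechet_derivative f (at x) e" for x
  have cont: "continuous_on UNIV f" "continuous_on UNIV f'"
    using f e Ck_on_continuous[OF f] unfolding f'_def by (auto simp: One_nat_def)
  have [measurable]: "f \<in> borel_measurable borel" "f' \<in> borel_measurable borel"
    using cont by (auto intro: borel_measurable_continuous_onI)
  have diff: "f differentiable (at x)" for x using f by (simp add: One_nat_def)
  have line: "((\<lambda>t. f (x + t *\<^sub>R e)) has_real_derivative f' (x + t *\<^sub>R e)) (at t)" for x t
  proof -
    have d: "((\<lambda>t. f (x + t *\<^sub>R e)) has_derivative (\<lambda>h. frechet_derivative f (at (x + t *\<^sub>R e)) (h *\<^sub>R e))) (at t)"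
      by (rule has_derivative_compose[OF _ frechet_derivative_works'[OF diff]])
        (auto intro!: derivative_eq_intros)
    have "frechet_derivative f (at (x + t *\<^sub>R e)) (h *\<^sub>R e) = f' (x + t *\<^sub>R e) * h" for h
      using linear_frechet_derivative[OF diff] by (simp add: linear_cmul f'_def)
    then show ?thesis using d by (simp add: has_field_derivative_def)
  qed
  obtain R where R: "\<And>x. x \<in> K \<Longrightarrow> norm x \<le> R" using compact_imp_bounded[OF K(1)] by (auto simp: bounded_iff)
  have out: "f x = 0" if "R < norm x" for x using K(2) R that by (meson not_le)
  have "compact (f' ` cball 0 (R + 1))"
    by (intro compact_continuous_image continuous_on_subset[OF cont(2)]) auto
  then obtain C where C: "\<And>x. x \<in> cball 0 (R + 1) \<Longrightarrow> norm (f' x) \<le> C"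
    using compact_imp_bounded by (fastforce simp: bounded_iff)
  have out': "f' x = 0" if "R + 1 < norm x" for x
  proof -
    have "((\<lambda>x. 0) has_derivative (\<lambda>h. 0)) (at x)" by simp
    then have "(f has_derivative (\<lambda>h. 0)) (at x)"
      by (rule has_derivative_transform_within_open[of _ _ _ _ "- cball 0 R"]) (use that out in \<open>auto simp: dist_norm\<close>)
    from frechet_derivative_at[OF this] show ?thesis unfolding f'_def by (rule fun_cong[symmetric])
  qed
  have bound: "norm (f' x) \<le> \<bar>C\<bar>" for x
    using C[of x] out'[of x] by (cases "R + 1 < norm x") (auto simp: not_less)
  define t where "t n = inverse (real (Suc n))" for n
  have t: "0 < t n" "t n \<le> 1" for n by (auto simp: t_def inverse_eq_divide)
  define q where "q n x = (f (x + t n *\<^sub>R e) - f x) / t n" for n x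
  obtain Cf where Cf: "\<And>x. x \<in> cball 0 R \<Longrightarrow> norm (f x) \<le> Cf"
    using compact_imp_bounded[OF compact_continuous_image[OF continuous_on_subset[OF cont(1) subset_UNIV] compact_cball], of 0 R]
    by (fastforce simp: bounded_iff)
  have intf: "integrable lborel f"
  proof (rule Bochner_Integration.integrable_bound)
    show "integrable lborel (\<lambda>x. \<bar>Cf\<bar> * indicator (cball (0::'a) R) x :: real)"
      by (intro integrable_mult_right integrable_real_indicator) (simp_all add: emeasure_lborel_cball_finite[unfolded infinity_ennreal_def])
    show "AE x in lborel. norm (f x) \<le> norm (\<bar>Cf\<bar> * indicator (cball 0 R) x :: real)"
    proof (rule AE_I2)
      fix x show "norm (f x) \<le> norm (\<bar>Cf\<bar> * indicator (cball 0 R) x :: real)"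
        using Cf[of x] out[of x] by (cases "x \<in> cball 0 R") auto
    qed
  qed measurable
  have intshift: "integrable lborel (\<lambda>x. f (x + c))" and eqshift: "(LINT x|lborel. f (x + c)) = (LINT x|lborel. f x)" for c
  proof -
    have "(\<lambda>x. x + c) = (+) c" by (rule ext) (rule add.commute)
    then have d: "distr lborel borel (\<lambda>x. x + c) = lborel" using lborel_distr_plus[of c] by (simp only:)
    have "integrable (distr lborel borel (\<lambda>x. x + c)) f" unfolding d by (rule intf)
    then show "integrable lborel (\<lambda>x. f (x + c))" by (subst (asm) integrable_distr_eq) auto
    have "(LINT x|distr lborel borel (\<lambda>x. x + c). f x) = (LINT x|lborel. f (x + c))"
      by (rule integral_distr) auto
    then show "(LINT x|lborel. f (x + c)) = (LINT x|lborel. f x)" unfolding d by simp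
  qed
  have q0: "(LINT x|lborel. q n x) = 0" for n
  proof -
    have "(LINT x|lborel. f (x + t n *\<^sub>R e) - f x) = 0"
      unfolding Bochner_Integration.integral_diff[OF intshift intf] eqshift by simp
    then show ?thesis unfolding q_def by simp
  qed
  have "(\<lambda>n. LINT x|lborel. q n x) \<longlonglongrightarrow> (LINT x|lborel. f' x)"
  proof (rule integral_dominated_convergence)
    show "integrable lborel (\<lambda>x. \<bar>C\<bar> * indicator (cball (0::'a) (R + 1)) x :: real)"
      by (intro integrable_mult_right integrable_real_indicator) (simp_all add: emeasure_lborel_cball_finite[unfolded infinity_ennreal_def])
    show "AE x in lborel. (\<lambda>n. q n x) \<longlonglongrightarrow> f' x"
    proof (rule AE_I2)
      fix x
      have "t \<longlonglongrightarrow> 0" unfolding t_def by (rule LIMSEQ_inverse_real_of_nat)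
      moreover have "t n \<noteq> 0" for n using t(1)[of n] by simp
      ultimately have "((\<lambda>h. (f (x + (0 + h) *\<^sub>R e) - f (x + 0 *\<^sub>R e)) / h) \<circ> t) \<longlonglongrightarrow> f' (x + 0 *\<^sub>R e)"
        by (intro line[of x 0, unfolded DERIV_def tendsto_at_iff_sequentially, rule_format]) simp_all
      then show "(\<lambda>n. q n x) \<longlonglongrightarrow> f' x" by (simp add: o_def q_def)
    qed
    show "AE x in lborel. norm (q n x) \<le> \<bar>C\<bar> * indicator (cball 0 (R + 1)) x" for n
    proof (rule AE_I2)
      fix x
      have mv: "norm (f (x + t n *\<^sub>R e) - f (x + 0 *\<^sub>R e)) \<le> \<bar>C\<bar> * norm (t n - 0)"
        by (rule field_differentiable_bound[of UNIV, OF _ line bound]) simp_all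
      show "norm (q n x) \<le> \<bar>C\<bar> * indicator (cball 0 (R + 1)) x"
      proof (cases "x \<in> cball 0 (R + 1)")
        case True
        then show ?thesis using mv t[of n] by (simp add: q_def pos_divide_le_eq)
      next
        case False
        have "norm x \<le> norm (x + t n *\<^sub>R e) + norm (t n *\<^sub>R e)" using norm_triangle_ineq4[of "x + t n *\<^sub>R e" "t n *\<^sub>R e"] by simp
        also have "norm (t n *\<^sub>R e) \<le> 1" using t[of n] e by simp
        finally have "R < norm (x + t n *\<^sub>R e)" "R < norm x" using False by auto
        then show ?thesis using out by (simp add: q_def)
      qed
    qed
  qed (auto simp: q_def)
  then have "(\<lambda>n::nat. 0::real) \<longlonglongrightarrow> (LINT x|lborel. f' x)" unfolding q0 .
  then show ?thesis by (simp add: LIMSEQ_const_iff f'_def)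
qed

text \<open>The product rule and \<open>integral_partial_derivative_eq_0\<close> for the product with a test function.\<close>

lemma smooth_has_weak_grad:
  fixes \<psi> :: "real^'n \<Rightarrow> real"
  assumes \<Omega>: "open \<Omega>" "bounded \<Omega>" and \<psi>: "Ck_on 1 UNIV \<psi>"
  shows "has_weak_grad \<Omega> \<psi> (grad \<psi>)"
  unfolding has_weak_grad_def
proof (intro allI impI)
  fix \<eta> assume \<eta>: "test_function \<Omega> \<eta>"
  define K where "K = closure {x. \<eta> x \<noteq> 0}"
  have K: "compact K" "K \<subseteq> \<Omega>" and \<eta>1: "Ck_on 1 UNIV \<eta>"
    using \<eta> by (auto simp: test_function_def smooth_on_def K_def)
  have out: "\<eta> x = 0" if "x \<notin> K" for x using that closure_subset[of "{x. \<eta> x \<noteq> 0}"] unfolding K_def by blast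
  have f: "Ck_on 1 UNIV (\<lambda>x. \<psi> x * \<eta> x)" by (rule Ck_on_mult[OF \<psi> \<eta>1])
  have fd: "frechet_derivative (\<lambda>x. \<psi> x * \<eta> x) (at x) e = \<psi> x * frechet_derivative \<eta> (at x) e + frechet_derivative \<psi> (at x) e * \<eta> x" for x e
  proof -
    have d: "((\<lambda>x. \<psi> x * \<eta> x) has_derivative (\<lambda>e. \<psi> x * frechet_derivative \<eta> (at x) e + frechet_derivative \<psi> (at x) e * \<eta> x)) (at x)"
      using \<psi> \<eta>1 by (intro has_derivative_mult frechet_derivative_works') (auto simp: One_nat_def)
    show ?thesis by (rule fun_cong[OF frechet_derivative_at[OF d], symmetric])
  qed
  define V where "V x = \<psi> x *\<^sub>R grad \<eta> x + \<eta> x *\<^sub>R grad \<psi> x" for x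
  have c: "continuous_on UNIV \<psi>" "continuous_on UNIV \<eta>" "continuous_on UNIV (grad \<psi>)" "continuous_on UNIV (grad \<eta>)"
    by (rule Ck_on_continuous[OF \<psi>] Ck_on_continuous[OF \<eta>1] continuous_on_grad[OF \<psi>] continuous_on_grad[OF \<eta>1])+
  have int: "integrable (lebesgue_on \<Omega>) (\<lambda>x. \<psi> x *\<^sub>R grad \<eta> x)" "integrable (lebesgue_on \<Omega>) (\<lambda>x. \<eta> x *\<^sub>R grad \<psi> x)"
    by (intro integrable_on_bounded_open[OF \<Omega>] continuous_on_scaleR c)+
  have cV: "continuous_on UNIV V"
    unfolding V_def by (intro continuous_on_add continuous_on_scaleR c)
  have Vi: "V x $ i = frechet_derivative (\<lambda>x. \<psi> x * \<eta> x) (at x) (axis i 1)" for x i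
    unfolding fd V_def by (simp add: grad_nth)
  have intV: "integrable (lebesgue_on \<Omega>) V" unfolding V_def using int by simp
  have "(LINT x|lebesgue_on \<Omega>. V x) $ i = 0" for i
  proof -
    have Ki: "V x $ i = 0" if "x \<notin> \<Omega>" for x
    proof -
      have mem: "x \<in> - K" using that K by blast
      have op: "open (- K)" by (rule open_Compl[OF compact_imp_closed[OF K(1)]])
      have z: "((\<lambda>x. 0::real) has_derivative (\<lambda>h. 0)) (at x)" by simp
      have eq: "0 = \<psi> y * \<eta> y" if "y \<in> - K" for y using out[of y] that by simp
      have "((\<lambda>x. \<psi> x * \<eta> x) has_derivative (\<lambda>h. 0)) (at x)"
        by (rule has_derivative_transform_within_open[OF z op mem eq])
      from fun_cong[OF frechet_derivative_at[OF this], of "axis i 1"] show ?thesis unfolding Vi by simp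
    qed
    have [measurable]: "(\<lambda>x. V x $ i) \<in> borel_measurable borel"
      by (rule borel_measurable_continuous_onI[OF continuous_on_component[OF cV]])
    have "(LINT x|lebesgue_on \<Omega>. V x) $ i = (LINT x|lebesgue_on \<Omega>. V x $ i)"
      by (rule integral_bounded_linear[OF bounded_linear_vec_nth intV, symmetric])
    also have "\<dots> = (LINT x|lebesgue. indicator \<Omega> x *\<^sub>R V x $ i)"
      using \<Omega> by (intro integral_restrict_space) auto
    also have "\<dots> = (LINT x|lebesgue. V x $ i)"
      by (rule Bochner_Integration.integral_cong) (use Ki in \<open>auto simp: indicator_def\<close>)
    also have "\<dots> = (LINT x|lborel. V x $ i)"
      by (rule integral_completion) measurable
    also have "\<dots> = 0"
      unfolding Vi by (rule integral_partial_derivative_eq_0[OF f K(1) _ axis_1_Basis]) (simp add: out)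
    finally show ?thesis .
  qed
  then have "(LINT x|lebesgue_on \<Omega>. V x) = 0" by (simp add: vec_eq_iff)
  then have "(LINT x|lebesgue_on \<Omega>. \<psi> x *\<^sub>R grad \<eta> x) + (LINT x|lebesgue_on \<Omega>. \<eta> x *\<^sub>R grad \<psi> x) = 0"
    unfolding V_def using int by simp
  then show "(LINT x|lebesgue_on \<Omega>. \<psi> x *\<^sub>R grad \<eta> x) = - (LINT x|lebesgue_on \<Omega>. \<eta> x *\<^sub>R grad \<psi> x)"
    by (rule eq_neg_iff_add_eq_0[THEN iffD2])
qed


lemma L2_eq_sqint: "L2 \<Omega> = sqint (lebesgue_on \<Omega>)"
  by (simp add: L2_def sqint_def)

lemma L2_inner_eq_ip: "L2_inner \<Omega> f g = ip (lebesgue_on \<Omega>) f g"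
  by (simp add: L2_inner_def ip_def)

lemma L2_tendsto_iff_sq: "L2_tendsto \<Omega> F f \<longleftrightarrow> (\<lambda>n. sq (lebesgue_on \<Omega>) (\<lambda>x. F n x - f x)) \<longlonglongrightarrow> 0"
  by (simp add: L2_tendsto_def sq_def)

lemma test_function_continuous: "test_function \<Omega> \<psi> \<Longrightarrow> continuous_on UNIV \<psi>"
  by (auto simp: test_function_def smooth_on_def intro: Ck_on_continuous)

lemma test_function_mono: "test_function U \<psi> \<Longrightarrow> U \<subseteq> \<Omega> \<Longrightarrow> test_function \<Omega> \<psi>"
  by (auto simp: test_function_def)

text \<open>The fundamental lemma of the calculus of variations. The vanishing of the integrals
  passes from test functions to indicator functions of open sets, then by outer regularity to
  those of measurable sets, in particular of the set where the function is positive.\<close>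

lemma fundamental_lemma_nonpos:
  fixes w :: "real^'n \<Rightarrow> real"
  assumes \<Omega>: "open \<Omega>" "bounded \<Omega>" and w: "w \<in> sqint (lebesgue_on \<Omega>)"
    and test: "\<And>\<psi>. test_function \<Omega> \<psi> \<Longrightarrow> (LINT x|lebesgue_on \<Omega>. \<psi> x * w x) = 0"
  shows "AE x in lebesgue_on \<Omega>. w x \<le> 0"
proof -
  define M where "M = lebesgue_on \<Omega>"
  have lm: "\<Omega> \<in> lmeasurable" using \<Omega> by (simp add: lmeasurable_open)
  interpret finite_measure M unfolding M_def using lm by (rule finite_measure_lebesgue_on)
  have wM: "w \<in> sqint M" using w by (simp add: M_def)
  have [measurable]: "w \<in> borel_measurable M" by (rule sqintD[OF wM])
  have wint: "integrable M w" by (rule sqint_imp_integrable[OF wM])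
  have open0: "(LINT x|M. indicator U x * w x) = 0" if U: "open U" "U \<subseteq> \<Omega>" for U
  proof -
    obtain \<psi> where \<psi>: "\<And>n::nat. test_function U (\<psi> n)" "\<And>n x. \<bar>\<psi> n x\<bar> \<le> 1"
      "\<And>x. (\<lambda>n. \<psi> n x) \<longlonglongrightarrow> indicator U x"
      using test_functions_approximate_open_set[OF U(1)] by blast
    have meas: "\<psi> n \<in> borel_measurable M" for n
    proof -
      have "\<psi> n \<in> borel_measurable borel"
        by (rule borel_measurable_continuous_onI[OF test_function_continuous[OF \<psi>(1)]])
      then show ?thesis unfolding M_def by (intro measurable_restrict_space1) (simp add: measurable_completion)
    qed
    have ind: "indicator U \<in> borel_measurable M"
      unfolding M_def using U(1) by (intro measurable_restrict_space1) (auto intro!: borel_measurable_indicator)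
    have "(\<lambda>n. LINT x|M. \<psi> n x * w x) \<longlonglongrightarrow> (LINT x|M. indicator U x * w x)"
    proof (rule integral_dominated_convergence[of _ _ _ "\<lambda>x. \<bar>w x\<bar>"])
      show "(\<lambda>x. indicator U x * w x) \<in> borel_measurable M" using ind by measurable
      show "(\<lambda>x. \<psi> n x * w x) \<in> borel_measurable M" for n using meas[of n] by measurable
      show "integrable M (\<lambda>x. \<bar>w x\<bar>)" using wint by simp
      show "AE x in M. (\<lambda>n. \<psi> n x * w x) \<longlonglongrightarrow> indicator U x * w x"
        by (intro AE_I2 tendsto_mult tendsto_const \<psi>(3))
      show "AE x in M. norm (\<psi> n x * w x) \<le> \<bar>w x\<bar>" for n
        using mult_right_mono[OF \<psi>(2), of "\<bar>w _\<bar>"] by (intro AE_I2) (simp add: abs_mult)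
    qed
    moreover have "(LINT x|M. \<psi> n x * w x) = 0" for n
      unfolding M_def by (rule test[OF test_function_mono[OF \<psi>(1) U(2)]])
    ultimately show ?thesis by (simp add: LIMSEQ_const_iff)
  qed
  define A where "A = {x \<in> \<Omega>. 0 < w x}"
  have spM: "space M = \<Omega>" using lm by (simp add: M_def space_restrict_space)
  have AM: "A \<in> sets M"
  proof -
    have eq: "A = {x \<in> space M. 0 < w x}" unfolding A_def spM ..
    show ?thesis unfolding eq by measurable
  qed
  have Alm: "A \<in> lmeasurable"
  proof (rule fmeasurableI2[OF lm])
    show "A \<subseteq> \<Omega>" by (auto simp: A_def)
    show "A \<in> sets lebesgue" using AM lm unfolding M_def by (simp add: sets_restrict_space_iff)
  qed
  have small: "\<bar>LINT x|M. indicator A x * w x\<bar> \<le> sqrt e * sqrt (sq M w)" if e: "0 < e" for e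
  proof -
    obtain T where T: "open T" "A \<subseteq> T" "T - A \<in> lmeasurable" and "emeasure lebesgue (T - A) < ennreal e"
      using sets_lebesgue_outer_open[OF fmeasurableD[OF Alm] e] by blast
    then have mT: "measure lebesgue (T - A) < e"
      using e by (simp add: emeasure_eq_measure2 ennreal_less_iff)
    define U where "U = T \<inter> \<Omega>"
    have U: "open U" "A \<subseteq> U" "U \<subseteq> \<Omega>" using T \<Omega> by (auto simp: U_def A_def)
    have UA: "U - A \<in> sets M"
    proof -
      have "U \<in> sets M" unfolding M_def using U lm by (auto simp: sets_restrict_space_iff)
      then show ?thesis using AM by auto
    qed
    have mUA: "measure M (U - A) \<le> e"
    proof -
      have "measure M (U - A) = measure lebesgue (U - A)"
        unfolding M_def using lm U by (intro measure_restrict_space) auto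
      also have "\<dots> \<le> measure lebesgue (T - A)"
      proof (rule measure_mono_fmeasurable[OF _ _ T(3)])
        show "U - A \<subseteq> T - A" by (auto simp: U_def)
        show "U - A \<in> sets lebesgue" using U(1) Alm by auto
      qed
      finally show ?thesis using mT by simp
    qed
    define i where "i = (indicator (U - A) :: _ \<Rightarrow> real)"
    have i2: "(norm (i x))\<^sup>2 = indicator (U - A) x" for x by (simp add: i_def indicator_def)
    have ii: "integrable M (indicator (U - A) :: _ \<Rightarrow> real)"
      using UA by (intro integrable_real_indicator) (auto simp: less_top[symmetric])
    have "i \<in> borel_measurable M" unfolding i_def using UA by (rule borel_measurable_indicator)
    moreover have "integrable M (\<lambda>x. (norm (i x))\<^sup>2)" unfolding i2 by (rule ii)
    ultimately have isq: "i \<in> sqint M" unfolding sqint_def by simp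
    have sqi: "sq M i \<le> e" unfolding sq_def i2 using UA mUA by simp
    have UM: "U \<in> sets M" unfolding M_def using U lm by (auto simp: sets_restrict_space_iff)
    have intU: "integrable M (\<lambda>x. indicator U x * w x)" and intA: "integrable M (\<lambda>x. indicator A x * w x)"
      using integrable_mult_indicator[OF UM wint] integrable_mult_indicator[OF AM wint] by simp_all
    have "(LINT x|M. indicator U x * w x) - (LINT x|M. indicator A x * w x) = (LINT x|M. indicator U x * w x - indicator A x * w x)"
      using intU intA by simp
    also have "\<dots> = ip M i w"
      unfolding ip_def i_def using U(2) by (intro Bochner_Integration.integral_cong) (auto simp: indicator_def)
    finally have "\<bar>LINT x|M. indicator A x * w x\<bar> = \<bar>ip M i w\<bar>" using open0[OF U(1,3)] by simp
    also have "\<dots> \<le> sqrt (sq M i) * sqrt (sq M w)" by (rule ip_abs_le[OF isq wM])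
    also have "\<dots> \<le> sqrt e * sqrt (sq M w)" using sqi by (intro mult_right_mono) (auto simp: sq_nonneg)
    finally show ?thesis .
  qed
  have "(LINT x|M. indicator A x * w x) = 0"
  proof -
    have t: "(\<lambda>n. inverse (real (Suc n))) \<longlonglongrightarrow> 0" by (rule LIMSEQ_inverse_real_of_nat)
    have "(\<lambda>n. sqrt (inverse (real (Suc n))) * sqrt (sq M w)) \<longlonglongrightarrow> sqrt 0 * sqrt (sq M w)"
      by (rule tendsto_mult[OF tendsto_real_sqrt[OF t] tendsto_const])
    then have "\<bar>LINT x|M. indicator A x * w x\<bar> \<le> sqrt 0 * sqrt (sq M w)"
      by (rule LIMSEQ_le_const) (intro exI[of _ 0] allI impI small, simp)
    then show ?thesis by simp
  qed
  moreover have "(LINT x|M. max 0 (w x)) = (LINT x|M. indicator A x * w x)"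
    by (rule Bochner_Integration.integral_cong) (auto simp: spM A_def indicator_def)
  ultimately have "(LINT x|M. max 0 (w x)) = 0" by simp
  moreover have "integrable M (\<lambda>x. max 0 (w x))" using wint by simp
  ultimately have "AE x in M. max 0 (w x) = 0"
    by (subst (asm) integral_nonneg_eq_0_iff_AE) auto
  then show ?thesis unfolding M_def by eventually_elim (simp add: max_def split: if_splits)
qed

lemma scaleR_sqint_integrable:
  fixes g :: "'a \<Rightarrow> 'b::euclidean_space"
  assumes "f \<in> sqint M" "g \<in> sqint M" shows "integrable M (\<lambda>x. f x *\<^sub>R g x)"
proof (rule Bochner_Integration.integrable_bound)
  have [measurable]: "f \<in> borel_measurable M" "g \<in> borel_measurable M" using assms by (auto dest: sqintD)
  show "(\<lambda>x. f x *\<^sub>R g x) \<in> borel_measurable M" by measurable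
  show "integrable M (\<lambda>x. (norm (f x))\<^sup>2 + (norm (g x))\<^sup>2)"
    using assms by (intro Bochner_Integration.integrable_add sqint_integrable_sq)
  have "norm (a *\<^sub>R b) \<le> (norm a)\<^sup>2 + (norm b)\<^sup>2" for a :: real and b :: 'b
  proof -
    have "0 \<le> norm a * norm b" by simp
    then show ?thesis using sum_squares_bound[of "norm a" "norm b"] unfolding norm_scaleR real_norm_def by linarith
  qed
  then show "AE x in M. norm (f x *\<^sub>R g x) \<le> norm ((norm (f x))\<^sup>2 + (norm (g x))\<^sup>2)" by auto
qed

text \<open>The components of the difference, with both signs, satisfy the assumption of
  \<open>fundamental_lemma_nonpos\<close>.\<close>

lemma weak_grad_unique:
  fixes \<Omega> :: "(real^'n) set"
  assumes \<Omega>: "open \<Omega>" "bounded \<Omega>" and g: "g \<in> L2 \<Omega>" "has_weak_grad \<Omega> u g"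
    and h: "h \<in> L2 \<Omega>" "has_weak_grad \<Omega> u h"
  shows "AE x in lebesgue_on \<Omega>. g x = h x"
proof -
  let ?M = "lebesgue_on \<Omega>"
  have gh: "(\<lambda>x. g x - h x) \<in> sqint ?M" using g h by (intro sqint_diff) (auto simp: L2_eq_sqint)
  have comp: "AE x in ?M. c * (g x - h x) $ i \<le> 0" for i and c :: real
  proof (rule fundamental_lemma_nonpos[OF \<Omega>])
    have g': "g \<in> sqint ?M" and h': "h \<in> sqint ?M"
      using g h by (auto simp: L2_eq_sqint)
    have m: "(\<lambda>x. (g x - h x) $ i) \<in> borel_measurable ?M"
      by (rule measurable_compose[OF borel_measurable_diff[OF sqintD[OF g'] sqintD[OF h']]
          borel_measurable_continuous_onI[OF continuous_on_component[OF continuous_on_id]]])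
    show "(\<lambda>x. c * (g x - h x) $ i) \<in> sqint ?M"
    proof (rule sqint_cmult)
      have "integrable ?M (\<lambda>x. ((g x - h x) $ i)\<^sup>2)"
      proof (rule Bochner_Integration.integrable_bound[OF sqint_integrable_sq[OF gh]])
        show "AE x in ?M. norm (((g x - h x) $ i)\<^sup>2) \<le> norm ((norm (g x - h x))\<^sup>2)"
        proof (rule AE_I2)
          fix x
          show "norm (((g x - h x) $ i)\<^sup>2) \<le> norm ((norm (g x - h x))\<^sup>2)"
            using power_mono[OF component_le_norm_cart abs_ge_zero, of "g x - h x" i 2]
            by (simp del: vector_minus_component)
        qed
      qed (use m in \<open>simp del: vector_minus_component\<close>)
      then show "(\<lambda>x. (g x - h x) $ i) \<in> sqint ?M" using m by (simp add: sqint_def del: vector_minus_component)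
    qed
    fix \<psi> assume \<psi>: "test_function \<Omega> \<psi>"
    have \<psi>2: "\<psi> \<in> sqint ?M" using continuous_in_L2[OF \<Omega> test_function_continuous[OF \<psi>]] by (simp add: L2_eq_sqint)
    have int: "integrable ?M (\<lambda>x. \<psi> x *\<^sub>R (g x - h x))" by (rule scaleR_sqint_integrable[OF \<psi>2 gh])
    have intgh: "integrable ?M (\<lambda>x. \<psi> x *\<^sub>R g x)" "integrable ?M (\<lambda>x. \<psi> x *\<^sub>R h x)"
      using g h by (auto intro: scaleR_sqint_integrable \<psi>2 simp: L2_eq_sqint)
    have "(LINT x|?M. \<psi> x *\<^sub>R g x) = (LINT x|?M. \<psi> x *\<^sub>R h x)"
      using g(2)[unfolded has_weak_grad_def, rule_format, OF \<psi>] h(2)[unfolded has_weak_grad_def, rule_format, OF \<psi>]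
      by simp
    then have "(LINT x|?M. \<psi> x *\<^sub>R (g x - h x)) = 0"
      using intgh by (simp add: scaleR_diff_right)
    moreover have "(LINT x|?M. (\<psi> x *\<^sub>R (g x - h x)) $ i) = (LINT x|?M. \<psi> x *\<^sub>R (g x - h x)) $ i"
      by (rule integral_bounded_linear[OF bounded_linear_vec_nth int])
    ultimately have "(LINT x|?M. \<psi> x * (g x - h x) $ i) = 0"
      by (simp del: vector_minus_component)
    moreover have "(LINT x|?M. \<psi> x * (c * (g x - h x) $ i)) = c * (LINT x|?M. \<psi> x * (g x - h x) $ i)"
      by (subst integral_mult_right_zero[symmetric]) (simp only: mult_ac)
    ultimately show "(LINT x|?M. \<psi> x * (c * (g x - h x) $ i)) = 0" by simp
  qed
  have "AE x in ?M. \<forall>i. g x $ i = h x $ i"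
  proof (rule AE_all_countable[THEN iffD2], intro allI)
    fix i
    from comp[of 1 i] comp[of "-1" i] show "AE x in ?M. g x $ i = h x $ i"
      by eventually_elim auto
  qed
  then show ?thesis by eventually_elim (simp add: vec_eq_iff)
qed

lemma weak_grad_props:
  assumes "u \<in> H1 \<Omega>" shows "weak_grad \<Omega> u \<in> L2 \<Omega>" "has_weak_grad \<Omega> u (weak_grad \<Omega> u)"
proof -
  have "\<exists>g. g \<in> L2 \<Omega> \<and> has_weak_grad \<Omega> u g" using assms by (auto simp: H1_def)
  from someI_ex[OF this] show "weak_grad \<Omega> u \<in> L2 \<Omega>" "has_weak_grad \<Omega> u (weak_grad \<Omega> u)"
    unfolding weak_grad_def by auto
qed

text \<open>The space \<open>H1_zero_on\<close> refers to the gradient picked by \<open>weak_grad\<close>; by uniqueness it is the classical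
  one, and the constant sequence is an approximation.\<close>

lemma smooth_H1_zero_on:
  assumes \<Omega>: "open \<Omega>" "bounded \<Omega>" and \<psi>: "smooth_vanishing_near D \<psi>"
  shows "\<psi> \<in> H1_zero_on \<Omega> D" "AE x in lebesgue_on \<Omega>. weak_grad \<Omega> \<psi> x = grad \<psi> x"
    "\<psi> \<in> L2 \<Omega>" "grad \<psi> \<in> L2 \<Omega>"
proof -
  have C1: "Ck_on 1 UNIV \<psi>" using \<psi> by (simp add: smooth_vanishing_near_def smooth_on_def)
  show L2\<psi>: "\<psi> \<in> L2 \<Omega>" by (rule continuous_in_L2[OF \<Omega> Ck_on_continuous[OF C1]])
  show L2g: "grad \<psi> \<in> L2 \<Omega>" by (rule continuous_in_L2[OF \<Omega> continuous_on_grad[OF C1]])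
  have wg: "has_weak_grad \<Omega> \<psi> (grad \<psi>)" by (rule smooth_has_weak_grad[OF \<Omega> C1])
  have H1: "\<psi> \<in> H1 \<Omega>" using L2\<psi> L2g wg by (auto simp: H1_def)
  show AE: "AE x in lebesgue_on \<Omega>. weak_grad \<Omega> \<psi> x = grad \<psi> x"
    by (rule weak_grad_unique[OF \<Omega> weak_grad_props[OF H1] L2g wg])
  have d: "(\<lambda>x. grad \<psi> x - weak_grad \<Omega> \<psi> x) \<in> sqint (lebesgue_on \<Omega>)"
    using L2g weak_grad_props[OF H1] by (intro sqint_diff) (auto simp: L2_eq_sqint)
  have "sq (lebesgue_on \<Omega>) (\<lambda>x. grad \<psi> x - weak_grad \<Omega> \<psi> x) = 0"
    unfolding sq_eq_0_iff[OF d] using AE by eventually_elim simp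
  then have "L2_tendsto \<Omega> (\<lambda>n. grad \<psi>) (weak_grad \<Omega> \<psi>)" by (simp add: L2_tendsto_iff_sq)
  moreover have "L2_tendsto \<Omega> (\<lambda>n. \<psi>) \<psi>" by (simp add: L2_tendsto_def)
  ultimately show "\<psi> \<in> H1_zero_on \<Omega> D" unfolding H1_zero_on_def using H1 \<psi> by auto
qed

section \<open>The mixed eigensystem\<close>

text \<open>Bessel's inequality, scaled so that orthogonal functions of norm zero are allowed: the gradient of
  an eigenfunction with eigenvalue \<open>0\<close> vanishes.\<close>

lemma bessel_orthogonal:
  assumes fin: "finite J" and G: "G \<in> sqint M" and g: "\<And>j. j \<in> J \<Longrightarrow> g j \<in> sqint M"
    and orth: "\<And>i j. i \<in> J \<Longrightarrow> j \<in> J \<Longrightarrow> ip M (g i) (g j) = (if i = j then e j else 0)"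
    and co: "\<And>j. j \<in> J \<Longrightarrow> ip M G (g j) = e j * a j"
  shows "(\<Sum>j\<in>J. e j * (a j)\<^sup>2) \<le> sq M G"
proof -
  define W where "W = (\<lambda>x. \<Sum>j\<in>J. a j *\<^sub>R g j x)"
  have W: "W \<in> sqint M" unfolding W_def by (intro sqint_sum sqint_scale g)
  have ipW: "ip M W h = (\<Sum>j\<in>J. a j * ip M (g j) h)" if h: "h \<in> sqint M" for h
  proof -
    have "ip M W h = (\<Sum>j\<in>J. ip M (\<lambda>x. a j *\<^sub>R g j x) h)"
      unfolding W_def by (intro ip_sum_left sqint_scale g h)
    then show ?thesis by (simp add: ip_scale_left)
  qed
  have WG: "ip M W G = (\<Sum>j\<in>J. e j * (a j)\<^sup>2)"
    unfolding ipW[OF G] by (rule sum.cong) (auto simp: ip_commute[of M "g _"] co power2_eq_square)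
  have "ip M W W = (\<Sum>j\<in>J. e j * (a j)\<^sup>2)"
  proof -
    have "ip M (g j) W = e j * a j" if "j \<in> J" for j
    proof -
      have "ip M W (g j) = (\<Sum>i\<in>J. a i * (if i = j then e j else 0))"
        unfolding ipW[OF g[OF that]] by (rule sum.cong) (auto simp: orth that)
      also have "\<dots> = e j * a j" using fin that by (simp add: if_distrib cong: if_cong)
      finally show ?thesis by (simp only: ip_commute[of M "g j"])
    qed
    then show ?thesis unfolding ipW[OF W] by (intro sum.cong) (auto simp: power2_eq_square)
  qed
  moreover have "0 \<le> sq M (\<lambda>x. G x - W x)" by (rule sq_nonneg)
  ultimately show ?thesis
    unfolding sq_diff_expand[OF G W] using WG by (simp add: ip_commute[of M G] sq_eq_ip[of M W])
qed

locale mixed_eigensystem =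
  fixes \<Omega> D :: "(real^'n) set" and ev :: "nat \<Rightarrow> real" and \<phi> :: "nat \<Rightarrow> real^'n \<Rightarrow> real" and s p :: real
  assumes s: "0 < s" "s < 1" "2 * s < real CARD('n)"
    and dom: "open \<Omega>" "\<Omega> \<noteq> {}" "bounded \<Omega>"
    and eig: "mixed_laplace_eigensystem \<Omega> D ev \<phi>"
    and p_def: "p = crit_exp CARD('n) s"
begin

abbreviation M where "M \<equiv> lebesgue_on \<Omega>"

lemma dom_lmeasurable: "\<Omega> \<in> lmeasurable"
  using dom by (simp add: lmeasurable_open)

sublocale M: finite_measure M
  by (rule finite_measure_lebesgue_on[OF dom_lmeasurable])

lemma eig_H1: "1 \<le> i \<Longrightarrow> \<phi> i \<in> H1_zero_on \<Omega> D"
  and eig_weak: "1 \<le> i \<Longrightarrow> v \<in> H1_zero_on \<Omega> D \<Longrightarrow>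
        ip M (weak_grad \<Omega> (\<phi> i)) (weak_grad \<Omega> v) = ev i * ip M (\<phi> i) v"
  and ev_mono: "1 \<le> i \<Longrightarrow> i \<le> j \<Longrightarrow> ev i \<le> ev j"
  and eig_orth: "1 \<le> i \<Longrightarrow> 1 \<le> j \<Longrightarrow> ip M (\<phi> i) (\<phi> j) = (if i = j then 1 else 0)"
  and eig_complete: "u \<in> sqint M \<Longrightarrow> (\<lambda>n. sq M (\<lambda>x. (\<Sum>j=1..n. ip M u (\<phi> j) * \<phi> j x) - u x)) \<longlonglongrightarrow> 0"
  using eig unfolding mixed_laplace_eigensystem_def mixed_laplace_solution_def
  by (auto simp: L2_inner_eq_ip L2_tendsto_iff_sq L2_eq_sqint)

lemma H1_zero_on_H1: "u \<in> H1_zero_on \<Omega> D \<Longrightarrow> u \<in> H1 \<Omega>"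
  by (simp add: H1_zero_on_def)

lemma H1_sqint: "u \<in> H1 \<Omega> \<Longrightarrow> u \<in> sqint M"
  by (simp add: H1_def L2_eq_sqint)

lemma weak_grad_sqint: "u \<in> H1 \<Omega> \<Longrightarrow> weak_grad \<Omega> u \<in> sqint M"
  using weak_grad_props(1) by (simp add: L2_eq_sqint)

lemma eig_sqint: "1 \<le> i \<Longrightarrow> \<phi> i \<in> sqint M"
  by (intro H1_sqint H1_zero_on_H1 eig_H1)

lemma eig_grad_sqint: "1 \<le> i \<Longrightarrow> weak_grad \<Omega> (\<phi> i) \<in> sqint M"
  by (intro weak_grad_sqint H1_zero_on_H1 eig_H1)

lemma ev_nonneg: "1 \<le> i \<Longrightarrow> 0 \<le> ev i"
  using eig_weak[of i "\<phi> i"] eig_H1[of i] eig_orth[of i i] sq_nonneg[of M "weak_grad \<Omega> (\<phi> i)"]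
  by (simp add: sq_eq_ip)

lemma powr_le_1_plus: "0 \<le> t \<Longrightarrow> t powr s \<le> 1 + t"
proof (cases "t \<le> 1")
  case True
  assume "0 \<le> t"
  then have "t powr s \<le> 1" using True s by (intro powr_le1) auto
  then show ?thesis using \<open>0 \<le> t\<close> by simp
next
  case False
  then have "t powr s \<le> t powr 1" using s by (intro powr_mono) auto
  then show ?thesis using False by simp
qed

text \<open>As \<open>t\<^sup>s \<le> 1 + t\<close>, the energy is controlled by the sums of the squared coefficients with weights \<open>1\<close> and
  \<open>ev j\<close>. Bessel's inequality for the eigenfunctions and for their gradients bounds these sums.\<close>

lemma energy_le_H1_norm:
  assumes U: "U \<in> sqint M" and G: "G \<in> sqint M"
    and coeff: "\<And>j. 1 \<le> j \<Longrightarrow> ip M G (weak_grad \<Omega> (\<phi> j)) = ev j * ip M U (\<phi> j)"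
  shows "finite_energy \<Omega> ev \<phi> s U" "energy_norm_sq \<Omega> ev \<phi> s U \<le> sq M U + sq M G"
proof -
  define a where "a j = ip M U (\<phi> j)" for j
  have bound: "(\<Sum>j\<in>F. (a j)\<^sup>2 * ev j powr s) \<le> sq M U + sq M G" if F: "finite F" "F \<subseteq> {1..}" for F
  proof -
    have "(\<Sum>j\<in>F. (a j)\<^sup>2 * ev j powr s) \<le> (\<Sum>j\<in>F. 1 * (a j)\<^sup>2 + ev j * (a j)\<^sup>2)"
    proof (rule sum_mono)
      fix j assume "j \<in> F"
      then have "1 \<le> j" using F by auto
      from mult_left_mono[OF powr_le_1_plus[OF ev_nonneg[OF this]], of "(a j)\<^sup>2"]
      show "(a j)\<^sup>2 * ev j powr s \<le> 1 * (a j)\<^sup>2 + ev j * (a j)\<^sup>2" by (simp add: algebra_simps)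
    qed
    also have "\<dots> = (\<Sum>j\<in>F. 1 * (a j)\<^sup>2) + (\<Sum>j\<in>F. ev j * (a j)\<^sup>2)" by (rule sum.distrib)
    also have "(\<Sum>j\<in>F. 1 * (a j)\<^sup>2) \<le> sq M U"
    proof (rule bessel_orthogonal[OF F(1) U, of \<phi>])
      fix i j assume ij: "i \<in> F" "j \<in> F"
      then have "1 \<le> i" "1 \<le> j" using F by auto
      then show "ip M (\<phi> i) (\<phi> j) = (if i = j then 1 else 0)" by (rule eig_orth)
    qed (use F in \<open>auto simp: a_def intro!: eig_sqint\<close>)
    also have "(\<Sum>j\<in>F. ev j * (a j)\<^sup>2) \<le> sq M G"
    proof (rule bessel_orthogonal[OF F(1) G, of "\<lambda>j. weak_grad \<Omega> (\<phi> j)"])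
      fix i j assume "i \<in> F" "j \<in> F"
      then have ij: "1 \<le> i" "1 \<le> j" using F by auto
      show "ip M (weak_grad \<Omega> (\<phi> i)) (weak_grad \<Omega> (\<phi> j)) = (if i = j then ev j else 0)"
        unfolding eig_weak[OF ij(1) eig_H1[OF ij(2)]] eig_orth[OF ij] by simp
    next
      fix j assume "j \<in> F"
      then have "1 \<le> j" using F by auto
      then show "weak_grad \<Omega> (\<phi> j) \<in> sqint M" "ip M G (weak_grad \<Omega> (\<phi> j)) = ev j * a j"
        unfolding a_def by (rule eig_grad_sqint, rule coeff)
    qed
    finally show ?thesis by simp
  qed
  have summ: "(\<lambda>j. (a j)\<^sup>2 * ev j powr s) summable_on {1..}"
    using bound by (intro nonneg_bdd_above_summable_on) (auto intro!: bdd_aboveI2[where M = "sq M U + sq M G"])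
  show "finite_energy \<Omega> ev \<phi> s U"
    unfolding finite_energy_def L2_inner_eq_ip L2_eq_sqint using U summ by (simp add: a_def)
  show "energy_norm_sq \<Omega> ev \<phi> s U \<le> sq M U + sq M G"
    unfolding energy_norm_sq_def L2_inner_eq_ip a_def[symmetric]
    by (rule infsum_le_finite_sums[OF summ bound])
qed

lemma energy_norm_nonneg: "0 \<le> energy_norm_sq \<Omega> ev \<phi> s u"
  unfolding energy_norm_sq_def by (rule infsum_nonneg) simp

lemma smooth_finite_energy:
  assumes "smooth_vanishing_near D \<psi>" shows "finite_energy \<Omega> ev \<phi> s \<psi>"
proof -
  note \<psi> = smooth_H1_zero_on[OF dom(1,3) assms]
  show ?thesis
  proof (rule energy_le_H1_norm(1))
    show "\<psi> \<in> sqint M" "weak_grad \<Omega> \<psi> \<in> sqint M"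
      using \<psi> by (auto intro!: H1_sqint weak_grad_sqint H1_zero_on_H1)
    show "ip M (weak_grad \<Omega> \<psi>) (weak_grad \<Omega> (\<phi> j)) = ev j * ip M \<psi> (\<phi> j)" if "1 \<le> j" for j
      using eig_weak[OF that \<psi>(1)] by (simp only: ip_commute[of M \<psi>] ip_commute[of M "weak_grad \<Omega> \<psi>"])
  qed
qed

text \<open>The Bessel inequality for the gradients of the eigenfunctions bounds the energy by the
  norm of \<open>H1 \<Omega>\<close>, so that approximations in \<open>H1 \<Omega>\<close> are approximations in energy.\<close>

lemma H1_zero_on_subset_Hs:
  assumes u: "u \<in> H1_zero_on \<Omega> D" shows "u \<in> Hs \<Omega> D ev \<phi> s"
proof -
  have H1u: "u \<in> H1 \<Omega>" by (rule H1_zero_on_H1[OF u])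
  obtain \<psi> where \<psi>: "\<And>n. smooth_vanishing_near D (\<psi> n)" and lim: "L2_tendsto \<Omega> \<psi> u"
    and glim: "L2_tendsto \<Omega> (\<lambda>n. grad (\<psi> n)) (weak_grad \<Omega> u)"
    using u unfolding H1_zero_on_def by blast
  note P = smooth_H1_zero_on[OF dom(1,3) \<psi>]
  have sqs: "u \<in> sqint M" "weak_grad \<Omega> u \<in> sqint M" "\<psi> n \<in> sqint M" "weak_grad \<Omega> (\<psi> n) \<in> sqint M"
    "grad (\<psi> n) \<in> sqint M" for n
    by (rule H1_sqint[OF H1u] weak_grad_sqint[OF H1u] P(3)[unfolded L2_eq_sqint]
        weak_grad_sqint[OF H1_zero_on_H1[OF P(1)]] P(4)[unfolded L2_eq_sqint])+
  have coeff: "ip M (weak_grad \<Omega> v) (weak_grad \<Omega> (\<phi> j)) = ev j * ip M v (\<phi> j)"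
    if "1 \<le> j" "v \<in> H1_zero_on \<Omega> D" for j v
    using eig_weak[OF that] by (simp only: ip_commute[of M v] ip_commute[of M "weak_grad \<Omega> v"])
  have geq: "sq M (\<lambda>x. weak_grad \<Omega> (\<psi> n) x - weak_grad \<Omega> u x) = sq M (\<lambda>x. grad (\<psi> n) x - weak_grad \<Omega> u x)" for n
    unfolding sq_def
  proof (rule integral_cong_AE)
    show "AE x in M. (norm (weak_grad \<Omega> (\<psi> n) x - weak_grad \<Omega> u x))\<^sup>2 = (norm (grad (\<psi> n) x - weak_grad \<Omega> u x))\<^sup>2"
      using P(2)[of n] by eventually_elim simp
  qed (use sqs[THEN sqintD] in measurable)
  have bound: "energy_norm_sq \<Omega> ev \<phi> s (\<lambda>x. \<psi> n x - u x) \<le> sq M (\<lambda>x. \<psi> n x - u x) + sq M (\<lambda>x. grad (\<psi> n) x - weak_grad \<Omega> u x)" for n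
    unfolding geq[symmetric]
  proof (rule energy_le_H1_norm(2))
    show "(\<lambda>x. \<psi> n x - u x) \<in> sqint M" "(\<lambda>x. weak_grad \<Omega> (\<psi> n) x - weak_grad \<Omega> u x) \<in> sqint M"
      by (intro sqint_diff sqs)+
    fix j :: nat assume j: "1 \<le> j"
    show "ip M (\<lambda>x. weak_grad \<Omega> (\<psi> n) x - weak_grad \<Omega> u x) (weak_grad \<Omega> (\<phi> j)) = ev j * ip M (\<lambda>x. \<psi> n x - u x) (\<phi> j)"
      unfolding ip_diff_left[OF sqs(3,1) eig_sqint[OF j]] ip_diff_left[OF sqs(4,2) eig_grad_sqint[OF j]]
        coeff[OF j P(1)] coeff[OF j u] by (simp add: right_diff_distrib)
  qed
  have fin: "finite_energy \<Omega> ev \<phi> s u"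
    by (rule energy_le_H1_norm(1)[OF sqs(1,2)]) (rule coeff[OF _ u])
  have "(\<lambda>n. sq M (\<lambda>x. \<psi> n x - u x) + sq M (\<lambda>x. grad (\<psi> n) x - weak_grad \<Omega> u x)) \<longlonglongrightarrow> 0 + 0"
    using lim glim unfolding L2_tendsto_iff_sq by (rule tendsto_add)
  then have lim0: "(\<lambda>n. sq M (\<lambda>x. \<psi> n x - u x) + sq M (\<lambda>x. grad (\<psi> n) x - weak_grad \<Omega> u x)) \<longlonglongrightarrow> 0" by simp
  have "(\<lambda>n. energy_norm_sq \<Omega> ev \<phi> s (\<lambda>x. \<psi> n x - u x)) \<longlonglongrightarrow> 0"
    by (rule Lim_null_comparison[OF always_eventually lim0])
      (intro allI, unfold real_norm_def abs_of_nonneg[OF energy_norm_nonneg], rule bound)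
  then show ?thesis unfolding Hs_def using fin \<psi> lim smooth_finite_energy by blast
qed

lemma eig_Hs: "1 \<le> i \<Longrightarrow> \<phi> i \<in> Hs \<Omega> D ev \<phi> s"
  by (intro H1_zero_on_subset_Hs eig_H1)

lemma eig_nonzero: "1 \<le> i \<Longrightarrow> \<not> (AE x in M. \<phi> i x = 0)"
  using eig_orth[of i i] sq_eq_0_iff[OF eig_sqint, of i] by (simp add: sq_eq_ip)

lemma energy_norm_eig: "1 \<le> i \<Longrightarrow> energy_norm_sq \<Omega> ev \<phi> s (\<phi> i) = ev i powr s"
proof -
  assume i: "1 \<le> i"
  have "energy_norm_sq \<Omega> ev \<phi> s (\<phi> i) = (\<Sum>\<^sub>\<infinity>j\<in>{i}. (L2_inner \<Omega> (\<phi> i) (\<phi> j))\<^sup>2 * ev j powr s)"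
    unfolding energy_norm_sq_def by (rule infsum_cong_neutral) (use i in \<open>auto simp: L2_inner_eq_ip eig_orth\<close>)
  then show ?thesis using i by (simp add: L2_inner_eq_ip eig_orth)
qed

abbreviation quotients :: "real set" where
  "quotients \<equiv> {energy_norm_sq \<Omega> ev \<phi> s u / ((LINT x|M. \<bar>u x\<bar> powr p) powr (1 / p))\<^sup>2 |
      u. u \<in> Hs \<Omega> D ev \<phi> s \<and> \<not> (AE x in M. u x = 0)}"

lemma p_gt_2: "2 < p"
  using s by (simp add: p_def crit_exp_def pos_less_divide_eq)

lemma quotients_bdd_below: "bdd_below quotients"
  by (rule bdd_belowI[of _ 0]) (auto intro!: divide_nonneg_nonneg energy_norm_nonneg)

lemma sobolev_const_nonneg: "0 \<le> sobolev_const \<Omega> D ev \<phi> s"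
  unfolding sobolev_const_def p_def[symmetric]
proof (rule cInf_greatest)
  show "quotients \<noteq> {}" using eig_Hs[of 1] eig_nonzero[of 1] by auto
qed (auto intro!: divide_nonneg_nonneg energy_norm_nonneg)

lemma sobolev_const_le:
  assumes "u \<in> Hs \<Omega> D ev \<phi> s" "\<not> (AE x in M. u x = 0)"
  shows "sobolev_const \<Omega> D ev \<phi> s \<le> energy_norm_sq \<Omega> ev \<phi> s u / (Lp_norm M p u)\<^sup>2"
  unfolding sobolev_const_def p_def[symmetric] Lp_norm_def Lp_int_def
  by (rule cInf_lower[OF _ quotients_bdd_below]) (use assms in blast)

end


lemma atLeast_1_eq_image_Suc: "{1..} = range Suc"
  by (auto simp: image_iff) (metis Suc_le_D)

lemma summable_on_Suc_iff:
  fixes f :: "nat \<Rightarrow> real"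
  assumes "\<And>j. 0 \<le> f j"
  shows "f summable_on {1..} \<longleftrightarrow> summable (\<lambda>j. f (Suc j))"
  unfolding atLeast_1_eq_image_Suc using assms
  by (simp add: summable_on_reindex o_def summable_on_UNIV_nonneg_real_iff)

lemma infsum_Suc_eq:
  fixes f :: "nat \<Rightarrow> real"
  assumes "f summable_on {1..}"
  shows "infsum f {1..} = (\<Sum>j. f (Suc j))"
proof -
  have 1: "infsum f {1..} = infsum (\<lambda>j. f (Suc j)) UNIV"
    unfolding atLeast_1_eq_image_Suc by (subst infsum_reindex) (auto simp: o_def)
  have "(\<lambda>j. f (Suc j)) summable_on UNIV"
    using assms unfolding atLeast_1_eq_image_Suc by (simp add: summable_on_reindex o_def)
  then have "(\<lambda>j. f (Suc j)) sums infsum (\<lambda>j. f (Suc j)) UNIV"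
    by (intro has_sum_imp_sums) simp
  then show ?thesis unfolding 1 by (rule sums_unique)
qed

locale positive_sobolev_const = mixed_eigensystem \<Omega> D ev \<phi> s p
  for \<Omega> D :: "(real^'n) set" and ev :: "nat \<Rightarrow> real" and \<phi> :: "nat \<Rightarrow> real^'n \<Rightarrow> real" and s p :: real +
  assumes sobolev_pos: "0 < sobolev_const \<Omega> D ev \<phi> s"
begin

text \<open>An eigenfunction with eigenvalue \<open>0\<close> would have energy zero and make the Sobolev constant vanish.\<close>

lemma ev_pos: assumes "1 \<le> i" shows "0 < ev i"
proof -
  have "ev 1 \<noteq> 0"
  proof
    assume "ev 1 = 0"
    then have "energy_norm_sq \<Omega> ev \<phi> s (\<phi> 1) = 0" using energy_norm_eig[of 1] by simp
    then show False using sobolev_const_le[OF eig_Hs eig_nonzero, of 1] sobolev_pos by simp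
  qed
  then have "0 < ev 1" using ev_nonneg[of 1] by simp
  then show ?thesis using ev_mono[of 1 i] assms by simp
qed

sublocale B: sobolev_basis M "\<lambda>j. \<phi> (Suc j)" "\<lambda>j. ev (Suc j) powr s"
proof
  show "\<phi> (Suc j) \<in> sqint M" for j by (rule eig_sqint) simp
  show "ip M (\<phi> (Suc i)) (\<phi> (Suc j)) = (if i = j then 1 else 0)" for i j by (simp add: eig_orth)
  show "(\<lambda>n. sq M (\<lambda>x. (\<Sum>j<n. ip M u (\<phi> (Suc j)) * \<phi> (Suc j) x) - u x)) \<longlonglongrightarrow> 0" if "u \<in> sqint M" for u
    using eig_complete[OF that] by (simp only: One_nat_def sum.atLeast1_atMost_eq)
  show "ev (Suc i) powr s \<le> ev (Suc j) powr s" if "i \<le> j" for i j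
    using ev_mono[of "Suc i" "Suc j"] ev_nonneg[of "Suc i"] that s by (intro powr_mono2) auto
  show "0 < ev (Suc j) powr s" for j using ev_pos[of "Suc j"] by simp
qed

lemma FE_iff: "B.FE u \<longleftrightarrow> finite_energy \<Omega> ev \<phi> s u"
  unfolding B.FE_def B.co_def finite_energy_def L2_eq_sqint L2_inner_eq_ip
  by (subst summable_on_Suc_iff) (simp_all add: mult.commute)

lemma energy_norm_eq: assumes "B.FE u" shows "energy_norm_sq \<Omega> ev \<phi> s u = B.E u"
proof -
  have "(\<lambda>j. (ip M u (\<phi> j))\<^sup>2 * ev j powr s) summable_on {1..}"
    using assms unfolding FE_iff finite_energy_def L2_inner_eq_ip by simp
  then show ?thesis
    unfolding energy_norm_sq_def L2_inner_eq_ip B.D_def B.co_def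
    by (subst infsum_Suc_eq) (simp_all add: mult.commute power2_eq_square)
qed

text \<open>Approximability holds for the eigenfunctions by \<open>H1_zero_on_subset_Hs\<close> and passes to their linear
  span and to limits, hence to every function of finite energy.\<close>

definition smoothly_approximable :: "(real^'n \<Rightarrow> real) \<Rightarrow> bool" where
  "smoothly_approximable w \<longleftrightarrow> B.FE w \<and>
     (\<forall>e>0. \<exists>\<psi>. smooth_vanishing_near D \<psi> \<and> B.E (\<lambda>x. \<psi> x - w x) < e)"

lemma smooth_FE: "smooth_vanishing_near D \<psi> \<Longrightarrow> B.FE \<psi>"
  unfolding FE_iff by (rule smooth_finite_energy)

lemma smooth_vanishing_near_add:
  assumes f: "smooth_vanishing_near D f" and g: "smooth_vanishing_near D g"
  shows "smooth_vanishing_near D (\<lambda>x. f x + g x)"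
proof -
  let ?F = "closure {x. f x \<noteq> 0}" and ?G = "closure {x. g x \<noteq> 0}"
  have fg: "compact (?F \<union> ?G)" "(?F \<union> ?G) \<inter> D = {}"
    using f g by (auto simp: smooth_vanishing_near_def)
  have "{x. f x + g x \<noteq> 0} \<subseteq> {x. f x \<noteq> 0} \<union> {x. g x \<noteq> 0}" by auto
  then have sub: "closure {x. f x + g x \<noteq> 0} \<subseteq> ?F \<union> ?G" unfolding closure_Un[symmetric] by (rule closure_mono)
  have "compact ((?F \<union> ?G) \<inter> closure {x. f x + g x \<noteq> 0})" by (rule compact_Int_closed[OF fg(1) closed_closure])
  then have "compact (closure {x. f x + g x \<noteq> 0})" unfolding Int_absorb1[OF sub] .
  moreover have "smooth_on UNIV (\<lambda>x. f x + g x)"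
    using f g by (simp add: smooth_vanishing_near_def smooth_on_def Ck_on_add)
  ultimately show ?thesis unfolding smooth_vanishing_near_def using sub fg(2) by blast
qed

lemma smooth_vanishing_near_cmult:
  assumes f: "smooth_vanishing_near D f" shows "smooth_vanishing_near D (\<lambda>x. c * f x)"
proof -
  let ?F = "closure {x. f x \<noteq> 0}"
  have sub: "closure {x. c * f x \<noteq> 0} \<subseteq> ?F" by (rule closure_mono) auto
  have "compact (?F \<inter> closure {x. c * f x \<noteq> 0})"
    using f by (intro compact_Int_closed closed_closure) (simp add: smooth_vanishing_near_def)
  then have "compact (closure {x. c * f x \<noteq> 0})" unfolding Int_absorb1[OF sub] .
  moreover have "smooth_on UNIV (\<lambda>x. c * f x)"
    using f by (simp add: smooth_vanishing_near_def smooth_on_def Ck_on_mult Ck_on_const)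
  ultimately show ?thesis using sub f unfolding smooth_vanishing_near_def by blast
qed

lemma smoothly_approximable_basis: "smoothly_approximable (\<phi> (Suc i))"
proof -
  have H: "\<phi> (Suc i) \<in> Hs \<Omega> D ev \<phi> s" by (rule eig_Hs) simp
  then obtain \<psi> where \<psi>: "\<And>n. smooth_vanishing_near D (\<psi> n)"
    and lim: "(\<lambda>n. energy_norm_sq \<Omega> ev \<phi> s (\<lambda>x. \<psi> n x - \<phi> (Suc i) x)) \<longlonglongrightarrow> 0"
    unfolding Hs_def by blast
  have FE: "B.FE (\<phi> (Suc i))" using H unfolding Hs_def FE_iff by simp
  have eq: "energy_norm_sq \<Omega> ev \<phi> s (\<lambda>x. \<psi> n x - \<phi> (Suc i) x) = B.E (\<lambda>x. \<psi> n x - \<phi> (Suc i) x)" for n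
    by (intro energy_norm_eq B.FE_diff smooth_FE \<psi> FE)
  show ?thesis
    unfolding smoothly_approximable_def
  proof (intro conjI FE allI impI)
    fix e :: real assume "0 < e"
    then obtain n where "energy_norm_sq \<Omega> ev \<phi> s (\<lambda>x. \<psi> n x - \<phi> (Suc i) x) < e"
      using order_tendstoD(2)[OF lim] by (auto simp: eventually_sequentially)
    then show "\<exists>\<psi>. smooth_vanishing_near D \<psi> \<and> B.E (\<lambda>x. \<psi> x - \<phi> (Suc i) x) < e"
      unfolding eq using \<psi> by blast
  qed
qed

lemma smoothly_approximable_limit:
  assumes u: "B.FE u" and approx: "\<And>e. 0 < e \<Longrightarrow> \<exists>w. smoothly_approximable w \<and> B.E (\<lambda>x. w x - u x) < e"
  shows "smoothly_approximable u"
  unfolding smoothly_approximable_def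
proof (intro conjI u allI impI)
  fix e :: real assume "0 < e"
  then have e: "0 < e / 4" by simp
  obtain w where w: "smoothly_approximable w" "B.E (\<lambda>x. w x - u x) < e / 4" using approx[OF e] by blast
  then have FEw: "B.FE w" by (simp add: smoothly_approximable_def)
  obtain \<psi> where \<psi>: "smooth_vanishing_near D \<psi>" "B.E (\<lambda>x. \<psi> x - w x) < e / 4"
    using w(1) e unfolding smoothly_approximable_def by blast
  have eq: "(\<lambda>x. \<psi> x - u x) = (\<lambda>x. (\<psi> x - w x) + (w x - u x))" by (rule ext) simp
  have "B.E (\<lambda>x. \<psi> x - u x) \<le> 2 * B.E (\<lambda>x. \<psi> x - w x) + 2 * B.E (\<lambda>x. w x - u x)"
    unfolding eq by (intro B.E_add_le B.FE_diff smooth_FE \<psi> FEw u)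
  also have "\<dots> < e" using w(2) \<psi>(2) by simp
  finally show "\<exists>\<psi>. smooth_vanishing_near D \<psi> \<and> B.E (\<lambda>x. \<psi> x - u x) < e" using \<psi>(1) by blast
qed

lemma smoothly_approximable_add:
  assumes v: "smoothly_approximable v" and w: "smoothly_approximable w"
  shows "smoothly_approximable (\<lambda>x. v x + w x)"
  unfolding smoothly_approximable_def
proof (intro conjI allI impI)
  have FE: "B.FE v" "B.FE w" using v w by (auto simp: smoothly_approximable_def)
  then show "B.FE (\<lambda>x. v x + w x)" by (rule B.FE_add)
  fix e :: real assume "0 < e"
  then have e: "0 < e / 4" by simp
  obtain f where f: "smooth_vanishing_near D f" "B.E (\<lambda>x. f x - v x) < e / 4"
    using v e unfolding smoothly_approximable_def by blast
  obtain g where g: "smooth_vanishing_near D g" "B.E (\<lambda>x. g x - w x) < e / 4"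
    using w e unfolding smoothly_approximable_def by blast
  have eq: "(\<lambda>x. f x + g x - (v x + w x)) = (\<lambda>x. (f x - v x) + (g x - w x))" by (rule ext) simp
  have "B.E (\<lambda>x. f x + g x - (v x + w x)) \<le> 2 * B.E (\<lambda>x. f x - v x) + 2 * B.E (\<lambda>x. g x - w x)"
    unfolding eq by (intro B.E_add_le B.FE_diff smooth_FE f g FE)
  also have "\<dots> < e" using f(2) g(2) by simp
  finally show "\<exists>\<psi>. smooth_vanishing_near D \<psi> \<and> B.E (\<lambda>x. \<psi> x - (v x + w x)) < e"
    using smooth_vanishing_near_add[OF f(1) g(1)] by blast
qed

lemma smoothly_approximable_cmult:
  assumes v: "smoothly_approximable v" shows "smoothly_approximable (\<lambda>x. c * v x)"
  unfolding smoothly_approximable_def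
proof (intro conjI allI impI)
  have FE: "B.FE v" using v by (auto simp: smoothly_approximable_def)
  then show "B.FE (\<lambda>x. c * v x)" by (rule B.FE_cmult)
  fix e :: real assume e: "0 < e"
  have "0 < e / (c\<^sup>2 + 1)" using e by (simp add: add_nonneg_pos)
  then obtain f where f: "smooth_vanishing_near D f" "B.E (\<lambda>x. f x - v x) < e / (c\<^sup>2 + 1)"
    using v unfolding smoothly_approximable_def by blast
  have d: "B.FE (\<lambda>x. f x - v x)" by (intro B.FE_diff smooth_FE f FE)
  have eq: "(\<lambda>x. c * f x - c * v x) = (\<lambda>x. c * (f x - v x))" by (rule ext) (simp add: right_diff_distrib)
  have "B.E (\<lambda>x. c * f x - c * v x) = c\<^sup>2 * B.E (\<lambda>x. f x - v x)" unfolding eq by (rule B.E_cmult[OF d])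
  also have "\<dots> \<le> (c\<^sup>2 + 1) * B.E (\<lambda>x. f x - v x)" using B.E_nonneg[OF d] by (intro mult_right_mono) auto
  also have "\<dots> < e" using f(2) by (simp add: pos_less_divide_eq add_nonneg_pos mult.commute)
  finally show "\<exists>\<psi>. smooth_vanishing_near D \<psi> \<and> B.E (\<lambda>x. \<psi> x - c * v x) < e"
    using smooth_vanishing_near_cmult[OF f(1)] by blast
qed

lemma smoothly_approximable_expand: "smoothly_approximable (B.expand n a)"
proof (induction n)
  case 0
  have "B.expand 0 a = (\<lambda>x. 0 * \<phi> (Suc 0) x)" by (rule ext) (simp add: B.expand_def)
  then show ?case using smoothly_approximable_cmult[OF smoothly_approximable_basis[of 0], of 0] by simp
next
  case (Suc n)
  have "B.expand (Suc n) a = (\<lambda>x. B.expand n a x + a n * \<phi> (Suc n) x)" by (rule ext) (simp add: B.expand_def)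
  then show ?case
    using smoothly_approximable_add[OF Suc smoothly_approximable_cmult[OF smoothly_approximable_basis]] by simp
qed

lemma FE_smoothly_approximable: assumes u: "B.FE u" shows "smoothly_approximable u"
proof (rule smoothly_approximable_limit[OF u])
  fix e :: real assume "0 < e"
  then obtain n where n: "B.E (\<lambda>x. u x - B.expand n (B.co u) x) < e"
    using order_tendstoD(2)[OF B.E_tail[OF u]] by (auto simp: eventually_sequentially)
  have d: "B.FE (\<lambda>x. u x - B.expand n (B.co u) x)" by (intro B.FE_diff u B.FE_expand)
  have eq: "(\<lambda>x. B.expand n (B.co u) x - u x) = (\<lambda>x. (-1) * (u x - B.expand n (B.co u) x))" by (rule ext) simp
  have "B.E (\<lambda>x. B.expand n (B.co u) x - u x) < e" unfolding eq B.E_cmult[OF d] using n by simp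
  then show "\<exists>w. smoothly_approximable w \<and> B.E (\<lambda>x. w x - u x) < e"
    using smoothly_approximable_expand by blast
qed

lemma Hs_iff: "u \<in> Hs \<Omega> D ev \<phi> s \<longleftrightarrow> B.FE u"
proof
  show "u \<in> Hs \<Omega> D ev \<phi> s \<Longrightarrow> B.FE u" by (simp add: Hs_def FE_iff)
  assume u: "B.FE u"
  have "\<exists>\<psi>. smooth_vanishing_near D \<psi> \<and> B.E (\<lambda>x. \<psi> x - u x) < inverse (real (Suc n))" for n
    using FE_smoothly_approximable[OF u] unfolding smoothly_approximable_def by simp
  then obtain \<psi> where \<psi>: "\<And>n. smooth_vanishing_near D (\<psi> n)"
    and le: "\<And>n. B.E (\<lambda>x. \<psi> n x - u x) < inverse (real (Suc n))" by metis
  have d: "B.FE (\<lambda>x. \<psi> n x - u x)" for n by (intro B.FE_diff smooth_FE \<psi> u)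
  have lim: "(\<lambda>n. B.E (\<lambda>x. \<psi> n x - u x)) \<longlonglongrightarrow> 0"
  proof (rule Lim_null_comparison[OF always_eventually LIMSEQ_inverse_real_of_nat], rule allI)
    show "norm (B.E (\<lambda>x. \<psi> n x - u x)) \<le> inverse (real (Suc n))" for n
      unfolding real_norm_def abs_of_nonneg[OF B.E_nonneg[OF d]] by (rule less_imp_le[OF le])
  qed
  have L0: "0 < ev (Suc 0) powr s" using ev_pos[of "Suc 0"] by simp
  have lim0: "(\<lambda>n. B.E (\<lambda>x. \<psi> n x - u x) / ev (Suc 0) powr s) \<longlonglongrightarrow> 0"
    using tendsto_divide[OF lim tendsto_const, of "ev (Suc 0) powr s"] L0 by simp
  have "(\<lambda>n. sq M (\<lambda>x. \<psi> n x - u x)) \<longlonglongrightarrow> 0"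
  proof (rule Lim_null_comparison[OF always_eventually lim0], rule allI)
    show "norm (sq M (\<lambda>x. \<psi> n x - u x)) \<le> B.E (\<lambda>x. \<psi> n x - u x) / ev (Suc 0) powr s" for n
      using B.sq_le_E[OF d[of n]] L0 unfolding real_norm_def abs_of_nonneg[OF sq_nonneg]
      by (simp add: pos_le_divide_eq mult.commute)
  qed
  then have L2: "L2_tendsto \<Omega> \<psi> u" by (simp only: L2_tendsto_iff_sq)
  have en: "(\<lambda>n. energy_norm_sq \<Omega> ev \<phi> s (\<lambda>x. \<psi> n x - u x)) \<longlonglongrightarrow> 0"
    unfolding energy_norm_eq[OF d] by (rule lim)
  show "u \<in> Hs \<Omega> D ev \<phi> s"
    unfolding Hs_def using u[unfolded FE_iff] \<psi> smooth_finite_energy[OF \<psi>] L2 en by blast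
qed

text \<open>The coefficients determine the function up to null sets, so that the choice in the definition of
  \<open>frac_laplacian\<close> only has to be possible, which is the Riesz-Fischer theorem.\<close>

lemma frac_laplacian_half:
  assumes u: "B.FE u"
  shows "frac_laplacian \<Omega> ev \<phi> (s / 2) u \<in> sqint M"
    "B.co (frac_laplacian \<Omega> ev \<phi> (s / 2) u) j = ev (Suc j) powr (s / 2) * B.co u j"
proof -
  define a where "a j = ev (Suc j) powr (s / 2) * B.co u j" for j
  have "(ev (Suc j) powr (s / 2))\<^sup>2 = ev (Suc j) powr s" for j
    unfolding power2_eq_square powr_add[symmetric] by simp
  then have "(a j)\<^sup>2 = ev (Suc j) powr s * (B.co u j)\<^sup>2" for j
    unfolding a_def power_mult_distrib by simp
  then have "summable (\<lambda>j. (a j)\<^sup>2)" using u by (simp add: B.FE_def)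
  then obtain w where w: "w \<in> sqint M" "\<And>j. B.co w j = a j" using B.riesz_fischer by blast
  have eq: "(\<lambda>n x. \<Sum>j=1..n. ev j powr (s / 2) * L2_inner \<Omega> u (\<phi> j) * \<phi> j x) = (\<lambda>n. B.expand n a)"
    by (intro ext) (simp add: sum.atLeast1_atMost_eq B.expand_def a_def B.co_def L2_inner_eq_ip)
  have "(\<lambda>n. sq M (\<lambda>x. B.expand n a x - w x)) \<longlonglongrightarrow> 0"
    using B.complete[OF w(1)] w(2) by (simp add: B.expand_def B.co_def)
  then have ex: "\<exists>w. w \<in> sqint M \<and> (\<lambda>n. sq M (\<lambda>x. B.expand n a x - w x)) \<longlonglongrightarrow> 0"
    using w(1) by blast
  have "frac_laplacian \<Omega> ev \<phi> (s / 2) u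
      = (SOME w. w \<in> sqint M \<and> (\<lambda>n. sq M (\<lambda>x. B.expand n a x - w x)) \<longlonglongrightarrow> 0)"
    unfolding frac_laplacian_def eq L2_tendsto_iff_sq L2_eq_sqint ..
  with someI_ex[OF ex] have z: "frac_laplacian \<Omega> ev \<phi> (s / 2) u \<in> sqint M"
    and lim: "(\<lambda>n. sq M (\<lambda>x. B.expand n a x - frac_laplacian \<Omega> ev \<phi> (s / 2) u x)) \<longlonglongrightarrow> 0"
    by simp_all
  show "frac_laplacian \<Omega> ev \<phi> (s / 2) u \<in> sqint M" by (rule z)
  have "(\<lambda>n::nat. sq M (\<lambda>x. \<phi> (Suc j) x - \<phi> (Suc j) x)) \<longlonglongrightarrow> 0" by (simp add: sq_def)
  from ip_tendsto[OF B.expand_sqint z lim B.basis_sqint B.basis_sqint this]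
  have "(\<lambda>n. B.co (B.expand n a) j) \<longlonglongrightarrow> B.co (frac_laplacian \<Omega> ev \<phi> (s / 2) u) j"
    unfolding B.co_def .
  moreover have "(\<lambda>n. B.co (B.expand n a) j) \<longlonglongrightarrow> a j"
    by (rule tendsto_eventually) (auto simp: B.co_expand eventually_sequentially intro!: exI[of _ "Suc j"])
  ultimately show "B.co (frac_laplacian \<Omega> ev \<phi> (s / 2) u) j = ev (Suc j) powr (s / 2) * B.co u j"
    unfolding a_def by (rule LIMSEQ_unique)
qed

text \<open>Parseval's identity turns the integral into the sum with weights \<open>ev j\<^sup>s\<^sup>/\<^sup>2 * ev j\<^sup>s\<^sup>/\<^sup>2\<close>.\<close>

lemma integral_frac_laplacians:
  assumes u: "B.FE u" and v: "B.FE v"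
  shows "(LINT x|M. frac_laplacian \<Omega> ev \<phi> (s / 2) u x * frac_laplacian \<Omega> ev \<phi> (s / 2) v x) = B.D u v"
proof -
  have "(\<lambda>j. B.co (frac_laplacian \<Omega> ev \<phi> (s / 2) u) j * B.co (frac_laplacian \<Omega> ev \<phi> (s / 2) v) j)
      sums ip M (frac_laplacian \<Omega> ev \<phi> (s / 2) u) (frac_laplacian \<Omega> ev \<phi> (s / 2) v)"
    by (rule B.parseval[OF frac_laplacian_half(1)[OF u] frac_laplacian_half(1)[OF v]])
  moreover have "B.co (frac_laplacian \<Omega> ev \<phi> (s / 2) u) j * B.co (frac_laplacian \<Omega> ev \<phi> (s / 2) v) j
      = ev (Suc j) powr s * (B.co u j * B.co v j)" for j
  proof -
    have "ev (Suc j) powr (s / 2) * ev (Suc j) powr (s / 2) = ev (Suc j) powr s"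
      unfolding powr_add[symmetric] by simp
    moreover have "(c * a) * (c * b) = (c * c) * (a * b)" for a b c :: real by (simp add: algebra_simps)
    ultimately show ?thesis unfolding frac_laplacian_half(2)[OF u] frac_laplacian_half(2)[OF v]
      by (simp only:)
  qed
  ultimately have "(\<lambda>j. ev (Suc j) powr s * (B.co u j * B.co v j))
      sums ip M (frac_laplacian \<Omega> ev \<phi> (s / 2) u) (frac_laplacian \<Omega> ev \<phi> (s / 2) v)" by simp
  from sums_unique2[OF this B.D_sums[OF u v]] show ?thesis by (simp add: ip_def)
qed

lemma weak_solutionI:
  assumes "B.FE u" and "\<And>v. B.FE v \<Longrightarrow> B.D u v = \<mu> * ip M u v + (LINT x|M. \<bar>u x\<bar> powr (p - 2) * u x * v x)"
  shows "weak_solution \<Omega> D ev \<phi> s \<mu> u"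
  unfolding weak_solution_def p_def[symmetric]
proof (intro conjI ballI)
  show "u \<in> Hs \<Omega> D ev \<phi> s" using assms(1) by (simp add: Hs_iff)
  fix v assume "v \<in> Hs \<Omega> D ev \<phi> s"
  then have v: "B.FE v" by (simp add: Hs_iff)
  show "(LINT x|M. frac_laplacian \<Omega> ev \<phi> (s / 2) u x * frac_laplacian \<Omega> ev \<phi> (s / 2) v x)
      = \<mu> * (LINT x|M. u x * v x) + (LINT x|M. \<bar>u x\<bar> powr (p - 2) * u x * v x)"
    using assms(2)[OF v] unfolding integral_frac_laplacians[OF assms(1) v] ip_def by simp
qed

abbreviation S where "S \<equiv> sobolev_const \<Omega> D ev \<phi> s"

text \<open>A function outside \<open>L\<^sup>p\<close> contributes the value \<open>0\<close> to the infimum that defines \<open>S\<close>, as its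
  integral and the quotient by it are \<open>0\<close> by convention. A positive infimum therefore contains
  the embedding into \<open>L\<^sup>p\<close> along with its best constant.\<close>

lemma sobolev_inequality:
  assumes u: "B.FE u" shows "u \<in> Lp M p" "S * (Lp_norm M p u)\<^sup>2 \<le> B.E u"
proof -
  have [measurable]: "u \<in> borel_measurable M" by (rule sqintD[OF B.FE_sqint[OF u]])
  have "u \<in> Lp M p \<and> S * (Lp_norm M p u)\<^sup>2 \<le> B.E u"
  proof (cases "AE x in M. u x = 0")
    case True
    then have AE: "AE x in M. \<bar>u x\<bar> powr p = 0" by eventually_elim simp
    have "integrable M (\<lambda>x. \<bar>u x\<bar> powr p) \<longleftrightarrow> integrable M (\<lambda>x. 0::real)"
      using AE by (intro integrable_cong_AE) measurable
    moreover have "Lp_int M p u = 0" unfolding Lp_int_def using AE by (rule integral_eq_zero_AE)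
    ultimately show ?thesis using B.E_nonneg[OF u] by (simp add: Lp_def Lp_norm_def)
  next
    case False
    have le: "S \<le> B.E u / (Lp_norm M p u)\<^sup>2"
      using sobolev_const_le[OF _ False] u by (simp add: Hs_iff energy_norm_eq)
    then have nz: "(Lp_norm M p u)\<^sup>2 \<noteq> 0" using sobolev_pos by auto
    then have "Lp_int M p u \<noteq> 0" by (auto simp: Lp_norm_def)
    then have "integrable M (\<lambda>x. \<bar>u x\<bar> powr p)"
      unfolding Lp_int_def using not_integrable_integral_eq by blast
    moreover have "0 < (Lp_norm M p u)\<^sup>2" using nz by simp
    ultimately show ?thesis using le by (simp add: Lp_def pos_le_divide_eq)
  qed
  then show "u \<in> Lp M p" "S * (Lp_norm M p u)\<^sup>2 \<le> B.E u" by auto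
qed

lemma small_sets:
  assumes e: "0 < e" shows "\<exists>A\<in>sets M. 0 < measure M A \<and> measure M A < e"
proof -
  obtain x where "x \<in> \<Omega>" using dom by blast
  then obtain r where r: "0 < r" "ball x r \<subseteq> \<Omega>" using dom open_contains_ball by blast
  define b where "b = unit_ball_vol (real DIM(real^'n))"
  have b: "0 < b" unfolding b_def by simp
  define t where "t = min (min r 1) (e / (2 * b))"
  have t: "0 < t" "t \<le> r" "t \<le> 1" "t \<le> e / (2 * b)" using r e b by (auto simp: t_def)
  have sub: "ball x t \<subseteq> \<Omega>" using r t by (meson order_trans subset_ball)
  have sets: "ball x t \<in> sets M" using sub dom_lmeasurable by (auto simp: sets_restrict_space_iff)
  have "measure M (ball x t) = measure lebesgue (ball x t)"
    using sub dom_lmeasurable by (intro measure_restrict_space) auto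
  also have "\<dots> = b * t ^ DIM(real^'n)"
    unfolding b_def using content_ball[of t x] t by simp
  finally have m: "measure M (ball x t) = b * t ^ DIM(real^'n)" .
  have "t ^ DIM(real^'n) \<le> t ^ 1" using t by (intro power_decreasing) auto
  then have "b * t ^ DIM(real^'n) \<le> b * (e / (2 * b))" using t b by (intro mult_left_mono) auto
  also have "\<dots> < e" using e b by simp
  finally show ?thesis using sets m b t by (intro bexI[of _ "ball x t"]) auto
qed

sublocale B: sobolev_embedding M "\<lambda>j. \<phi> (Suc j)" "\<lambda>j. ev (Suc j) powr s" p S
  by unfold_locales (use p_gt_2 sobolev_pos small_sets sobolev_inequality in auto)

end

section \<open>Two solutions of the critical problem\<close>

theorem theorem1:
  fixes \<Omega> \<Sigma>D \<Sigma>N :: "(real^'n) set"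
    and s \<alpha> \<mu> S V \<delta> :: real
    and ev \<Lambda> :: "nat \<Rightarrow> real"
    and \<phi> :: "nat \<Rightarrow> real^'n \<Rightarrow> real"
    and k m :: nat
  assumes s: "1/2 < s" "s < 1" "2 * s < real CARD('n)"
    and dom: "open \<Omega>" "connected \<Omega>" "\<Omega> \<noteq> {}" "bounded \<Omega>" "smooth_boundary \<Omega>"
    and parts: "\<Sigma>D \<inter> \<Sigma>N = {}" "\<Sigma>D \<union> \<Sigma>N = frontier \<Omega>"
    and mfd: "closed \<Sigma>D"
      "smooth_submanifold_with_boundary (CARD('n) - 1) \<Sigma>D"
      "smooth_submanifold_with_boundary (CARD('n) - 1) \<Sigma>N"
      "smooth_submanifold (CARD('n) - 2) (\<Sigma>D \<inter> closure \<Sigma>N)"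
    and meas: "0 < \<alpha>" "hausdorff_measure (CARD('n) - 1) \<Sigma>D = ennreal \<alpha>"
      "ennreal \<alpha> < hausdorff_measure (CARD('n) - 1) (frontier \<Omega>)"
    and eig: "mixed_laplace_eigensystem \<Omega> \<Sigma>D ev \<phi>"
    and Lam: "\<And>i. \<Lambda> i = ev i powr s"
    and mult: "k \<ge> 2" "m \<ge> 1" "\<Lambda> (k - 1) < \<Lambda> k"
      "\<forall>i\<in>{k..k + m - 1}. \<Lambda> i = \<Lambda> k" "\<Lambda> (k + m - 1) < \<Lambda> (k + m)"
    and S: "S = sobolev_const \<Omega> \<Sigma>D ev \<phi> s"
    and V: "V = measure lebesgue \<Omega> powr (- (2 * s / real CARD('n)))"
    and \<delta>: "\<delta> = min ((\<Lambda> k - \<Lambda> (k - 1)) / (\<Lambda> (k - 1) + V * S))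
                   ((\<Lambda> (k + m) - \<Lambda> k) / \<Lambda> (k + m)) * V * S"
    and \<mu>: "\<Lambda> k - \<delta> < \<mu>" "\<mu> < \<Lambda> k"
  shows "\<exists>u1 u2. weak_solution \<Omega> \<Sigma>D ev \<phi> s \<mu> u1 \<and> weak_solution \<Omega> \<Sigma>D ev \<phi> s \<mu> u2 \<and>
           \<not> (AE x in lebesgue_on \<Omega>. u1 x = 0) \<and> \<not> (AE x in lebesgue_on \<Omega>. u2 x = 0) \<and>
           \<not> (AE x in lebesgue_on \<Omega>. u1 x = u2 x)"
proof -
  define p where "p = crit_exp CARD('n) s"
  interpret E: mixed_eigensystem \<Omega> \<Sigma>D ev \<phi> s p
    using s dom eig by unfold_locales (auto simp: p_def)
  \<comment> \<open>the interval for \<open>\<mu>\<close> is nonempty only if \<open>\<delta>\<close>, and with it \<open>S\<close>, does not vanish\<close>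
  have "0 < \<delta>" using \<mu> by simp
  then have "S \<noteq> 0" using \<delta> by auto
  then have Spos: "0 < S" using E.sobolev_const_nonneg S by simp
  interpret P: positive_sobolev_const \<Omega> \<Sigma>D ev \<phi> s p
    by unfold_locales (use Spos S in simp)
  define v where "v = measure lebesgue \<Omega>"
  have mv: "measure (lebesgue_on \<Omega>) (space (lebesgue_on \<Omega>)) = v"
    unfolding v_def space_lebesgue_on using E.dom_lmeasurable by (intro measure_restrict_space) auto
  have v: "0 < v"
  proof -
    obtain A where "0 < measure (lebesgue_on \<Omega>) A"
      using P.small_sets[of 1] by auto
    moreover have "measure (lebesgue_on \<Omega>) A \<le> v"
      using E.M.bounded_measure[of A] unfolding mv .
    ultimately show ?thesis by linarith
  qed
  have V0: "0 < V" using v unfolding V v_def by simp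
  define X where "X = V * S"
  have X: "0 < X" using V0 Spos by (simp add: X_def)
  have \<Lambda>0: "0 < \<Lambda> i" if "1 \<le> i" for i using P.ev_pos[OF that] by (simp add: Lam)
  have L1: "0 < \<Lambda> (k - 1)" "0 < \<Lambda> k" "0 < \<Lambda> (k + m)" using mult(1) by (auto intro!: \<Lambda>0)
  have gap1: "\<Lambda> (k - 1) < \<mu>"
  proof -
    have "\<delta> \<le> (\<Lambda> k - \<Lambda> (k - 1)) / (\<Lambda> (k - 1) + X) * X"
      unfolding \<delta> mult.assoc[of "min _ _"] X_def[symmetric] using X by (intro mult_right_mono) auto
    also have "\<dots> = (\<Lambda> k - \<Lambda> (k - 1)) * (X / (\<Lambda> (k - 1) + X))" by simp
    also have "\<dots> \<le> (\<Lambda> k - \<Lambda> (k - 1)) * 1"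
      using X L1 mult(3) by (intro mult_left_mono) auto
    finally show ?thesis using \<mu> by simp
  qed
  have small: "\<Lambda> k - \<mu> < X"
  proof -
    have "\<delta> \<le> (\<Lambda> (k + m) - \<Lambda> k) / \<Lambda> (k + m) * X"
      unfolding \<delta> mult.assoc[of "min _ _"] X_def[symmetric] using X by (intro mult_right_mono) auto
    also have "\<dots> \<le> 1 * X" using X L1 by (intro mult_right_mono) auto
    finally show ?thesis using \<mu> by simp
  qed
  have exponent: "1 - 2 / p = 2 * s / real CARD('n)"
    using s by (simp add: p_def crit_exp_def field_simps)
  have small_gap: "(\<Lambda> k - \<mu>) * v powr (1 - 2 / p) < S"
  proof -
    have "(\<Lambda> k - \<mu>) * v powr (1 - 2 / p) < X * v powr (1 - 2 / p)"
      using small v by (intro mult_strict_right_mono) auto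
    also have "\<dots> = S"
      unfolding X_def V exponent v_def[symmetric] using v by (simp add: powr_minus)
    finally show ?thesis .
  qed
  have k: "Suc (k - 1) = k" "Suc (k - 1 - 1) = k - 1" using mult(1) by auto
  \<comment> \<open>basis functions are numbered from \<open>0\<close> there, so that \<open>\<Lambda> k\<close> has index \<open>k - 1\<close>\<close>
  interpret G: spectral_gap "lebesgue_on \<Omega>" "\<lambda>j. \<phi> (Suc j)" "\<lambda>j. ev (Suc j) powr s" p S \<mu> "k - 1"
  proof -
    have S': "P.S = S" using S by simp
    interpret sobolev_embedding "lebesgue_on \<Omega>" "\<lambda>j. \<phi> (Suc j)" "\<lambda>j. ev (Suc j) powr s" p S
      using P.B.sobolev_embedding_axioms unfolding S' .
    show "spectral_gap (lebesgue_on \<Omega>) (\<lambda>j. \<phi> (Suc j)) (\<lambda>j. ev (Suc j) powr s) p S \<mu> (k - 1)"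
    proof unfold_locales
      show "0 < k - 1" using mult(1) by simp
      show "0 \<le> \<mu>" using gap1 L1 by simp
      show "ev (Suc (k - 1 - 1)) powr s < \<mu>" using gap1 unfolding k Lam .
      show "\<mu> < ev (Suc (k - 1)) powr s" using \<mu>(2) unfolding k Lam .
      show "(ev (Suc (k - 1)) powr s - \<mu>) * measure (lebesgue_on \<Omega>) (space (lebesgue_on \<Omega>)) powr (1 - 2 / p) < S"
        using small_gap unfolding mv k Lam .
    qed
  qed
  obtain u where u: "P.B.FE u" and nz: "\<not> (AE x in lebesgue_on \<Omega>. u x = 0)"
    and eq: "\<And>h. P.B.FE h \<Longrightarrow> P.B.D u h = \<mu> * ip (lebesgue_on \<Omega>) u h
        + (LINT x|lebesgue_on \<Omega>. \<bar>u x\<bar> powr (p - 2) * u x * h x)"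
    using G.nontrivial_weak_solution by blast
  have u': "P.B.FE (\<lambda>x. - u x)" using P.B.FE_cmult[OF u, of "-1"] by simp
  have "weak_solution \<Omega> \<Sigma>D ev \<phi> s \<mu> u" by (rule P.weak_solutionI[OF u eq])
  moreover have "weak_solution \<Omega> \<Sigma>D ev \<phi> s \<mu> (\<lambda>x. - u x)"
  proof (rule P.weak_solutionI[OF u'])
    fix h assume h: "P.B.FE h"
    show "P.B.D (\<lambda>x. - u x) h = \<mu> * ip (lebesgue_on \<Omega>) (\<lambda>x. - u x) h
        + (LINT x|lebesgue_on \<Omega>. \<bar>- u x\<bar> powr (p - 2) * (- u x) * h x)"
      using P.B.D_cmult_left[OF u h, of "-1"] ip_cmult_left[of "lebesgue_on \<Omega>" "-1" u h] eq[OF h] by simp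
  qed
  moreover have "\<not> (AE x in lebesgue_on \<Omega>. - u x = 0)" using nz by simp
  moreover have "\<not> (AE x in lebesgue_on \<Omega>. u x = - u x)" using nz by simp
  ultimately show ?thesis using nz by blast
qed

end
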